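(* (1) If $\mathfrak g$ is of type $A_{2n-1}^{(2)}$ ($n\ge3$) and $\Lambda$ is a dominant integral weight of level $1$, then for every $m\ge0$ the map $$\pi:\mathcal Z(\Lambda)_{\Lambda-m\delta}\longrightarrow\bigsqcup_{m_1+2m_2=m}\mathcal P^{(n)}(m_1)\times\mathcal{DP}_0(m_2)$$ is a bijection. (2) If $\mathfrak g$ is of type $D_{n+1}^{(1)}$ ($n\ge3$) and $\Lambda$ is a dominant integral weight of level $1$, then for every $m\ge0$ the map $$\pi:\mathcal Z(\Lambda)_{\Lambda-m\delta}\longrightarrow\bigsqcup_{m_1+m_2+m_3=m}\mathcal P^{(n-1)}(m_1)\times\mathcal P_0(m_2)\times\mathcal{DP}_0(m_3)$$ is a bijection. Here $\pi(Y)=(\pi_0(Y),\pi_1(\widetilde Y))$.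
   Context: **Types and weights.** Type $A_{2n-1}^{(2)}$ ($n\ge3$): colors $0,\dots,n$, $\delta=\alpha_0+\alpha_1+2(\alpha_2+\cdots+\alpha_{n-1})+\alpha_n$, level 1 weights $\Lambda\in\{\Lambda_0,\Lambda_1\}$, $\ell=L=2n-1$. Type $D_{n+1}^{(1)}$ ($n\ge3$): colors $0,\dots,n+1$, $\delta=\alpha_0+\alpha_1+2(\alpha_2+\cdots+\alpha_{n-1})+\alpha_n+\alpha_{n+1}$, level 1 weights $\Lambda\in\{\Lambda_0,\Lambda_1,\Lambda_n,\Lambda_{n+1}\}$, $\ell=n$, $L=2n$. **Proper Young walls.** There are infinitely many columns, numbered $1,2,\dots$ from right to left. Each column is a stack of unit-height floors. A floor is either one unit cube of the indicated color, or a "split floor" $\{i,j\}$ made of two half-thickness blocks of colors $i,j$ in two positions called A and B. The floors from bottom to top are, repeated cyclically: for $A_{2n-1}^{(2)}$: $\{0,1\},2,\dots,n-1,n,n-1,\dots,2$; for $D_{n+1}^{(1)}$ with $\Lambda\in\{\Lambda_0,\Lambda_1\}$: $\{0,1\},2,\dots,n-1,\{n,n+1\},n-1,\dots,2$; for $D_{n+1}^{(1)}$ with $\Lambda\in\{\Lambda_n,\Lambda_{n+1}\}$: $\{n,n+1\},n-1,\dots,2,\{0,1\},2,\dots,n-1$. On a floor $\{0,1\}$ of column $k$, position A has color $1$ for $k$ odd and $0$ for $k$ even, except that for $\Lambda=\Lambda_1$ this is reversed; on a floor $\{n,n+1\}$ of column $k$, position A has color $n+1$ for $k$ odd and $n$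 for $k$ even, except that for $\Lambda=\Lambda_{n+1}$ this is reversed; position B has the other color. The ground state wall $Y_\Lambda$ consists of the A-block of the bottom floor in every column. A Young wall $Y=(y_k)_{k\ge1}$ is obtained by adding finitely many blocks, where a floor may be started only when the floor below it is completely filled, the two blocks of a split floor above the bottom may be added in either order, and there is no free space to the right of any block (if a place is occupied in column $k+1$, the same place is occupied in column $k$). $|y_k|$ is the number of added blocks in column $k$; the top floor of column $k$ is half-filled iff $\ell\mid|y_k|$. A column is full if its top floor is completely filled, i.e. $\ell\nmid|y_k|$. $Y$ is proper if no two full columns have the same height. Equivalently, a proper Young wall is a partition $(|y_k|)_k$ whose parts not divisible by $\ell$ are distinct, with a choice A or B for each positive part divisible by $\ell$ (the position of the top half-block), equal parts having equal choices. $\mathcal Z(\Lambda)$ is the set of proper Young walls, $\mathrm{wt}(Y)=\Lambda-\sum_ik_i\alpha_i$ with $k_i$ the number of added $i$-blocks, and $\mathcal Z(\Lambda)_\lambda=\{Y:\mathrm{wt}(Y)=\lambda\}$. $\mathcal Z(\Lambda)'$ is the set of $Y\in\mathcal Z(\Lambda)$ with all $|y_k|\equiv0\pmod\ell$. **Beads.** Place a bead at position $|y_k|$ for each nonzero $|y_k|$, colored gray if the top block of column $k$ is a half-thickness block in position B on a half-filled floor, and white otherwise. Runners: $R_k=\{s>0: s\equiv k \pmod L\}$ for $1\le k<L$, $k\neq\ell$ (type I, at most one bead per position), and $R_\ell$ is the set of positive multiples of $\ell$. The bead configuration determines $Y$. Operations: $(B_1)$ if a bead is at $s>L$ in a runner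 of type I and there is no bead at $s-L$, move it to $s-L$ and switch the color (white/gray) of all beads in $R_\ell$ at positions $k$ with $s-L<k<s$; $(B_2)$ if there are beads at $s$ and $L-s$ with $1\le s\le n-1$, remove both and, if $s<\ell<L-s$, switch the color of all beads at $\ell$. $\widetilde Y$ is the proper Young wall obtained from $Y$ by applying $(B_1),(B_2)$ until neither applies (independent of choices). **Partitions.** $\mathcal P(m)$: partitions of $m$. $\mathcal P^{(k)}(m)$: $k$-tuples of partitions of total size $m$. $\mathcal P_0(m)$: partitions with empty 2-core and 2-weight $m$ (so of size $2m$). A partition is 2-reduced if $\lambda_i-\lambda_{i+1}\le1$ for all $i\ge1$ (trailing zeros included). $\mathcal{DP}_0(m)$: 2-reduced partitions with empty 2-core and 2-weight $m$. Frobenius notation: $(\lambda'|\lambda'')$, for strictly decreasing sequences of non-negative integers of the same length $r$, is the partition $\lambda$ with exactly $r$ diagonal boxes, $\lambda_k=\lambda''_k+k$ and $\lambda^t_k=\lambda'_k+k$ for $1\le k\le r$. **$\pi_0$.** Let $Y\in\mathcal Z(\Lambda)_{\Lambda-m\delta}$. For $1\le k\le n-1$, $R_k$ and $R_{L-k}$ contain equally many beads. For $j\in\{k,L-k\}$ with bead positions $N_1>\cdots>N_r$ in $R_j$, put $\mu^{(j)}=((N_i-j)/L)_{1\le i\le r}$, and $\lambda^{(k)}=(\mu^{(k)}|\mu^{(L-k)})$. Then $\pi_0(Y)=(\lambda^{(1)},\dots,\lambda^{(n-1)})$. **$\pi_1$.** A two-colored partition is a partition whose positive parts are each colored white (written $k$)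 or gray (written $\underline k$). $\mathcal P'$ is the set of those in which $k$ and $\underline k$ never both occur, for every $k\ge1$. Addition is partwise, $(\lambda+\mu)_k=\lambda_k+\mu_k$, where a sum of two positive parts is white if they have the same color and gray otherwise, and $a+0=a$. Ordinary partitions are regarded as all white. For $Y\in\mathcal Z(\Lambda)'$, $\lambda_Y\in\mathcal P'$ has $k$ (resp. $\underline k$) with multiplicity the number of white (resp. gray) beads at $k\ell$. Every $\lambda\in\mathcal P'$ is uniquely $\lambda=\lambda^0+\lambda^1$ with $\lambda^0$ an ordinary (white) partition and $\lambda^1\in\mathcal P'$ which is 2-reduced and either empty or of the form $(\underline1^{m_1},2^{m_2},\underline3^{m_3},\dots)$ with $m_1\ne0$ (odd parts gray, even parts white). For $Z\in\mathcal Z(\Lambda)'$, $\pi_1(Z)=((\lambda_Z)^0,(\lambda_Z)^1)$, the second entry being viewed as an ordinary partition. In (1), $\pi(Y)$ is read with $(\lambda^{(1)},\dots,\lambda^{(n-1)},(\lambda_{\widetilde Y})^0)\in\mathcal P^{(n)}(m_1)$ and $(\lambda_{\widetilde Y})^1\in\mathcal{DP}_0(m_2)$. *)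

theory Defs
  imports Main "HOL-Library.Multiset"
begin

section \<open>Affine types and their level one data\<close>

text \<open>\<open>A2 n\<close> stands for type \<open>A\<close> with subscript \<open>2n-1\<close> and superscript \<open>(2)\<close>, and \<open>D1 n\<close> for type
  \<open>D\<close> with subscript \<open>n+1\<close> and superscript \<open>(1)\<close>. The fundamental weight with index \<open>i\<close> is
  represented by its index \<open>i\<close>.\<close>

datatype affine_type = A2 nat | D1 nat

fun rk :: "affine_type \<Rightarrow> nat" where
  "rk (A2 n) = n"
| "rk (D1 n) = n"

fun ell :: "affine_type \<Rightarrow> nat" where
  "ell (A2 n) = 2 * n - 1"
| "ell (D1 n) = n"

fun Lper :: "affine_type \<Rightarrow> nat" where
  "Lper (A2 n) = 2 * n - 1"
| "Lper (D1 n) = 2 * n"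

fun level1 :: "affine_type \<Rightarrow> nat set" where
  "level1 (A2 n) = {0, 1}"
| "level1 (D1 n) = {0, 1, n, n + 1}"

text \<open>Coefficient of the \<open>i\<close>-th simple root in the null root.\<close>

fun delta :: "affine_type \<Rightarrow> nat \<Rightarrow> int" where
  "delta (A2 n) i = (if i \<in> {0, 1, n} then 1 else if i \<in> {2..n - 1} then 2 else 0)"
| "delta (D1 n) i = (if i \<in> {0, 1, n, n + 1} then 1 else if i \<in> {2..n - 1} then 2 else 0)"


section \<open>Proper Young walls\<close>

datatype floor_kind = Unit_Cube nat | Split nat nat

datatype slot = Whole | PosA | PosB

fun floor_cycle :: "affine_type \<Rightarrow> nat \<Rightarrow> floor_kind list" where
  "floor_cycle (A2 n) \<Lambda> =
     Split 0 1 # map Unit_Cube [2..<n] @ Unit_Cube n # map Unit_Cube (rev [2..<n])"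
| "floor_cycle (D1 n) \<Lambda> =
     (if \<Lambda> \<in> {n, n + 1}
      then Split n (n + 1) # map Unit_Cube (rev [2..<n]) @ Split 0 1 # map Unit_Cube [2..<n]
      else Split 0 1 # map Unit_Cube [2..<n] @ Split n (n + 1) # map Unit_Cube (rev [2..<n]))"

text \<open>Floors are numbered from the bottom, starting with \<open>0\<close>.\<close>

definition floor_at :: "affine_type \<Rightarrow> nat \<Rightarrow> nat \<Rightarrow> floor_kind" where
  "floor_at X \<Lambda> h = floor_cycle X \<Lambda> ! (h mod length (floor_cycle X \<Lambda>))"

fun floor_slots :: "floor_kind \<Rightarrow> slot set" where
  "floor_slots (Unit_Cube i) = {Whole}"
| "floor_slots (Split i j) = {PosA, PosB}"

text \<open>On a floor \<open>Split i j\<close> (which is \<open>{0, 1}\<close> or \<open>{n, n + 1}\<close>) position A has colour \<open>j\<close> in the odd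
  columns and \<open>i\<close> in the even ones, except that this is reversed if the weight has index \<open>j\<close>.\<close>

fun slot_colour :: "nat \<Rightarrow> nat \<Rightarrow> floor_kind \<Rightarrow> slot \<Rightarrow> nat" where
  "slot_colour \<Lambda> k (Unit_Cube i) s = i"
| "slot_colour \<Lambda> k (Split i j) s =
     (let a = (if odd k \<longleftrightarrow> \<Lambda> \<noteq> j then j else i); b = (if odd k \<longleftrightarrow> \<Lambda> \<noteq> j then i else j)
      in if s = PosA then a else b)"

text \<open>A wall is the set of its occupied places \<open>(k, h, s)\<close>: column \<open>k \<ge> 1\<close> (counted from the right),
  floor \<open>h\<close>, slot \<open>s\<close>.\<close>

type_synonym wall = "(nat \<times> nat \<times> slot) set"

definition ground_wall :: wall where
  "ground_wall = {(k, h, s). k \<ge> 1 \<and> h = 0 \<and> s = PosA}"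

definition young_wall :: "affine_type \<Rightarrow> nat \<Rightarrow> wall \<Rightarrow> bool" where
  "young_wall X \<Lambda> Y \<longleftrightarrow>
     ground_wall \<subseteq> Y \<and> finite (Y - ground_wall) \<and>
     (\<forall>k h s. (k, h, s) \<in> Y \<longrightarrow> k \<ge> 1 \<and> s \<in> floor_slots (floor_at X \<Lambda> h)) \<and>
     (\<forall>k h s. (k, Suc h, s) \<in> Y \<longrightarrow> (\<forall>t \<in> floor_slots (floor_at X \<Lambda> h). (k, h, t) \<in> Y)) \<and>
     (\<forall>k\<ge>1. \<forall>h s. (Suc k, h, s) \<in> Y \<longrightarrow> (k, h, s) \<in> Y)"

definition top_floor :: "wall \<Rightarrow> nat \<Rightarrow> nat" where
  "top_floor Y k = Max {h. \<exists>s. (k, h, s) \<in> Y}"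

definition full_column :: "affine_type \<Rightarrow> nat \<Rightarrow> wall \<Rightarrow> nat \<Rightarrow> bool" where
  "full_column X \<Lambda> Y k \<longleftrightarrow>
     (\<forall>s \<in> floor_slots (floor_at X \<Lambda> (top_floor Y k)). (k, top_floor Y k, s) \<in> Y)"

definition proper_walls :: "affine_type \<Rightarrow> nat \<Rightarrow> wall set" where
  "proper_walls X \<Lambda> = {Y. young_wall X \<Lambda> Y \<and>
     (\<forall>j\<ge>1. \<forall>k\<ge>1. j \<noteq> k \<and> full_column X \<Lambda> Y j \<and> full_column X \<Lambda> Y k \<longrightarrow>
        top_floor Y j \<noteq> top_floor Y k)}"

definition added_count :: "wall \<Rightarrow> nat \<Rightarrow> nat" where
  "added_count Y k = card {(h, s). (k, h, s) \<in> Y - ground_wall}"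

definition colour_count :: "affine_type \<Rightarrow> nat \<Rightarrow> wall \<Rightarrow> nat \<Rightarrow> nat" where
  "colour_count X \<Lambda> Y i =
     card {(k, h, s). (k, h, s) \<in> Y - ground_wall \<and> slot_colour \<Lambda> k (floor_at X \<Lambda> h) s = i}"

text \<open>A weight in the coset of the highest weight modulo the root lattice is represented by the
  coordinates, with respect to the (linearly independent) simple roots, of its difference from the
  highest weight.\<close>

definition wt :: "affine_type \<Rightarrow> nat \<Rightarrow> wall \<Rightarrow> nat \<Rightarrow> int" where
  "wt X \<Lambda> Y i = - int (colour_count X \<Lambda> Y i)"

definition proper_walls_wt :: "affine_type \<Rightarrow> nat \<Rightarrow> (nat \<Rightarrow> int) \<Rightarrow> wall set" where
  "proper_walls_wt X \<Lambda> \<mu> = {Y \<in> proper_walls X \<Lambda>. wt X \<Lambda> Y = \<mu>}"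


section \<open>Beads\<close>

datatype colour = White | Gray

fun switch :: "colour \<Rightarrow> colour" where
  "switch White = Gray"
| "switch Gray = White"

text \<open>A bead configuration is a multiset of pairs (position, colour).\<close>

definition bead_colour :: "wall \<Rightarrow> nat \<Rightarrow> colour" where
  "bead_colour Y k =
     (if (k, top_floor Y k, PosB) \<in> Y \<and> (k, top_floor Y k, PosA) \<notin> Y then Gray else White)"

definition beads :: "wall \<Rightarrow> (nat \<times> colour) multiset" where
  "beads Y = {# (added_count Y k, bead_colour Y k). k \<in># mset_set {k. k \<ge> 1 \<and> added_count Y k \<noteq> 0} #}"

definition runner :: "affine_type \<Rightarrow> nat \<Rightarrow> nat set" where
  "runner X k = (if k = ell X then {s. s > 0 \<and> ell X dvd s} else {s. s > 0 \<and> s mod Lper X = k mod Lper X})"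

definition type_I :: "affine_type \<Rightarrow> nat \<Rightarrow> bool" where
  "type_I X k \<longleftrightarrow> 1 \<le> k \<and> k < Lper X \<and> k \<noteq> ell X"

definition switch_at :: "nat set \<Rightarrow> (nat \<times> colour) multiset \<Rightarrow> (nat \<times> colour) multiset" where
  "switch_at P C = {# (if p \<in> P then (p, switch c) else (p, c)). (p, c) \<in># C #}"

inductive bead_step ::
  "affine_type \<Rightarrow> (nat \<times> colour) multiset \<Rightarrow> (nat \<times> colour) multiset \<Rightarrow> bool"
  for X :: affine_type where
  B1: "\<lbrakk>(s, c) \<in># C; s > Lper X; type_I X k; s \<in> runner X k; s - Lper X \<notin># image_mset fst C\<rbrakk> \<Longrightarrow>
     bead_step X C (add_mset (s - Lper X, c)
       (switch_at {p \<in> runner X (ell X). s - Lper X < p \<and> p < s} (C - {#(s, c)#})))"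
| B2: "\<lbrakk>(s, c) \<in># C; (Lper X - s, d) \<in># C; 1 \<le> s; s \<le> rk X - 1\<rbrakk> \<Longrightarrow>
     bead_step X C (switch_at (if s < ell X \<and> ell X < Lper X - s then {ell X} else {})
       (C - {#(s, c), (Lper X - s, d)#}))"

text \<open>The wall \<open>Y\<close> with a tilde: the end result of the bead operations, starting from \<open>Y\<close>.\<close>

definition reduced_wall :: "affine_type \<Rightarrow> nat \<Rightarrow> wall \<Rightarrow> wall" where
  "reduced_wall X \<Lambda> Y =
     (THE Z. Z \<in> proper_walls X \<Lambda> \<and> (bead_step X)\<^sup>*\<^sup>* (beads Y) (beads Z) \<and>
             (\<nexists>C. bead_step X (beads Z) C))"


section \<open>Partitions\<close>

text \<open>A partition is the sequence of its parts, padded with zeros; \<open>p i\<close> is the part with index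
  \<open>i + 1\<close> in the usual numbering.\<close>

definition is_partition :: "(nat \<Rightarrow> nat) \<Rightarrow> bool" where
  "is_partition p \<longleftrightarrow> antimono p \<and> finite {i. p i \<noteq> 0}"

definition psize :: "(nat \<Rightarrow> nat) \<Rightarrow> nat" where
  "psize p = (\<Sum>i | p i \<noteq> 0. p i)"

definition conj_part :: "(nat \<Rightarrow> nat) \<Rightarrow> nat \<Rightarrow> nat" where
  "conj_part p j = card {i. j < p i}"

definition multipartitions :: "nat \<Rightarrow> nat \<Rightarrow> (nat \<Rightarrow> nat) list set" where
  "multipartitions r m =
     {ps. length ps = r \<and> (\<forall>p \<in> set ps. is_partition p) \<and> sum_list (map psize ps) = m}"

definition diagram :: "(nat \<Rightarrow> nat) \<Rightarrow> (nat \<times> nat) set" where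
  "diagram p = {(i, j). j < p i}"

definition domino_removal :: "(nat \<Rightarrow> nat) \<Rightarrow> (nat \<Rightarrow> nat) \<Rightarrow> bool" where
  "domino_removal p q \<longleftrightarrow> is_partition p \<and> is_partition q \<and> diagram q \<subseteq> diagram p \<and>
     (\<exists>i j. diagram p - diagram q = {(i, j), (i, j + 1)} \<or>
            diagram p - diagram q = {(i, j), (i + 1, j)})"

text \<open>\<open>two_core_weight p c w\<close>: the partition \<open>p\<close> has 2-core \<open>c\<close> and 2-weight \<open>w\<close>.\<close>

definition two_core_weight :: "(nat \<Rightarrow> nat) \<Rightarrow> (nat \<Rightarrow> nat) \<Rightarrow> nat \<Rightarrow> bool" where
  "two_core_weight p c w \<longleftrightarrow>
     is_partition p \<and> (domino_removal ^^ w) p c \<and> (\<nexists>q. domino_removal c q)"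

definition P0 :: "nat \<Rightarrow> (nat \<Rightarrow> nat) set" where
  "P0 m = {p. two_core_weight p (\<lambda>_. 0) m}"

definition two_reduced :: "(nat \<Rightarrow> nat) \<Rightarrow> bool" where
  "two_reduced p \<longleftrightarrow> (\<forall>i. p i - p (Suc i) \<le> 1)"

definition DP0 :: "nat \<Rightarrow> (nat \<Rightarrow> nat) set" where
  "DP0 m = {p \<in> P0 m. two_reduced p}"

text \<open>\<open>frobenius xs ys\<close> is the partition with Frobenius notation \<open>(xs|ys)\<close>; the legs come first.\<close>

definition frobenius :: "nat list \<Rightarrow> nat list \<Rightarrow> nat \<Rightarrow> nat" where
  "frobenius xs ys = (THE p. is_partition p \<and> length xs = length ys \<and>
     card {i. i < p i} = length xs \<and>
     (\<forall>i < length xs. p i = ys ! i + (i + 1) \<and> conj_part p i = xs ! i + (i + 1)))"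


section \<open>The map from walls to tuples of partitions\<close>

definition mu_seq :: "affine_type \<Rightarrow> wall \<Rightarrow> nat \<Rightarrow> nat list" where
  "mu_seq X Y j = map (\<lambda>N. (N - j) div Lper X)
     (rev (sorted_list_of_set {s \<in> runner X j. s \<in># image_mset fst (beads Y)}))"

definition pi0 :: "affine_type \<Rightarrow> wall \<Rightarrow> (nat \<Rightarrow> nat) list" where
  "pi0 X Y = map (\<lambda>k. frobenius (mu_seq X Y k) (mu_seq X Y (Lper X - k))) [1..<rk X]"

text \<open>A two-coloured partition is a zero-padded sequence of coloured parts, where the parts \<open>0\<close> are
  white by convention. The set \<open>Pprime\<close> consists of those where equal parts have equal colours; for
  these the sequence is determined by the multiplicities of the coloured parts.\<close>

definition Pprime :: "(nat \<Rightarrow> nat \<times> colour) set" where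
  "Pprime = {x. is_partition (fst \<circ> x) \<and> (\<forall>i. fst (x i) = 0 \<longrightarrow> snd (x i) = White) \<and>
     (\<forall>i j. fst (x i) = fst (x j) \<longrightarrow> snd (x i) = snd (x j))}"

fun part_add :: "nat \<times> colour \<Rightarrow> nat \<times> colour \<Rightarrow> nat \<times> colour" where
  "part_add (a, c) (b, d) =
     (if a = 0 then (b, d) else if b = 0 then (a, c)
      else (a + b, if c = d then White else Gray))"

definition white :: "(nat \<Rightarrow> nat) \<Rightarrow> nat \<Rightarrow> nat \<times> colour" where
  "white p i = (p i, White)"

definition special_part :: "(nat \<Rightarrow> nat \<times> colour) \<Rightarrow> bool" where
  "special_part x \<longleftrightarrow> x \<in> Pprime \<and> two_reduced (fst \<circ> x) \<and>
     ((\<forall>i. fst (x i) = 0) \<or>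
      (\<exists>i. fst (x i) = 1) \<and> (\<forall>i. snd (x i) = (if odd (fst (x i)) then Gray else White)))"

definition wall_part :: "affine_type \<Rightarrow> wall \<Rightarrow> nat \<Rightarrow> nat \<times> colour" where
  "wall_part X Z = (THE x. x \<in> Pprime \<and>
     (\<forall>k\<ge>1. \<forall>c. card {i. x i = (k, c)} = count (beads Z) (k * ell X, c)))"

definition decompose :: "(nat \<Rightarrow> nat \<times> colour) \<Rightarrow> (nat \<Rightarrow> nat) \<times> (nat \<Rightarrow> nat \<times> colour)" where
  "decompose x = (THE (p, y). is_partition p \<and> special_part y \<and>
     x = (\<lambda>i. part_add (white p i) (y i)))"

definition pi1 :: "affine_type \<Rightarrow> wall \<Rightarrow> (nat \<Rightarrow> nat) \<times> (nat \<Rightarrow> nat)" where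
  "pi1 X Z = (case decompose (wall_part X Z) of (p, y) \<Rightarrow> (p, fst \<circ> y))"

definition pi_map ::
  "affine_type \<Rightarrow> nat \<Rightarrow> wall \<Rightarrow> (nat \<Rightarrow> nat) list \<times> (nat \<Rightarrow> nat) \<times> (nat \<Rightarrow> nat)" where
  "pi_map X \<Lambda> Y = (pi0 X Y, pi1 X (reduced_wall X \<Lambda> Y))"

text \<open>For type \<open>A2\<close> the first component of \<open>pi1\<close> is regarded as the last entry of the tuple.\<close>

fun regroup :: "'a list \<times> 'a \<times> 'b \<Rightarrow> 'a list \<times> 'b" where
  "regroup (ps, p, q) = (ps @ [p], q)"

end

theory Submission
  imports Defs
begin

text \<open>
  A proper Young wall is recorded by its columns: the numbers of added blocks form a partition, and a
  column whose top floor is half-filled also carries the colour (white or gray) of its bead. In the terms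
  of beads, a wall is a multiset of coloured positions in which positions not divisible by \<open>\<ell>\<close> (the
  full columns) are white and simple (lemmas \<open>wall_of_proper\<close>, \<open>proper_wall_of\<close>, \<open>columns_iff_valid\<close>).

  \<^bold>\<open>The bead moves.\<close> Each move changes the number of type I beads beyond a position of \<open>R\<^sub>\<ell>\<close> by an
  odd number exactly when it switches the colour there. So the colour of a bead in \<open>R\<^sub>\<ell>\<close>, corrected by the
  parity of the number of type I beads beyond it, never changes. If \<open>R\<^sub>k\<close> and \<open>R\<^bsub>L-k\<^esub>\<close> contain
  equally many beads for all \<open>k\<close>, a configuration without moves has no type I beads left, and therefore the
  reduced wall consists of the beads of \<open>R\<^sub>\<ell>\<close> with their corrected colours (\<open>bead_steps_to_reduce\<close>,
  \<open>bead_steps_stuck\<close>). Conversely, the set \<open>S\<close> of type I positions and the reduced wall can be prescribed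
  independently and determine the wall (\<open>valid_split\<close>, \<open>valid_join\<close>).

  \<^bold>\<open>The weight.\<close> The \<open>t\<close>-th block of a column has a colour that depends on \<open>t mod L\<close> alone, except on
  split floors, where the two colours alternate with the column. Counting residues shows that the weight is
  \<open>\<Lambda> - m\<delta>\<close> iff \<open>R\<^sub>k\<close> and \<open>R\<^bsub>L-k\<^esub>\<close> contain equally many beads, the positions sum up to \<open>L m\<close>, and the two
  colours of each split floor occur equally often (\<open>weight_iff\<close>). The last condition says that an alternating sum
  over the columns vanishes. Deleting the full columns shifts the signs of the later columns and switches
  their colours, and the two effects cancel (\<open>alt_sum_strip\<close>). So the condition can be read off from the
  reduced wall: if its coloured partition is \<open>p + q\<close> with \<open>p\<close> white and \<open>q\<close> special, then the gray parts
  are those with an odd summand from \<open>q\<close>, and it says that the odd parts of \<open>q\<close> (in type \<open>D\<close> also those of \<open>p\<close>) occur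
  equally often at even and at odd indices (\<open>weight_splits_iff\<close>). For a partition this means that it has an
  empty 2-core (\<open>P0_iff\<close>).

  \<^bold>\<open>The three parts.\<close> The set \<open>S\<close> corresponds to the tuple \<open>\<pi>\<^sub>0\<close> by Frobenius notation
  (\<open>frobenius_tuple_inject\<close>, \<open>frobenius_tuple_surj\<close>). A coloured partition is the sum of a unique white
  partition and a unique special one, which counts colour changes (\<open>compose_surj\<close>, \<open>compose_inj\<close>).
  The sum of the bead positions is additive for this splitting, which gives the equation for the sizes.
\<close>


section \<open>Partitions\<close>

lemma down_closed_eq_lessThan:
  assumes "finite (A :: nat set)" "\<And>i j. i \<in> A \<Longrightarrow> j \<le> i \<Longrightarrow> j \<in> A"
  shows "A = {..<card A}"
proof (cases "A = {}")
  case False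
  have "A = {..Max A}"
    using assms(2)[OF Max_in[OF assms(1) False]] Max_ge[OF assms(1)] by auto
  then show ?thesis
    by (metis card_atMost lessThan_Suc_atMost)
qed simp

lemma partition_finite: "is_partition p \<Longrightarrow> finite {i. j < p i}"
  unfolding is_partition_def by (elim conjE, erule rev_finite_subset) auto

lemma partition_le: "is_partition p \<Longrightarrow> i \<le> j \<Longrightarrow> p j \<le> p i"
  unfolding is_partition_def by (simp add: antimonoD)

lemma is_partitionI:
  assumes "\<And>i. p (Suc i) \<le> p i" "\<And>i. i \<ge> N \<Longrightarrow> p i = 0"
  shows "is_partition p"
proof -
  have "i < N" if "p i \<noteq> 0" for i using assms(2)[of i] that by (cases "i < N") auto
  then have "{i. p i \<noteq> 0} \<subseteq> {..<N}" by auto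
  then show ?thesis
    using assms(1) by (auto simp: is_partition_def antimono_iff_le_Suc intro: finite_subset)
qed

text \<open>The rows that reach beyond column \<open>j\<close> form an initial segment.\<close>

lemma less_conj_part_iff:
  assumes "is_partition p"
  shows "i < conj_part p j \<longleftrightarrow> j < p i"
proof -
  have "{i. j < p i} = {..<card {i. j < p i}}"
    using partition_finite[OF assms] partition_le[OF assms]
    by (intro down_closed_eq_lessThan) (auto intro: less_le_trans)
  then show ?thesis unfolding conj_part_def by blast
qed

lemma conj_part_antimono: "is_partition p \<Longrightarrow> i \<le> j \<Longrightarrow> conj_part p j \<le> conj_part p i"
  unfolding conj_part_def by (intro card_mono partition_finite) auto

lemma partition_zero_iff: "is_partition p \<Longrightarrow> p i = 0 \<longleftrightarrow> conj_part p 0 \<le> i"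
  using less_conj_part_iff[of p i 0] by auto

lemma nat_eqI_less: "(\<And>j::nat. j < a \<longleftrightarrow> j < b) \<Longrightarrow> a = b"
  by (rule antisym) (metis not_le less_irrefl)+

lemma partition_eqI:
  assumes "is_partition p" "is_partition q" "\<And>j. conj_part p j = conj_part q j"
  shows "p = q"
proof
  fix i
  have "j < p i \<longleftrightarrow> j < q i" for j
    using less_conj_part_iff[OF assms(1), of i j] less_conj_part_iff[OF assms(2), of i j]
    by (simp only: assms(3))
  then show "p i = q i" by (rule nat_eqI_less)
qed

lemma psize_eq_sum:
  assumes "\<And>i. i \<ge> N \<Longrightarrow> p i = 0"
  shows "psize p = sum p {..<N}"
proof -
  have "i < N" if "p i \<noteq> 0" for i using assms[of i] that by (cases "i < N") auto
  then show ?thesis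
    unfolding psize_def by (intro sum.mono_neutral_left) auto
qed

lemma psize_zero_iff:
  assumes "is_partition p"
  shows "psize p = 0 \<longleftrightarrow> p = (\<lambda>_. 0)"
proof -
  have "finite {i. p i \<noteq> 0}" using assms by (simp add: is_partition_def)
  then show ?thesis unfolding psize_def by (auto simp: fun_eq_iff)
qed


section \<open>Frobenius notation\<close>

text \<open>The property that \<open>frobenius xs ys\<close> is defined to satisfy uniquely.\<close>

definition is_frobenius :: "nat list \<Rightarrow> nat list \<Rightarrow> (nat \<Rightarrow> nat) \<Rightarrow> bool" where
  "is_frobenius xs ys p \<longleftrightarrow> is_partition p \<and> length xs = length ys \<and>
     card {i. i < p i} = length xs \<and>
     (\<forall>i < length xs. p i = ys ! i + (i + 1) \<and> conj_part p i = xs ! i + (i + 1))"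

lemma diagonal_iff:
  assumes "is_partition p"
  shows "i < p i \<longleftrightarrow> i < card {i. i < p i}"
proof -
  have "finite {i. i < p i}"
    using partition_finite[OF assms, of 0] by (rule rev_finite_subset) auto
  then have "{i. i < p i} = {..<card {i. i < p i}}"
    using partition_le[OF assms] by (intro down_closed_eq_lessThan) (auto intro: le_less_trans less_le_trans)
  then show ?thesis by blast
qed

lemma conj_diagonal_iff: "is_partition p \<Longrightarrow> i < conj_part p i \<longleftrightarrow> i < card {i. i < p i}"
  using less_conj_part_iff diagonal_iff by metis

text \<open>Below the diagonal a row is counted by the columns that reach it, and all of these columns
  meet the diagonal.\<close>

lemma row_below_diagonal:
  assumes "is_partition p" "r = card {i. i < p i}" "r \<le> i"
  shows "p i = card {j. j < r \<and> i < conj_part p j}"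
proof -
  have "p i \<le> p r" "p r \<le> r"
    using partition_le[OF assms(1,3)] diagonal_iff[OF assms(1), of r] assms(2) by auto
  then have "{j. j < r \<and> i < conj_part p j} = {..<p i}"
    using less_conj_part_iff[OF assms(1)] by auto
  then show ?thesis by simp
qed

lemma is_frobenius_unique:
  assumes p: "is_frobenius xs ys p" and q: "is_frobenius xs ys q"
  shows "p = q"
proof
  fix i
  let ?r = "length xs"
  show "p i = q i"
  proof (cases "i < ?r")
    case True
    then show ?thesis using p q by (simp add: is_frobenius_def)
  next
    case False
    have "{j. j < ?r \<and> i < conj_part p j} = {j. j < ?r \<and> i < conj_part q j}"
      using p q by (auto simp: is_frobenius_def)
    then show ?thesis
      using row_below_diagonal[of p ?r i] row_below_diagonal[of q ?r i] p q False
      by (simp add: is_frobenius_def)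
  qed
qed

lemma is_frobenius_coords_unique:
  assumes "is_frobenius xs ys p" "is_frobenius xs' ys' p"
  shows "xs = xs'" "ys = ys'"
  using assms unfolding is_frobenius_def by (auto intro!: nth_equalityI)

lemma sorted_desc_shift_antimono:
  fixes xs :: "nat list"
  assumes "sorted_wrt (>) xs" "j < length xs" "i \<le> j"
  shows "xs ! j + j \<le> xs ! i + i"
  using assms(3,2)
proof (induction j rule: dec_induct)
  case (step k)
  have "xs ! Suc k < xs ! k" using assms(1) step by (simp add: sorted_wrt_iff_nth_less)
  then show ?case using step by simp
qed simp

text \<open>The rows that meet the diagonal are prescribed by \<open>ys\<close>; each other row counts the legs in \<open>xs\<close>
  that reach it. Strict decrease of the two lists makes the row lengths weakly decreasing and makes the legs
  that reach a given row an initial segment.\<close>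

lemma frobenius_exists:
  assumes xs: "sorted_wrt (>) xs" and ys: "sorted_wrt (>) ys" and len: "length xs = length ys"
  shows "\<exists>p. is_frobenius xs ys p"
proof -
  define r where "r = length xs"
  define below where "below i = {j. j < r \<and> i < xs ! j + (j + 1)}" for i
  define p where "p i = (if i < r then ys ! i + (i + 1) else card (below i))" for i
  have fin: "finite (below i)" for i unfolding below_def by simp
  have below_le: "card (below i) \<le> r" for i
    using card_mono[of "{..<r}" "below i"] by (auto simp: below_def)
  have below_down: "below i = {..<card (below i)}" for i
  proof (rule down_closed_eq_lessThan[OF fin])
    fix a b assume "a \<in> below i" "b \<le> a"
    then show "b \<in> below i"
      using sorted_desc_shift_antimono[OF xs, of a b] by (auto simp: below_def r_def)
  qed
  \<comment> \<open>The diagonal square fits into the prescribed rows and columns.\<close>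
  have big: "r \<le> zs ! i + (i + 1)"
    if "i < r" "sorted_wrt (>) zs" "length zs = r" for i and zs :: "nat list"
  proof -
    have "r - 1 < length zs" "i \<le> r - 1" using that by auto
    then show ?thesis using sorted_desc_shift_antimono[OF that(2), of "r - 1" i] by linarith
  qed
  note big' = big[OF _ xs r_def[symmetric]]
  note big = big[OF _ ys, folded len, OF _ r_def[symmetric]]
  have part: "is_partition p"
  proof (rule is_partitionI)
    fix i
    consider "Suc i < r" | "Suc i = r" | "r \<le> i" by linarith
    then show "p (Suc i) \<le> p i"
    proof cases
      case 1
      then show ?thesis
        using sorted_desc_shift_antimono[OF ys, of "Suc i" i] len by (simp add: p_def r_def)
    next
      case 2
      then show ?thesis using below_le[of "Suc i"] by (simp add: p_def)
    next
      case 3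
      have "below (Suc i) \<subseteq> below i" by (auto simp: below_def)
      then show ?thesis using 3 card_mono[OF fin] by (simp add: p_def)
    qed
  next
    fix i assume i: "i \<ge> r + xs ! 0 + 1"
    have "below i = {}"
      using sorted_desc_shift_antimono[OF xs, of _ 0] i by (fastforce simp: below_def r_def)
    then show "p i = 0" using i by (simp add: p_def)
  qed
  have "i < p i \<longleftrightarrow> i < r" for i
    using below_le[of i] by (simp add: p_def)
  then have diag: "{i. i < p i} = {..<r}" by auto
  have conj: "conj_part p j = xs ! j + (j + 1)" if j: "j < r" for j
  proof -
    have "j < p i \<longleftrightarrow> i < xs ! j + (j + 1)" for i
    proof (cases "i < r")
      case True
      then show ?thesis using big[of i] big'[OF j] j by (simp add: p_def)
    next
      case False
      then have "j < p i \<longleftrightarrow> j \<in> below i" using below_down[of i] by (auto simp: p_def)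
      then show ?thesis using j by (simp add: below_def)
    qed
    then have "{i. j < p i} = {..<xs ! j + (j + 1)}" by auto
    then show ?thesis by (simp add: conj_part_def)
  qed
  have "is_frobenius xs ys p"
    using part diag conj len by (simp add: is_frobenius_def r_def p_def)
  then show ?thesis by blast
qed

lemma frobenius_coords_exist:
  assumes p: "is_partition p"
  shows "\<exists>xs ys. sorted_wrt (>) xs \<and> sorted_wrt (>) ys \<and> is_frobenius xs ys p"
proof -
  define r where "r = card {i. i < p i}"
  define xs where "xs = map (\<lambda>i. conj_part p i - (i + 1)) [0..<r]"
  define ys where "ys = map (\<lambda>i. p i - (i + 1)) [0..<r]"
  have pos: "i < p i" "i < conj_part p i" if "i < r" for i
    using that diagonal_iff[OF p, of i] conj_diagonal_iff[OF p, of i] by (auto simp: r_def)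
  have "sorted_wrt (>) xs"
    unfolding sorted_wrt_iff_nth_less
  proof (intro allI impI)
    fix i j assume ij: "i < j" "j < length xs"
    then show "xs ! i > xs ! j"
      using pos(2)[of i] pos(2)[of j] conj_part_antimono[OF p, of i j] by (simp add: xs_def)
  qed
  moreover have "sorted_wrt (>) ys"
    unfolding sorted_wrt_iff_nth_less
  proof (intro allI impI)
    fix i j assume ij: "i < j" "j < length ys"
    then show "ys ! i > ys ! j"
      using pos(1)[of i] pos(1)[of j] partition_le[OF p, of i j] by (simp add: ys_def)
  qed
  moreover have "is_frobenius xs ys p"
    unfolding is_frobenius_def
  proof (intro conjI allI impI)
    fix i assume "i < length xs"
    then have i: "i < r" by (simp add: xs_def)
    show "p i = ys ! i + (i + 1)" using pos(1)[OF i] i by (simp add: ys_def)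
    show "conj_part p i = xs ! i + (i + 1)" using pos(2)[OF i] i by (simp add: xs_def)
  qed (use p in \<open>simp_all add: xs_def ys_def r_def\<close>)
  ultimately show ?thesis by blast
qed

text \<open>The boxes below the diagonal square are counted by columns, those to its right by rows.\<close>

lemma psize_frobenius:
  assumes "is_frobenius xs ys p"
  shows "psize p = sum_list xs + sum_list ys + length xs"
proof -
  define r where "r = length xs"
  have p: "is_partition p" and len: "length ys = r" and r: "r = card {i. i < p i}"
    and row: "\<And>i. i < r \<Longrightarrow> p i = ys ! i + (i + 1)"
    and col: "\<And>i. i < r \<Longrightarrow> conj_part p i = xs ! i + (i + 1)"
    using assms by (auto simp: is_frobenius_def r_def)
  define N where "N = r + conj_part p 0"
  have "psize p = sum p {..<N}"
    by (rule psize_eq_sum) (simp add: partition_zero_iff[OF p] N_def)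
  also have "{..<N} = {..<r} \<union> {r..<N}" by (auto simp: N_def)
  also have "sum p \<dots> = sum p {..<r} + sum p {r..<N}" by (rule sum.union_disjoint) auto
  also have "sum p {r..<N} = (\<Sum>i\<in>{r..<N}. \<Sum>j<r. if i < conj_part p j then 1 else 0)"
  proof (rule sum.cong[OF refl])
    fix i assume "i \<in> {r..<N}"
    then have "p i = card {j. j < r \<and> i < conj_part p j}"
      using row_below_diagonal[OF p r] by simp
    also have "{j. j < r \<and> i < conj_part p j} = {j \<in> {..<r}. i < conj_part p j}" by auto
    also have "card \<dots> = (\<Sum>j<r. if i < conj_part p j then 1 else 0)"
      by (simp only: card_eq_sum) (rule sum.inter_filter, simp)
    finally show "p i = (\<Sum>j<r. if i < conj_part p j then 1 else 0)" .
  qed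
  also have "\<dots> = (\<Sum>j<r. \<Sum>i\<in>{r..<N}. if i < conj_part p j then 1 else 0)"
    by (rule sum.swap)
  also have "\<dots> = (\<Sum>j<r. conj_part p j - r)"
  proof (rule sum.cong[OF refl])
    fix j assume "j \<in> {..<r}"
    have "{i \<in> {r..<N}. i < conj_part p j} = {r..<conj_part p j}"
      using conj_part_antimono[OF p, of 0 j] by (auto simp: N_def)
    then show "(\<Sum>i\<in>{r..<N}. if i < conj_part p j then 1 else 0) = conj_part p j - r"
      by (simp flip: sum.inter_filter)
  qed
  finally have 1: "psize p = sum p {..<r} + (\<Sum>j<r. conj_part p j - r)" .
  have 2: "(\<Sum>j<r. conj_part p j - r) + r * r = (\<Sum>j<r. conj_part p j)"
  proof -
    have "(\<Sum>j<r. conj_part p j) = (\<Sum>j<r. (conj_part p j - r) + r)"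
    proof (rule sum.cong[OF refl])
      fix j assume "j \<in> {..<r}"
      then have "r - 1 < r" "j \<le> r - 1" by auto
      then have "r - 1 < conj_part p (r - 1)" "conj_part p (r - 1) \<le> conj_part p j"
        using conj_diagonal_iff[OF p, of "r - 1", folded r] conj_part_antimono[OF p, of j "r - 1"]
        by blast+
      then show "conj_part p j = conj_part p j - r + r" by simp
    qed
    then show ?thesis by (simp add: sum.distrib)
  qed
  have split: "sum f {..<r} = sum_list zs + (\<Sum>i<r. i + 1)"
    if "\<And>i. i < r \<Longrightarrow> f i = zs ! i + (i + 1)" "length zs = r" for f zs
  proof -
    have "sum f {..<r} = (\<Sum>i<r. zs ! i + (i + 1))" using that(1) by (intro sum.cong) auto
    also have "\<dots> = (\<Sum>i<r. zs ! i) + (\<Sum>i<r. i + 1)" by (rule sum.distrib)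
    finally show ?thesis by (simp only: sum_list_sum_nth atLeast0LessThan that(2))
  qed
  note 3 = split[OF row len] and 4 = split[OF col r_def[symmetric]]
  have "2 * (\<Sum>i<k. i + 1) = k * k + k" for k :: nat
    by (induction k) (auto simp: algebra_simps)
  from this[of r] 1 2 3 4 show ?thesis unfolding r_def[symmetric] by linarith
qed

lemma is_frobenius_frobenius:
  assumes "sorted_wrt (>) xs" "sorted_wrt (>) ys" "length xs = length ys"
  shows "is_frobenius xs ys (frobenius xs ys)"
proof -
  have "frobenius xs ys = (THE p. is_frobenius xs ys p)"
    by (simp add: frobenius_def is_frobenius_def)
  then show ?thesis
    using theI'[of "is_frobenius xs ys"] frobenius_exists[OF assms] is_frobenius_unique by metis
qed

lemma frobenius_eqI: "is_frobenius xs ys p \<Longrightarrow> frobenius xs ys = p"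
  unfolding frobenius_def is_frobenius_def[symmetric]
  using is_frobenius_unique by (intro the_equality) auto


section \<open>Partitions with empty 2-core\<close>

text \<open>The excess of white over black boxes in the chessboard colouring: a row contributes only if
  its length is odd.\<close>

definition tilt :: "(nat \<Rightarrow> nat) \<Rightarrow> int" where
  "tilt p = (\<Sum>i | odd (p i). (- 1) ^ i)"

lemma lessThan_eq_insert: "{..<a::nat} = insert j {..<b} \<Longrightarrow> j \<notin> {..<b} \<Longrightarrow> j = b \<and> a = Suc b"
  by (metis card_insert_disjoint card_lessThan finite_lessThan insertI1 lessThan_Suc lessThan_iff
      insert_iff less_antisym not_less_eq)

text \<open>In terms of rows: the two boxes of a vertical domino lie at the ends of two rows and in one column, so the
  two rows have the same length.\<close>

lemma domino_removal_iff:
  "domino_removal p q \<longleftrightarrow> is_partition p \<and> is_partition q \<and>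
     (\<exists>i. p = q(i := q i + 2) \<or> q i = q (Suc i) \<and> p = q(i := q i + 1, Suc i := q i + 1))"
    (is "_ \<longleftrightarrow> _ \<and> _ \<and> ?R")
proof -
  let ?D = "diagram q \<subseteq> diagram p \<and>
     (\<exists>i j. diagram p - diagram q = {(i, j), (i, j + 1)} \<or>
            diagram p - diagram q = {(i, j), (i + 1, j)})"
  have forward: "?R" if sub: "diagram q \<subseteq> diagram p"
    and D: "diagram p - diagram q = {(i, j), (i, j + 1)} \<or>
            diagram p - diagram q = {(i, j), (i + 1, j)}" for i j
    using D
  proof
    assume h: "diagram p - diagram q = {(i, j), (i, j + 1)}"
    have eq: "diagram p = diagram q \<union> {(i, j), (i, j + 1)}" using h sub by blast
    then have mem: "b < p a \<longleftrightarrow> b < q a \<or> a = i \<and> (b = j \<or> b = j + 1)" for a b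
      by (auto simp: diagram_def set_eq_iff)
    have out: "\<not> j < q i" "\<not> j + 1 < q i" using h by (auto simp: diagram_def)
    have "p a = q a" if "a \<noteq> i" for a
      using mem[of _ a] that by (intro nat_eqI_less) auto
    moreover have "p i = q i + 2"
    proof -
      have "{..<p i} = {..<q i} \<union> {j, j + 1}" using mem[of _ i] by auto
      moreover have "card \<dots> = q i + 2"
        using out by (subst card_Un_disjoint) auto
      ultimately show ?thesis by (metis card_lessThan)
    qed
    ultimately have "p = q(i := q i + 2)" by auto
    then show ?R by blast
  next
    assume h: "diagram p - diagram q = {(i, j), (i + 1, j)}"
    have eq: "diagram p = diagram q \<union> {(i, j), (i + 1, j)}" using h sub by blast
    then have mem: "b < p a \<longleftrightarrow> b < q a \<or> (a = i \<or> a = i + 1) \<and> b = j" for a b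
      by (auto simp: diagram_def set_eq_iff)
    have out: "\<not> j < q i" "\<not> j < q (i + 1)" using h by (auto simp: diagram_def)
    have 1: "p a = q a" if "a \<noteq> i" "a \<noteq> i + 1" for a
      using mem[of _ a] that by (intro nat_eqI_less) auto
    have 2: "j = q a \<and> p a = Suc (q a)" if "a = i \<or> a = i + 1" for a
      using mem[of _ a] out that by (intro lessThan_eq_insert) auto
    have "q i = q (Suc i)" "p = q(i := q i + 1, Suc i := q i + 1)"
      using 1 2[of i] 2[of "Suc i"] by (auto simp: fun_eq_iff)
    then show ?R by blast
  qed
  have backward: ?D if ?R
  proof -
    from that obtain i where "p = q(i := q i + 2) \<or>
      q i = q (Suc i) \<and> p = q(i := q i + 1, Suc i := q i + 1)" by blast
    then show ?thesis
    proof
      assume p: "p = q(i := q i + 2)"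
      then have "diagram q \<subseteq> diagram p" "diagram p - diagram q = {(i, q i), (i, q i + 1)}"
        by (auto simp: diagram_def split: if_splits)
      then show ?thesis by blast
    next
      assume p: "q i = q (Suc i) \<and> p = q(i := q i + 1, Suc i := q i + 1)"
      then have "diagram q \<subseteq> diagram p" "diagram p - diagram q = {(i, q i), (i + 1, q i)}"
        by (auto simp: diagram_def split: if_splits)
      then show ?thesis by blast
    qed
  qed
  have "?D \<longleftrightarrow> ?R"
  proof
    assume ?D
    then show ?R by (elim conjE exE) (rule forward)
  qed (rule backward)
  then show ?thesis unfolding domino_removal_def by (simp only:)
qed

lemma finite_odd_parts: "is_partition p \<Longrightarrow> finite {i. odd (p i)}"
  unfolding is_partition_def by (elim conjE, erule rev_finite_subset) (auto intro: odd_pos)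

text \<open>A domino covers one box of each colour.\<close>

lemma domino_removal_tilt:
  assumes "domino_removal p q"
  shows "tilt p = tilt q"
proof -
  have fin: "finite {k. odd (p k)}" "finite {k. odd (q k)}"
    using assms finite_odd_parts by (auto simp: domino_removal_def)
  obtain i where "p = q(i := q i + 2) \<or>
      q i = q (Suc i) \<and> p = q(i := q i + 1, Suc i := q i + 1)"
    using assms domino_removal_iff by metis
  then show ?thesis
  proof
    assume "p = q(i := q i + 2)"
    then have "odd (p k) \<longleftrightarrow> odd (q k)" for k by auto
    then show ?thesis by (simp add: tilt_def)
  next
    assume v: "q i = q (Suc i) \<and> p = q(i := q i + 1, Suc i := q i + 1)"
    have flip: "tilt r = tilt s"
      if "{k. odd (r k)} = {k. odd (s k)} \<union> {i, Suc i}" "even (s i)" "even (s (Suc i))"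
        "finite {k. odd (s k)}" for r s
    proof -
      have "tilt r = (\<Sum>k\<in>{k. odd (s k)} \<union> {i, Suc i}. (- 1) ^ k)"
        unfolding tilt_def that(1) ..
      also have "\<dots> = tilt s + (\<Sum>k\<in>{i, Suc i}. (- 1) ^ k)"
        unfolding tilt_def using that by (intro sum.union_disjoint) auto
      finally show ?thesis by simp
    qed
    show ?thesis
    proof (cases "odd (q i)")
      case True
      then have "{k. odd (q k)} = {k. odd (p k)} \<union> {i, Suc i}" "even (p i)" "even (p (Suc i))"
        using v by auto
      from flip[OF this fin(1)] show ?thesis by (rule sym)
    next
      case False
      then have "{k. odd (p k)} = {k. odd (q k)} \<union> {i, Suc i}" "even (q i)" "even (q (Suc i))"
        using v by auto
      from flip[OF this fin(2)] show ?thesis .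
    qed
  qed
qed

lemma domino_removal_psize:
  assumes "domino_removal p q"
  shows "psize p = psize q + 2"
proof -
  have p: "is_partition p" and q: "is_partition q" using assms by (auto simp: domino_removal_def)
  obtain i where i: "p = q(i := q i + 2) \<or>
      q i = q (Suc i) \<and> p = q(i := q i + 1, Suc i := q i + 1)"
    using assms domino_removal_iff by metis
  define N where "N = conj_part p 0 + conj_part q 0 + i + 2"
  have "p k = 0" "q k = 0" if "k \<ge> N" for k
    using partition_zero_iff[OF p, of k] partition_zero_iff[OF q, of k] that by (auto simp: N_def)
  then have "psize p = sum p {..<N}" "psize q = sum q {..<N}"
    by (auto intro!: psize_eq_sum simp only:)
  moreover have "sum f {..<N} = f i + f (Suc i) + sum f ({..<N} - {i, Suc i})" for f :: "nat \<Rightarrow> nat"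
    using sum.subset_diff[of "{i, Suc i}" "{..<N}" f] by (simp add: N_def)
  moreover have "sum p ({..<N} - {i, Suc i}) = sum q ({..<N} - {i, Suc i})"
    using i by (intro sum.cong) auto
  ultimately show ?thesis using i by auto
qed

text \<open>A 2-core is a staircase, and a nonempty staircase has nonzero tilt, since all its odd rows
  start with boxes of the same colour.\<close>

lemma domino_removable:
  assumes p: "is_partition p" and t: "tilt p = 0" and ne: "p \<noteq> (\<lambda>_. 0)"
  shows "\<exists>q. domino_removal p q"
proof (rule ccontr)
  assume no: "\<not> ?thesis"
  have pz: "\<And>i. i \<ge> conj_part p 0 \<Longrightarrow> p i = 0" using partition_zero_iff[OF p] by auto
  have le: "p (Suc i) \<le> p i" for i using partition_le[OF p] by simp
  have step: "p i \<le> p (Suc i) + 1" for i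
  proof (rule ccontr)
    assume big: "\<not> ?thesis"
    let ?q = "p(i := p i - 2)"
    have "is_partition ?q"
    proof (rule is_partitionI)
      show "?q (Suc k) \<le> ?q k" for k using le[of k] big by auto
      show "?q k = 0" if "k \<ge> conj_part p 0" for k using pz[of k] pz[of i] that by auto
    qed
    moreover have "p = ?q(i := ?q i + 2)" using big by (auto simp: fun_eq_iff)
    ultimately show False using no p domino_removal_iff by blast
  qed
  have neq: "p i \<noteq> p (Suc i)" if nz: "p i \<noteq> 0" for i
  proof
    assume eq: "p i = p (Suc i)"
    \<comment> \<open>The last row of the same length; the vertical domino at the end of this row and the row above it can be
      removed.\<close>
    define k where "k = conj_part p (p i - 1) - 1"
    have "Suc i < conj_part p (p i - 1)"
      using less_conj_part_iff[OF p] eq nz by auto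
    then have k: "Suc i \<le> k" "k < conj_part p (p i - 1)" "\<not> Suc k < conj_part p (p i - 1)"
      by (auto simp: k_def)
    then have "p i - 1 < p k" "p (Suc k) \<le> p i - 1"
      using less_conj_part_iff[OF p] by auto
    moreover obtain k' where k': "k = Suc k'" "i \<le> k'" using k(1) by (cases k) auto
    ultimately have pk: "p k = p i" "p k' = p i" "p (Suc k) \<le> p i - 1"
      using partition_le[OF p, of i k'] partition_le[OF p, of k' k] by auto
    let ?q = "p(k' := p i - 1, Suc k' := p i - 1)"
    have "is_partition ?q"
    proof (rule is_partitionI)
      show "?q (Suc a) \<le> ?q a" for a using le[of a] pk k' by auto
      show "?q a = 0" if "a \<ge> conj_part p 0" for a
        using pz[of a] pz[of k] pz[of k'] that pk k' nz by auto
    qed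
    moreover have "p = ?q(k' := ?q k' + 1, Suc k' := ?q k' + 1)"
      using pk k' nz by (auto simp: fun_eq_iff)
    moreover have "?q k' = ?q (Suc k')" by simp
    ultimately have "domino_removal p ?q" using p unfolding domino_removal_iff by blast
    then show False using no by blast
  qed
  define r where "r = p 0"
  have stair: "p i = r - i" for i
  proof (induction i)
    case (Suc i)
    then show ?case using le[of i] step[of i] neq[of i] by (cases "p i = 0") auto
  qed (simp add: r_def)
  have r: "r > 0" using ne stair by (metis bot_nat_0.not_eq_extremum diff_0_eq_0 ext)
  have "tilt p = (\<Sum>i | odd (p i). (- 1) ^ (r - 1))"
    unfolding tilt_def
  proof (rule sum.cong[OF refl])
    fix i assume "i \<in> {i. odd (p i)}"
    then have "odd (r - i)" using stair by simp
    moreover from this have "i < r" using odd_pos[of "r - i"] by simp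
    ultimately have "even i \<longleftrightarrow> even (r - 1)" using r by simp
    then show "(- 1) ^ i = ((- 1) ^ (r - 1) :: int)"
      by (cases "even i") auto
  qed
  also have "\<dots> = int (card {i. odd (p i)}) * (- 1) ^ (r - 1)" by simp
  finally have "card {i. odd (p i)} = 0" using t by simp
  then have "{i. odd (p i)} = {}" using finite_odd_parts[OF p] by simp
  moreover have "odd (p (r - 1))" using stair r by simp
  ultimately show False by blast
qed

text \<open>The tilt is invariant under domino removal, so it vanishes if the 2-core is empty; conversely a
  nonempty partition with vanishing tilt has a removable domino.\<close>

lemma P0_iff: "p \<in> P0 m \<longleftrightarrow> is_partition p \<and> tilt p = 0 \<and> psize p = 2 * m"
proof -
  have core: "\<nexists>q. domino_removal (\<lambda>_. 0) q"
    using domino_removal_psize[of "\<lambda>_. 0"] by (auto simp: psize_def)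
  have "(domino_removal ^^ m) p (\<lambda>_. 0) \<longleftrightarrow> tilt p = 0 \<and> psize p = 2 * m" if "is_partition p"
    using that
  proof (induction m arbitrary: p)
    case 0
    then show ?case using psize_zero_iff[of p] by (auto simp: tilt_def)
  next
    case (Suc m)
    show ?case
    proof
      assume "(domino_removal ^^ Suc m) p (\<lambda>_. 0)"
      then obtain q where q: "domino_removal p q" "(domino_removal ^^ m) q (\<lambda>_. 0)"
        using relpowp_Suc_D2 by metis
      moreover have "is_partition q" using q(1) by (simp add: domino_removal_def)
      ultimately show "tilt p = 0 \<and> psize p = 2 * Suc m"
        using Suc.IH[of q] domino_removal_tilt[OF q(1)] domino_removal_psize[OF q(1)] by simp
    next
      assume p: "tilt p = 0 \<and> psize p = 2 * Suc m"
      then have "p \<noteq> (\<lambda>_. 0)" using psize_zero_iff[OF Suc.prems] by auto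
      then obtain q where q: "domino_removal p q"
        using domino_removable[OF Suc.prems] p by blast
      then have "is_partition q" by (simp add: domino_removal_def)
      then have "(domino_removal ^^ m) q (\<lambda>_. 0)"
        using Suc.IH[of q] domino_removal_tilt[OF q] domino_removal_psize[OF q] p by simp
      then show "(domino_removal ^^ Suc m) p (\<lambda>_. 0)"
        using q relpowp_Suc_I2 by metis
    qed
  qed
  then show ?thesis using core by (auto simp: P0_def two_core_weight_def)
qed


section \<open>Two-coloured partitions\<close>

lemma Pprime_partition: "x \<in> Pprime \<Longrightarrow> is_partition (fst \<circ> x)"
  and Pprime_zero: "x \<in> Pprime \<Longrightarrow> fst (x i) = 0 \<Longrightarrow> snd (x i) = White"
  and Pprime_same: "x \<in> Pprime \<Longrightarrow> fst (x i) = fst (x j) \<Longrightarrow> snd (x i) = snd (x j)"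
  unfolding Pprime_def by blast+

text \<open>The sum of the white partition \<open>p\<close> and the special partition with parts \<open>q\<close>: a white summand leaves the
  colour of a gray or white part unchanged, so the colours are given by the parities in \<open>q\<close>.\<close>

definition compose :: "(nat \<Rightarrow> nat) \<Rightarrow> (nat \<Rightarrow> nat) \<Rightarrow> nat \<Rightarrow> nat \<times> colour" where
  "compose p q i = (p i + q i, if odd (q i) then Gray else White)"

lemma fst_compose: "fst \<circ> compose p q = (\<lambda>i. p i + q i)"
  by (simp add: fun_eq_iff compose_def)

lemma part_add_compose: "part_add (white p i) (compose (\<lambda>_. 0) q i) = compose p q i"
  by (simp add: compose_def white_def)

lemma is_partition_add:
  assumes "is_partition p" "is_partition q"
  shows "is_partition (\<lambda>i. p i + q i)"
proof (rule is_partitionI)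
  show "p (Suc i) + q (Suc i) \<le> p i + q i" for i
    using assms[THEN partition_le, of i "Suc i"] by simp
  show "p i + q i = 0" if "i \<ge> conj_part p 0 + conj_part q 0" for i
    using partition_zero_iff[OF assms(1), of i] partition_zero_iff[OF assms(2), of i] that by simp
qed

lemma compose_in_Pprime:
  assumes p: "is_partition p" and q: "is_partition q"
  shows "compose p q \<in> Pprime"
proof -
  have le: "q i = q j" if "p i + q i = p j + q j" "i \<le> j" for i j
    using partition_le[OF p that(2)] partition_le[OF q that(2)] that(1) by linarith
  have eq: "q i = q j" if "p i + q i = p j + q j" for i j
  proof (cases "i \<le> j")
    case True
    then show ?thesis using le[OF that] by simp
  next
    case False
    then show ?thesis using le[OF that[symmetric]] by simp
  qed
  have "snd (compose p q i) = snd (compose p q j)"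
    if "fst (compose p q i) = fst (compose p q j)" for i j
    using eq[of i j] that by (simp add: compose_def)
  moreover have "snd (compose p q i) = White" if "fst (compose p q i) = 0" for i
    using that by (simp add: compose_def)
  ultimately show ?thesis
    using is_partition_add[OF p q] unfolding Pprime_def mem_Collect_eq fst_compose by blast
qed

text \<open>The last nonzero part of a 2-reduced partition is 1, because the step from it to 0 has height at most 1.\<close>

lemma special_part_iff:
  "special_part y \<longleftrightarrow> (\<exists>q. is_partition q \<and> two_reduced q \<and> y = compose (\<lambda>_. 0) q)"
proof
  assume y: "special_part y"
  have "y i = compose (\<lambda>_. 0) (fst \<circ> y) i" for i
  proof (cases "\<forall>i. fst (y i) = 0")
    case True
    then have "fst (y i) = 0" "snd (y i) = White" using y unfolding special_part_def Pprime_def by blast+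
    then show ?thesis by (simp add: compose_def prod_eq_iff)
  next
    case False
    then have "snd (y i) = (if odd (fst (y i)) then Gray else White)"
      using y unfolding special_part_def by blast
    then show ?thesis by (simp add: compose_def prod_eq_iff)
  qed
  then have "y = compose (\<lambda>_. 0) (fst \<circ> y)" ..
  moreover have "is_partition (fst \<circ> y)" "two_reduced (fst \<circ> y)"
    using y unfolding special_part_def Pprime_def by blast+
  ultimately show "\<exists>q. is_partition q \<and> two_reduced q \<and> y = compose (\<lambda>_. 0) q" by blast
next
  assume "\<exists>q. is_partition q \<and> two_reduced q \<and> y = compose (\<lambda>_. 0) q"
  then obtain q where q: "is_partition q" "two_reduced q" "y = compose (\<lambda>_. 0) q" by blast
  have y: "y \<in> Pprime"
    unfolding q(3) by (intro compose_in_Pprime q) (simp add: is_partition_def antimono_def)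
  have "\<exists>i. q i = 1" if "\<not> (\<forall>i. q i = 0)"
  proof -
    define i where "i = conj_part q 0 - 1"
    from that obtain j where "q j \<noteq> 0" by blast
    then have "conj_part q 0 > 0" using partition_zero_iff[OF q(1), of j] by simp
    then have "q i \<noteq> 0" "q (Suc i) = 0"
      using partition_zero_iff[OF q(1), of i] partition_zero_iff[OF q(1), of "Suc i"]
      by (auto simp: i_def)
    moreover have "q i - q (Suc i) \<le> 1" using q(2) by (simp add: two_reduced_def)
    ultimately have "q i = 1" by linarith
    then show ?thesis ..
  qed
  then have "(\<forall>i. q i = 0) \<or> (\<exists>i. q i = 1)" by blast
  moreover have "fst (y i) = q i" "snd (y i) = (if odd (q i) then Gray else White)" for i
    by (simp_all add: q(3) compose_def)
  moreover have "fst \<circ> y = q" by (simp add: q(3) fst_compose)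
  ultimately show "special_part y"
    using q(2) y unfolding special_part_def by (simp only:) simp
qed

text \<open>A 2-reduced partition is determined by the parities of its parts, from the tail upwards.\<close>

lemma two_reduced_eqI:
  assumes p: "is_partition p" "two_reduced p" and q: "is_partition q" "two_reduced q"
    and par: "\<And>i. odd (p i) \<longleftrightarrow> odd (q i)"
  shows "p = q"
proof
  fix i
  define N where "N = conj_part p 0 + conj_part q 0 + i"
  have "i \<le> N" by (simp add: N_def)
  then show "p i = q i"
  proof (induction i rule: inc_induct)
    case base
    then show ?case
      using partition_zero_iff[OF p(1), of N] partition_zero_iff[OF q(1), of N] by (simp add: N_def)
  next
    case (step i)
    have "p (Suc i) \<le> p i" "q (Suc i) \<le> q i" using p(1) q(1) by (simp_all add: partition_le)
    moreover have "p i - p (Suc i) \<le> 1" "q i - q (Suc i) \<le> 1"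
      using p(2) q(2) by (simp_all add: two_reduced_def)
    ultimately have "p i = p (Suc i) \<or> p i = Suc (p (Suc i))" "q i = q (Suc i) \<or> q i = Suc (q (Suc i))"
      by linarith+
    then show ?case using par[of i] par[of "Suc i"] step.IH by auto
  qed
qed

text \<open>The 2-reduced summand counts the colour changes towards the tail.\<close>

lemma compose_surj:
  assumes x: "x \<in> Pprime"
  shows "\<exists>p q. is_partition p \<and> is_partition q \<and> two_reduced q \<and> x = compose p q"
proof -
  define a where "a i = fst (x i)" for i
  \<comment> \<open>Equal parts have equal colours, so a colour change forces a strict descent of \<open>a\<close>; this leaves room
    to subtract the number of later colour changes.\<close>
  define ch where "ch i \<longleftrightarrow> snd (x i) \<noteq> snd (x (Suc i))" for i
  have "a = fst \<circ> x" by (simp add: a_def fun_eq_iff)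
  then have a: "is_partition a" using Pprime_partition[OF x] by simp
  define N where "N = conj_part a 0"
  have tail: "a i = 0" "snd (x i) = White" if "i \<ge> N" for i
    using partition_zero_iff[OF a, of i] that Pprime_zero[OF x, of i] by (auto simp: N_def a_def)
  define q where "q i = card {j. i \<le> j \<and> ch j}" for i
  have "j < N" if "ch j" for j using that tail(2)[of j] tail(2)[of "Suc j"] by (cases "j < N") (auto simp: ch_def)
  then have fin: "finite {j. i \<le> j \<and> ch j}" for i
    by (auto intro: finite_subset[of _ "{..<N}"])
  have q_step: "q i = (if ch i then Suc (q (Suc i)) else q (Suc i))" for i
  proof -
    have "{j. i \<le> j \<and> ch j} = (if ch i then insert i {j. Suc i \<le> j \<and> ch j} else {j. Suc i \<le> j \<and> ch j})"
      by (auto simp: Suc_le_eq le_less)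
    then show ?thesis using fin[of "Suc i"] by (simp add: q_def)
  qed
  have q_tail: "q i = 0" if "i \<ge> N" for i
  proof -
    have "{j. i \<le> j \<and> ch j} = {}" using tail(2) that by (auto simp: ch_def)
    then show ?thesis by (simp only: q_def card.empty)
  qed
  have a_step: "(if ch i then Suc (a (Suc i)) else a (Suc i)) \<le> a i" for i
  proof -
    have "a i \<noteq> a (Suc i)" if "ch i"
      using Pprime_same[OF x, of i "Suc i"] that by (auto simp: a_def ch_def)
    then show ?thesis using partition_le[OF a, of i "Suc i"] by auto
  qed
  have q_le: "q i \<le> a i" and q_par: "snd (x i) = (if odd (q i) then Gray else White)" for i
  proof -
    have "i \<le> N + i" by simp
    then have "q i \<le> a i \<and> snd (x i) = (if odd (q i) then Gray else White)"
    proof (induction i rule: inc_induct)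
      case base
      then show ?case using q_tail tail by simp
    next
      case (step i)
      have "snd (x i) = (if ch i then switch (snd (x (Suc i))) else snd (x (Suc i)))"
        by (cases "snd (x i)"; cases "snd (x (Suc i))") (auto simp: ch_def)
      then show ?case using step.IH q_step[of i] a_step[of i] by (auto split: if_splits)
    qed
    then show "q i \<le> a i" "snd (x i) = (if odd (q i) then Gray else White)" by auto
  qed
  define p where "p i = a i - q i" for i
  have "is_partition p"
  proof (rule is_partitionI)
    show "p (Suc i) \<le> p i" for i using q_step[of i] a_step[of i] by (auto simp: p_def split: if_splits)
    show "p i = 0" if "i \<ge> N" for i using tail(1)[OF that] by (simp add: p_def)
  qed
  moreover have "is_partition q"
    by (rule is_partitionI[OF _ q_tail]) (auto simp: q_step)
  moreover have "q i - q (Suc i) \<le> 1" for i using q_step[of i] by (auto split: if_splits)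
  then have "two_reduced q" by (simp add: two_reduced_def)
  moreover have "x = compose p q"
    using q_le q_par by (auto simp: fun_eq_iff compose_def p_def prod_eq_iff a_def)
  ultimately show ?thesis by blast
qed

lemma compose_inj:
  assumes "is_partition q" "two_reduced q" "is_partition q'" "two_reduced q'"
    and eq: "compose p q = compose p' q'"
  shows "p = p' \<and> q = q'"
proof -
  have e: "compose p q i = compose p' q' i" for i using eq by simp
  have "odd (q i) \<longleftrightarrow> odd (q' i)" for i using e[of i] by (auto simp: compose_def split: if_splits)
  then have "q = q'" using two_reduced_eqI assms by blast
  moreover have "p = p'" using e \<open>q = q'\<close> by (auto simp: compose_def fun_eq_iff)
  ultimately show ?thesis by simp
qed

lemma decompose_compose:
  assumes p: "is_partition p" and q: "is_partition q" "two_reduced q"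
  shows "decompose (compose p q) = (p, compose (\<lambda>_. 0) q)"
  unfolding decompose_def
proof (rule the_equality)
  show "case (p, compose (\<lambda>_. 0) q) of (p', y) \<Rightarrow> is_partition p' \<and> special_part y \<and>
     compose p q = (\<lambda>i. part_add (white p' i) (y i))"
    using assms by (auto simp: special_part_iff part_add_compose)
next
  fix z assume z: "case z of (p', y) \<Rightarrow> is_partition p' \<and> special_part y \<and>
     compose p q = (\<lambda>i. part_add (white p' i) (y i))"
  obtain p' y where zp: "z = (p', y)" by (cases z)
  then obtain q' where q': "is_partition q'" "two_reduced q'" "y = compose (\<lambda>_. 0) q'"
    using z by (auto simp: special_part_iff)
  then have "compose p q = compose p' q'" using z zp by (simp add: part_add_compose)
  from compose_inj[OF q q'(1,2) this] show "z = (p, compose (\<lambda>_. 0) q)" using zp q'(3) by simp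
qed


section \<open>Two-coloured partitions as lists and multisets\<close>

definition parts_mset :: "(nat \<Rightarrow> nat \<times> colour) \<Rightarrow> (nat \<times> colour) multiset" where
  "parts_mset x = image_mset x (mset_set {i. fst (x i) \<noteq> 0})"

text \<open>The multisets that come from a coloured partition in which equal parts have equal colours.\<close>

definition consistent :: "(nat \<times> colour) multiset \<Rightarrow> bool" where
  "consistent B \<longleftrightarrow> (\<forall>p c. (p, c) \<in># B \<longrightarrow> p \<noteq> 0) \<and>
     (\<forall>p c d. (p, c) \<in># B \<longrightarrow> (p, d) \<in># B \<longrightarrow> c = d)"

definition decreasing :: "(nat \<times> colour) list \<Rightarrow> bool" where
  "decreasing xs \<longleftrightarrow> sorted_wrt (\<lambda>a b. fst b \<le> fst a) xs"

definition pad :: "(nat \<times> colour) list \<Rightarrow> nat \<Rightarrow> nat \<times> colour" where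
  "pad xs i = (if i < length xs then xs ! i else (0, White))"

lemma Pprime_finite: "x \<in> Pprime \<Longrightarrow> finite {i. fst (x i) \<noteq> 0}"
  by (simp add: Pprime_def is_partition_def)

lemma set_parts_mset: "x \<in> Pprime \<Longrightarrow> set_mset (parts_mset x) = {x i | i. fst (x i) \<noteq> 0}"
  using Pprime_finite[of x] by (auto simp: parts_mset_def)

lemma consistent_parts_mset: "x \<in> Pprime \<Longrightarrow> consistent (parts_mset x)"
proof -
  assume x: "x \<in> Pprime"
  have "c = d" if "(p, c) = x i" "(p, d) = x j" for p c d i j
    using Pprime_same[OF x, of i j] by (simp add: that[symmetric])
  then show ?thesis unfolding consistent_def set_parts_mset[OF x] mem_Collect_eq
    by (metis fst_conv)
qed

lemma count_parts_mset:
  assumes "x \<in> Pprime" "k \<noteq> 0"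
  shows "count (parts_mset x) (k, c) = card {i. x i = (k, c)}"
proof -
  have "count (parts_mset x) (k, c) = card (x -` {(k, c)} \<inter> {i. fst (x i) \<noteq> 0})"
    unfolding parts_mset_def count_image_mset card_eq_sum using Pprime_finite[OF assms(1)]
    by (intro sum.cong) auto
  also have "x -` {(k, c)} \<inter> {i. fst (x i) \<noteq> 0} = {i. x i = (k, c)}"
    using assms(2) by auto
  finally show ?thesis .
qed

text \<open>The parts above each height can be counted in the multiset, which determines the conjugate partition; the
  colour of a part is determined by its size.\<close>

lemma parts_mset_inject:
  assumes x: "x \<in> Pprime" and y: "y \<in> Pprime" and eq: "parts_mset x = parts_mset y"
  shows "x = y"
proof -
  have conj: "conj_part (fst \<circ> w) j = size (filter_mset (\<lambda>(p, c). j < p) (parts_mset w))"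
    if "w \<in> Pprime" for w j
  proof -
    have "filter_mset (\<lambda>(p, c). j < p) (parts_mset w) =
        image_mset w (mset_set {i \<in> {i. fst (w i) \<noteq> 0}. case w i of (p, c) \<Rightarrow> j < p})"
      using Pprime_finite[OF that] by (simp add: parts_mset_def filter_mset_image_mset)
    also have "{i \<in> {i. fst (w i) \<noteq> 0}. case w i of (p, c) \<Rightarrow> j < p} = {i. j < (fst \<circ> w) i}"
      by (auto simp: case_prod_unfold)
    finally show ?thesis by (simp add: conj_part_def)
  qed
  have "fst \<circ> x = fst \<circ> y"
    using x y by (intro partition_eqI Pprime_partition) (simp_all only: conj eq)
  then have fst: "fst (x i) = fst (y i)" for i by (metis comp_apply)
  have "snd (x i) = snd (y i)" for i
  proof (cases "fst (x i) = 0")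
    case True
    then show ?thesis using Pprime_zero[OF x, of i] Pprime_zero[OF y, of i] fst[of i] by simp
  next
    case False
    then have "x i \<in># parts_mset y" using set_parts_mset[OF x] eq by auto
    then obtain j where "x i = y j" using set_parts_mset[OF y] by auto
    then show ?thesis using Pprime_same[OF y, of i j] fst[of i] by simp
  qed
  then show ?thesis using fst by (auto simp: fun_eq_iff prod_eq_iff)
qed

lemma pad_in_Pprime:
  assumes dec: "decreasing xs" and con: "consistent (mset xs)"
  shows "pad xs \<in> Pprime"
proof -
  have nz: "fst (xs ! i) \<noteq> 0" if "i < length xs" for i
    using con nth_mem[OF that] by (auto simp: consistent_def) (metis prod.collapse)
  have "is_partition (fst \<circ> pad xs)"
  proof (rule is_partitionI)
    show "(fst \<circ> pad xs) (Suc i) \<le> (fst \<circ> pad xs) i" for i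
      using dec by (auto simp: pad_def decreasing_def sorted_wrt_iff_nth_less)
    show "(fst \<circ> pad xs) i = 0" if "i \<ge> length xs" for i using that by (simp add: pad_def)
  qed
  moreover have "snd (pad xs i) = snd (pad xs j)" if "fst (pad xs i) = fst (pad xs j)" for i j
  proof (cases "i < length xs \<and> j < length xs")
    case True
    then have "(fst (xs ! i), snd (xs ! i)) \<in># mset xs" "(fst (xs ! i), snd (xs ! j)) \<in># mset xs"
      using that by (simp, simp add: pad_def)
    then have "snd (xs ! i) = snd (xs ! j)" using con unfolding consistent_def by blast
    then show ?thesis using True by (simp add: pad_def)
  next
    case False
    then show ?thesis using that nz[of i] nz[of j] by (auto simp: pad_def split: if_splits)
  qed
  moreover have "snd (pad xs i) = White" if "fst (pad xs i) = 0" for i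
    using that nz[of i] by (auto simp: pad_def split: if_splits)
  ultimately show ?thesis unfolding Pprime_def by blast
qed

lemma parts_mset_pad:
  assumes "consistent (mset xs)"
  shows "parts_mset (pad xs) = mset xs"
proof -
  have nz: "fst (xs ! i) \<noteq> 0" if "i < length xs" for i
    using assms nth_mem[OF that] by (auto simp: consistent_def) (metis prod.collapse)
  then have "{i. fst (pad xs i) \<noteq> 0} = {..<length xs}" by (auto simp: pad_def split: if_splits)
  then have "parts_mset (pad xs) = mset (map (pad xs) [0..<length xs])"
    by (simp add: parts_mset_def mset_set_upto_eq_mset_upto)
  also have "map (pad xs) [0..<length xs] = xs" by (rule nth_equalityI) (auto simp: pad_def)
  finally show ?thesis .
qed

lemma Pprime_pad:
  assumes x: "x \<in> Pprime"
  obtains xs where "x = pad xs" "decreasing xs" "consistent (mset xs)"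
proof -
  note part = Pprime_partition[OF x]
  define N where "N = conj_part (fst \<circ> x) 0"
  have z: "fst (x i) = 0 \<longleftrightarrow> N \<le> i" for i using partition_zero_iff[OF part, of i] by (simp add: N_def)
  define xs where "xs = map x [0..<N]"
  have "x i = pad xs i" for i
    using z[of i] Pprime_zero[OF x, of i] by (cases "i < N") (auto simp: pad_def xs_def prod_eq_iff)
  then have "x = pad xs" by auto
  moreover have "decreasing xs"
    using partition_le[OF part] by (auto simp: decreasing_def xs_def sorted_wrt_iff_nth_less)
  moreover have "set xs = {x i | i. fst (x i) \<noteq> 0}" using z by (auto simp: xs_def)
  then have "consistent (mset xs)"
    using consistent_parts_mset[OF x] by (simp add: consistent_def set_parts_mset[OF x])
  ultimately show ?thesis using that by blast
qed

lemma parts_mset_surj: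
  assumes "consistent B"
  shows "\<exists>x \<in> Pprime. parts_mset x = B"
proof -
  obtain ys where ys: "mset ys = B" using ex_mset by blast
  define xs where "xs = rev (sort_key fst ys)"
  have "sorted (map fst (rev xs))" by (simp add: xs_def)
  then have "decreasing xs"
    unfolding decreasing_def by (simp add: sorted_map sorted_wrt_rev)
  moreover have "mset xs = B" using ys by (simp add: xs_def)
  ultimately show ?thesis using pad_in_Pprime parts_mset_pad assms by metis
qed


section \<open>Alternating sums and deletion of full columns\<close>

fun alt_sum :: "('a \<Rightarrow> int) \<Rightarrow> 'a list \<Rightarrow> int" where
  "alt_sum v [] = 0"
| "alt_sum v (a # xs) = v a - alt_sum v xs"

lemma alt_sum_eq_sum: "alt_sum v xs = (\<Sum>i<length xs. (- 1) ^ i * v (xs ! i))"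
proof (induction xs)
  case (Cons a xs)
  have "(\<Sum>i<length (a # xs). (- 1) ^ i * v ((a # xs) ! i)) =
      v a + (\<Sum>i<length xs. (- 1) ^ Suc i * v (xs ! i))"
    by (simp only: length_Cons sum.lessThan_Suc_shift) simp
  also have "(\<Sum>i<length xs. (- 1) ^ Suc i * v (xs ! i)) = - alt_sum v xs"
    by (simp only: Cons.IH sum_negf[symmetric]) simp
  finally show ?case by simp
qed simp

text \<open>The positions satisfying \<open>F\<close> will be those of the full columns. The flag is the parity of the number of
  entries deleted so far.\<close>

fun strip :: "(nat \<Rightarrow> bool) \<Rightarrow> bool \<Rightarrow> (nat \<times> colour) list \<Rightarrow> (nat \<times> colour) list" where
  "strip F b [] = []"
| "strip F b ((p, c) # xs) =
     (if F p then strip F (\<not> b) xs else (p, if b then switch c else c) # strip F b xs)"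

text \<open>The contribution of a column, up to a sign alternating with the columns, to a discrepancy between the
  colours of split floors. A full column contributes 1, a half-filled one 0 or 2, depending on the position of
  its top block; \<open>h\<close> says where the roles of the two positions are exchanged.\<close>

definition excess :: "(nat \<Rightarrow> bool) \<Rightarrow> (nat \<Rightarrow> bool) \<Rightarrow> nat \<times> colour \<Rightarrow> int" where
  "excess F h = (\<lambda>(p, c). if F p then 1 else if (c = Gray) \<noteq> h p then 2 else 0)"

text \<open>Deleting a full column shifts the signs of all later columns, and switching the colours of these
  replaces their excess \<open>e\<close> by \<open>2 - e\<close>. Up to a constant the two effects cancel, and the constant is absorbed by the
  next full column. Hence the assertion is proved together with the one for an odd number of remaining full
  columns.\<close>

lemma alt_sum_strip:
  "(even (length (filter (F \<circ> fst) xs)) \<longrightarrow> alt_sum (excess F h) (strip F False xs) = alt_sum (excess F h) xs) \<and>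
   (odd (length (filter (F \<circ> fst) xs)) \<longrightarrow> alt_sum (excess F h) (strip F True xs) = 1 - alt_sum (excess F h) xs)"
proof (induction xs)
  case (Cons a xs)
  obtain p c where "a = (p, c)" by (cases a)
  then show ?case using Cons by (cases c) (auto simp: excess_def)
qed simp

definition overtaken :: "(nat \<Rightarrow> bool) \<Rightarrow> (nat \<times> colour) multiset \<Rightarrow> nat \<Rightarrow> nat" where
  "overtaken F B p = size (filter_mset (\<lambda>(s, _). F s \<and> p < s) B)"

text \<open>The normal form of the bead moves in closed form: each bead of \<open>F\<close> switches every bead below it that remains
  exactly once.\<close>

definition reduce :: "(nat \<Rightarrow> bool) \<Rightarrow> (nat \<times> colour) multiset \<Rightarrow> (nat \<times> colour) multiset" where
  "reduce F B = image_mset (\<lambda>(p, c). (p, if odd (overtaken F B p) then switch c else c))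
     (filter_mset (\<lambda>(p, _). \<not> F p) B)"

text \<open>The positions with \<open>F\<close> that precede an entry without \<open>F\<close> in a decreasing list are exactly the larger ones.\<close>

lemma strip_eq_map:
  assumes "decreasing xs"
  shows "strip F b xs = map (\<lambda>(p, c). (p, if b \<noteq> odd (overtaken F (mset xs) p) then switch c else c))
    (filter (\<lambda>(p, _). \<not> F p) xs)"
  using assms
proof (induction xs arbitrary: b)
  case (Cons a xs)
  obtain p c where a: "a = (p, c)" by (cases a)
  have dec: "decreasing xs" and le: "\<And>q d. (q, d) \<in> set xs \<Longrightarrow> q \<le> p"
    using Cons.prems by (auto simp: decreasing_def a)
  show ?case
  proof (cases "F p")
    case True
    have "overtaken F (mset (a # xs)) q = Suc (overtaken F (mset xs) q)"
      if "(q, d) \<in> set xs" "\<not> F q" for q d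
      using le[OF that(1)] that(2) True by (cases "q = p") (auto simp: overtaken_def a)
    then show ?thesis using True Cons.IH[OF dec] by (auto simp: a intro!: map_cong)
  next
    case False
    then have "overtaken F (mset (a # xs)) q = overtaken F (mset xs) q" for q
      by (simp add: overtaken_def a)
    moreover have "s \<notin># filter_mset (\<lambda>(s, _). F s \<and> p < s) (mset xs)" for s
      using le by (cases s) fastforce
    then have "overtaken F (mset xs) p = 0"
      unfolding overtaken_def by (metis multiset_nonemptyE size_empty)
    ultimately show ?thesis using False Cons.IH[OF dec] by (simp add: a)
  qed
qed simp

lemma mset_strip: "decreasing xs \<Longrightarrow> mset (strip F False xs) = reduce F (mset xs)"
  by (simp add: strip_eq_map reduce_def flip: mset_filter)

lemma decreasing_strip:
  assumes "decreasing xs"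
  shows "decreasing (strip F b xs)"
proof -
  have "decreasing (filter (\<lambda>(p, _). \<not> F p) xs)"
    using assms by (simp add: decreasing_def sorted_wrt_filter)
  then show ?thesis
    unfolding strip_eq_map[OF assms]
    by (simp add: decreasing_def sorted_wrt_map case_prod_unfold)
qed


section \<open>Columns\<close>

text \<open>The two affine types differ in \<open>L\<close>, which is \<open>\<ell>\<close> or \<open>2 \<ell>\<close>, and in whether the floor opposite to the
  bottom one is split.\<close>

locale level1_data =
  fixes X :: affine_type and \<Lambda> :: nat
  assumes rank: "3 \<le> rk X" and level: "\<Lambda> \<in> level1 X"
begin

abbreviation n where "n \<equiv> rk X"
abbreviation l where "l \<equiv> ell X"
abbreviation L where "L \<equiv> Lper X"

definition twisted :: bool where "twisted \<longleftrightarrow> X = A2 n"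

text \<open>The bottom floor is split with colours \<open>bot\<close> and \<open>bot + 1\<close>; in type \<open>D\<close> the other split floors have the colours
  \<open>n - bot\<close> and \<open>n - bot + 1\<close>.\<close>

definition bot :: nat where "bot = (if \<not> twisted \<and> \<Lambda> \<in> {n, n + 1} then n else 0)"

text \<open>The colour of the cubes at level \<open>c\<close>, where the level of the floors with the colours of the bottom floor is 1.\<close>

definition mid :: "nat \<Rightarrow> nat" where "mid c = (if bot = 0 then c else n + 1 - c)"

text \<open>The top floor of a column with \<open>p\<close> added blocks: as the ground state block is the first half of the bottom
  floor, each period of \<open>\<ell>\<close> blocks fills \<open>\<ell> - 1\<close> floors.\<close>

definition top :: "nat \<Rightarrow> nat" where "top p = (l - 1) * (p div l) + (p mod l - 1)"

lemma type_cases: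
  obtains (A) "twisted" "X = A2 n" "l = 2 * n - 1" "L = l" "bot = 0"
  | (D) "\<not> twisted" "X = D1 n" "l = n" "L = 2 * l" "bot = (if \<Lambda> \<in> {n, n + 1} then n else 0)"
  unfolding twisted_def bot_def by (cases X) auto

lemma l_ge: "3 \<le> l" and L_ge: "l \<le> L" and l_dvd_L: "l dvd L" and l_pos: "0 < l" and L_pos: "0 < L"
  and L_n: "n < L" "2 * n - 1 \<le> L"
  by (cases rule: type_cases; use rank in simp)+

lemma top_Suc: "top (Suc p) = (if l dvd p then top p else Suc (top p))"
proof -
  define q r where "q = p div l" and "r = p mod l"
  have p: "p = l * q + r" "r < l" using l_pos by (simp_all add: q_def r_def)
  have dvd: "l dvd p \<longleftrightarrow> r = 0" by (simp add: r_def dvd_eq_mod_eq_0)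
  show ?thesis
  proof (cases "Suc r = l")
    case True
    then have "Suc p = l * Suc q" using p by simp
    then have "Suc p div l = Suc q" "Suc p mod l = 0"
      using l_pos by (simp_all only: nonzero_mult_div_cancel_left mod_mult_self1_is_0 neq0_conv)
    moreover have "r \<noteq> 0" using True l_ge by auto
    ultimately show ?thesis using True dvd l_ge
      by (simp add: top_def flip: q_def r_def)
  next
    case False
    then have "Suc p div l = q" "Suc p mod l = Suc r"
      using p(2) by (simp_all add: q_def r_def div_Suc mod_Suc)
    then show ?thesis using dvd by (simp add: top_def flip: q_def r_def)
  qed
qed

lemma top_mono: "p \<le> q \<Longrightarrow> top p \<le> top q"
  by (induction q rule: dec_induct) (auto simp: top_Suc)

lemma top_strict:
  assumes "p < q" "\<not> l dvd p"
  shows "top p < top q"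
  using top_mono[of "Suc p" q] assms by (simp add: top_Suc)

lemma not_dvd_Suc: "l dvd p \<Longrightarrow> \<not> l dvd Suc p"
  using l_ge by (simp add: dvd_eq_mod_eq_0 mod_Suc)

text \<open>Only the second half of a split floor is added without starting a new floor.\<close>

lemma top_eq_dvd:
  assumes "p < q" "top p = top q"
  shows "l dvd p" "q = Suc p"
proof -
  show dvd: "l dvd p" using top_strict assms by fastforce
  show "q = Suc p"
  proof (rule ccontr)
    assume "q \<noteq> Suc p"
    then have "top (Suc p) < top q" using top_strict[of "Suc p" q] not_dvd_Suc[OF dvd] assms by auto
    then show False using assms(2) dvd by (simp add: top_Suc)
  qed
qed

lemma top_surj: "\<exists>p. top p = h \<and> \<not> l dvd p"
proof -
  define a b where "a = h div (l - 1)" and "b = h mod (l - 1)"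
  define c where "c = Suc b"
  define p where "p = l * a + c"
  have "b < l - 1" unfolding b_def using l_ge by (intro mod_less_divisor) simp
  then have "c < l" by (simp add: c_def)
  then have "p div l = a" "p mod l = c" unfolding p_def by simp_all
  then have "top p = (l - 1) * a + b" "\<not> l dvd p" by (simp_all add: top_def dvd_eq_mod_eq_0 c_def)
  moreover have "(l - 1) * a + b = h" by (simp add: a_def b_def)
  ultimately show ?thesis by metis
qed

lemma top_0: "top 0 = 0"
  by (simp add: top_def)

lemma top_eq_0: "l dvd p \<Longrightarrow> top p = 0 \<Longrightarrow> p = 0"
  using l_ge by (auto simp: top_def dvd_eq_mod_eq_0)

lemma cycle_A:
  assumes "j < 2 * m - 2" "3 \<le> m"
  shows "floor_cycle (A2 m) \<Lambda> ! j =
    (if j = 0 then Split 0 1 else if j < m then Unit_Cube (j + 1) else Unit_Cube (2 * m - 1 - j))"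
proof -
  define fs where "fs = map Unit_Cube [2..<m]"
  have len: "length fs = m - 2" and nth: "i < m - 2 \<Longrightarrow> fs ! i = Unit_Cube (i + 2)" for i
    by (simp_all add: fs_def)
  have eq: "floor_cycle (A2 m) \<Lambda> = Split 0 1 # fs @ Unit_Cube m # rev fs"
    by (simp add: fs_def rev_map)
  show ?thesis
    unfolding eq using assms by (auto simp: nth_Cons' nth_append rev_nth len nth)
qed

lemma cycle_D:
  assumes "j < 2 * m - 2" "3 \<le> m" "\<Lambda> \<notin> {m, m + 1}"
  shows "floor_cycle (D1 m) \<Lambda> ! j =
    (if j = 0 then Split 0 1 else if j < m - 1 then Unit_Cube (j + 1)
     else if j = m - 1 then Split m (m + 1) else Unit_Cube (2 * m - 1 - j))" (is "_ = ?rhs")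
proof -
  define fs where "fs = map Unit_Cube [2..<m]"
  have len: "length fs = m - 2" and nth: "i < m - 2 \<Longrightarrow> fs ! i = Unit_Cube (i + 2)" for i
    by (simp_all add: fs_def)
  let ?xs = "Split 0 1 # fs @ Split m (m + 1) # rev fs"
  have eq: "floor_cycle (D1 m) \<Lambda> = ?xs"
    using assms(3) by (simp add: fs_def rev_map)
  consider "j = 0" | "0 < j" "j < m - 1" | "j = m - 1" | "m \<le> j" by linarith
  then have "?xs ! j = ?rhs"
  proof cases
    case 4
    then obtain d where "j = m + d" using le_Suc_ex by blast
    then show "?xs ! j = ?rhs"
      using assms(1,2) by (simp add: nth_Cons' nth_append rev_nth len nth) arith?
  qed (use assms(1,2) in \<open>simp_all add: nth_Cons' nth_append rev_nth len nth\<close>)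
  then show ?thesis by (simp only: eq)
qed

lemma cycle_D':
  assumes "j < 2 * m - 2" "3 \<le> m" "\<Lambda> \<in> {m, m + 1}"
  shows "floor_cycle (D1 m) \<Lambda> ! j =
    (if j = 0 then Split m (m + 1) else if j < m - 1 then Unit_Cube (m - j)
     else if j = m - 1 then Split 0 1 else Unit_Cube (j + 2 - m))" (is "_ = ?rhs")
proof -
  define fs where "fs = map Unit_Cube [2..<m]"
  have len: "length fs = m - 2" and nth: "i < m - 2 \<Longrightarrow> fs ! i = Unit_Cube (i + 2)" for i
    by (simp_all add: fs_def)
  let ?xs = "Split m (m + 1) # rev fs @ Split 0 1 # fs"
  have eq: "floor_cycle (D1 m) \<Lambda> = ?xs"
    using assms(3) by (auto simp: fs_def rev_map)
  consider "j = 0" | "0 < j" "j < m - 1" | "j = m - 1" | "m \<le> j" by linarith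
  then have "?xs ! j = ?rhs"
  proof cases
    case 4
    then obtain d where "j = m + d" using le_Suc_ex by blast
    then show "?xs ! j = ?rhs"
      using assms(1,2) by (simp add: nth_Cons' nth_append rev_nth len nth) arith?
  qed (use assms(1,2) in \<open>simp_all add: nth_Cons' nth_append rev_nth len nth, arith?\<close>)
  then show ?thesis by (simp only: eq)
qed
text \<open>A period of the floors comprises \<open>L\<close> blocks, so the floor of the \<open>t\<close>-th block depends on \<open>t mod L\<close> only.\<close>

lemma floor_at_top:
  "floor_at X \<Lambda> (top t) =
     (if t mod L \<le> 1 then Split bot (bot + 1)
      else if \<not> twisted \<and> t mod L \<in> {n, n + 1} then Split (n - bot) (n - bot + 1)
      else Unit_Cube (mid (if t mod L \<le> n then t mod L else L + 1 - t mod L)))"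
proof (cases rule: type_cases)
  case A
  have len: "length (floor_cycle X \<Lambda>) = 2 * n - 2"
    using rank by (subst A(2)) simp
  define r where "r = t mod L"
  have r: "r < 2 * n - 1" using L_pos A by (simp add: r_def)
  have "l - 1 = 2 * n - 2" using A(3) by simp
  then have "top t = (2 * n - 2) * (t div l) + (r - 1)" using A(4) by (simp add: top_def r_def)
  then have "top t mod (2 * n - 2) = r - 1" using r rank by simp
  then have "floor_at X \<Lambda> (top t) = floor_cycle (A2 n) \<Lambda> ! (r - 1)"
    unfolding floor_at_def len by (subst A(2)) simp
  also have "\<dots> = (if r - 1 = 0 then Split 0 1 else if r - 1 < n then Unit_Cube (r - 1 + 1)
      else Unit_Cube (2 * n - 1 - (r - 1)))"
    using r rank by (intro cycle_A) auto
  finally have fl: "floor_at X \<Lambda> (top t) = \<dots>" .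
  have "L + 1 - r = 2 * n - r" using A rank by simp
  then show ?thesis unfolding fl r_def[symmetric] using r A(1,5) rank by (auto simp: mid_def)
next
  case D
  have len: "length (floor_cycle X \<Lambda>) = 2 * n - 2"
    using rank by (subst D(2)) auto
  define s a e where "s = t mod n" and "a = t div n div 2" and "e = t div n mod 2"
  have s: "s < n" using rank by (simp add: s_def)
  have e: "e = 0 \<or> e = 1" by (auto simp: e_def)
  have q: "t div n = 2 * a + e" by (simp add: a_def e_def)
  have "t = n * (2 * a + e) + s" using q by (simp add: s_def flip: q)
  then have "t = (2 * n) * a + (n * e + s)" by (simp add: algebra_simps)
  moreover have "n * e + s < 2 * n" using e s by auto
  ultimately have tL: "t mod L = n * e + s" using D by simp
  have "top t = (n - 1) * (2 * a + e) + (s - 1)" using D q by (simp add: top_def s_def)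
  also have "\<dots> = (2 * n - 2) * a + ((n - 1) * e + (s - 1))"
    by (simp add: algebra_simps diff_mult_distrib)
  finally have "top t = (2 * n - 2) * a + ((n - 1) * e + (s - 1))" .
  moreover have lt: "(n - 1) * e + (s - 1) < 2 * n - 2" using e s rank by auto
  ultimately have "top t mod (2 * n - 2) = (n - 1) * e + (s - 1)" by simp
  then have fl: "floor_at X \<Lambda> (top t) = floor_cycle (D1 n) \<Lambda> ! ((n - 1) * e + (s - 1))"
    unfolding floor_at_def len by (subst D(2)) simp
  have L1: "L + 1 = 2 * n + 1" using D by simp
  from e show ?thesis
  proof
    assume [simp]: "e = 0"
    show ?thesis
    proof (cases "\<Lambda> \<in> {n, n + 1}")
      case True
      then have "bot = n" using D(5) by simp
      then show ?thesis
        unfolding fl cycle_D'[OF lt rank True] tL L1 using s rank D(1) by (auto simp: mid_def)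
    next
      case False
      then have "bot = 0" using D(5) by simp
      then show ?thesis
        unfolding fl cycle_D[OF lt rank False] tL L1 using s rank D(1) by (auto simp: mid_def)
    qed
  next
    assume [simp]: "e = 1"
    show ?thesis
    proof (cases "\<Lambda> \<in> {n, n + 1}")
      case True
      then have "bot = n" using D(5) by simp
      then show ?thesis
        unfolding fl cycle_D'[OF lt rank True] tL L1 using s rank D(1) by (auto simp: mid_def)
    next
      case False
      then have "bot = 0" using D(5) by simp
      then show ?thesis
        unfolding fl cycle_D[OF lt rank False] tL L1 using s rank D(1) by (auto simp: mid_def)
    qed
  qed
qed

lemma mod_L_mod_l: "t mod L mod l = t mod l"
  using l_dvd_L by (simp add: mod_mod_cancel)

lemma split_residue: "t mod l \<le> 1 \<longleftrightarrow> t mod L \<le> 1 \<or> \<not> twisted \<and> t mod L \<in> {n, n + 1}"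
proof (cases rule: type_cases)
  case D
  define r where "r = t mod L"
  have lt: "r < 2 * n" using D rank by (simp add: r_def)
  have tl: "t mod l = r mod n" using mod_L_mod_l[of t] D(3) by (simp add: r_def)
  show ?thesis
  proof (cases "r < n")
    case True
    then show ?thesis unfolding tl r_def[symmetric] by simp
  next
    case False
    then have "r mod n = r - n" using lt by (simp add: le_mod_geq)
    then show ?thesis unfolding tl r_def[symmetric] using False D(1) rank by auto
  qed
next
  case A
  then show ?thesis by simp
qed

lemma slots_top: "floor_slots (floor_at X \<Lambda> (top t)) = (if t mod l \<le> 1 then {PosA, PosB} else {Whole})"
  unfolding floor_at_top split_residue by simp

lemma slots_nonempty: "floor_slots f \<noteq> {}"
  by (cases f) simp_all

text \<open>The occupied places of a column with \<open>p\<close> added blocks, where \<open>c\<close> gives the position of the top block if the top floor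
  is half-filled.\<close>

definition column :: "nat \<times> colour \<Rightarrow> (nat \<times> slot) set" where
  "column = (\<lambda>(p, c). {(h, s). s \<in> floor_slots (floor_at X \<Lambda> h) \<and>
     (h < top p \<or> h = top p \<and> (\<not> l dvd p \<or> s = (if c = White then PosA else PosB)))})"

text \<open>The place of the \<open>t\<close>-th block if position A is always filled before position B; block 0 belongs to the ground
  state.\<close>

definition block :: "nat \<Rightarrow> nat \<times> slot" where
  "block t = (top t, if l dvd t then PosA else if t mod l = 1 then PosB else Whole)"

lemma slots_dvd: "l dvd t \<Longrightarrow> floor_slots (floor_at X \<Lambda> (top t)) = {PosA, PosB}"
  by (simp add: slots_top dvd_eq_mod_eq_0)

lemma column_Suc_dvd:
  assumes "l dvd p"
  shows "column (Suc p, c) = insert (top p, PosB) (column (p, White))"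
  using slots_dvd[OF assms] not_dvd_Suc[OF assms] assms
  by (auto simp: column_def top_Suc)

lemma column_Suc_not_dvd:
  assumes "\<not> l dvd p" "l dvd Suc p"
  shows "column (Suc p, c) = insert (top (Suc p), if c = White then PosA else PosB) (column (p, White))"
  using slots_dvd[OF assms(2)] assms
  by (auto simp: column_def top_Suc less_Suc_eq)

lemma column_Suc_cube:
  assumes "\<not> l dvd p" "\<not> l dvd Suc p"
  shows "column (Suc p, c) = insert (top (Suc p), Whole) (column (p, White))"
proof -
  have "Suc p mod l > 1" using assms by (auto simp: dvd_eq_mod_eq_0 mod_Suc split: if_splits)
  then have "floor_slots (floor_at X \<Lambda> (top (Suc p))) = {Whole}" by (simp add: slots_top)
  then show ?thesis using assms by (auto simp: column_def top_Suc less_Suc_eq)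
qed

lemma column_0: "column (0, White) = {(0, PosA)}"
  using slots_dvd[of 0] by (auto simp: column_def top_0)

lemma column_white: "column (p, White) = block ` {..p}"
proof (induction p)
  case 0
  then show ?case by (simp add: column_0 block_def top_0)
next
  case (Suc p)
  have "column (Suc p, White) = insert (block (Suc p)) (column (p, White))"
  proof (cases "l dvd p")
    case True
    then have "Suc p mod l = 1" using l_ge by (simp add: dvd_eq_mod_eq_0 mod_Suc)
    then show ?thesis
      using True not_dvd_Suc[OF True] by (simp add: column_Suc_dvd block_def top_Suc)
  next
    case False
    have "Suc p mod l \<noteq> 1" using False by (auto simp: dvd_eq_mod_eq_0 mod_Suc split: if_splits)
    then show ?thesis
      using False column_Suc_not_dvd[OF False] column_Suc_cube[OF False] by (simp add: block_def)
  qed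
  then show ?case using Suc by (simp add: atMost_Suc)
qed

lemma inj_block: "inj block"
proof (rule inj_onI)
  fix s t assume eq: "block s = block t"
  have "\<not> a < b" if "block a = block b" for a b
  proof
    assume "a < b"
    moreover have "top a = top b" using that by (simp add: block_def)
    ultimately have "l dvd a" "b = Suc a" using top_eq_dvd by blast+
    then show False using that not_dvd_Suc[of a] by (auto simp: block_def split: if_splits)
  qed
  then show "s = t" using eq by (metis linorder_neqE_nat)
qed

lemma column_gray:
  assumes "l dvd p" "p \<noteq> 0"
  shows "column (p, Gray) = insert (top p, PosB) (block ` {..p - 1})" "(top p, PosB) \<notin> block ` {..p - 1}"
proof -
  obtain p' where p: "p = Suc p'" using assms(2) by (cases p) auto
  have nd: "\<not> l dvd p'" using assms(1) not_dvd_Suc p by blast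
  show "column (p, Gray) = insert (top p, PosB) (block ` {..p - 1})"
    using column_Suc_not_dvd[OF nd] assms(1) by (simp add: p column_white)
  have "top p \<noteq> top t" if "t \<le> p'" for t
    using top_mono[OF that] nd by (simp add: p top_Suc)
  then show "(top p, PosB) \<notin> block ` {..p - 1}" by (auto simp: p block_def)
qed

lemma column_white_eq: "\<not> l dvd p \<Longrightarrow> column (p, c) = column (p, White)"
  by (simp add: column_def)


lemma card_column:
  assumes "p = 0 \<longrightarrow> c = White"
  shows "finite (column (p, c))" "card (column (p, c)) = Suc p"
proof -
  have inj: "inj_on block A" for A using inj_block by (rule inj_on_subset) simp
  have "finite (column (p, c)) \<and> card (column (p, c)) = Suc p"
  proof (cases "c = White \<or> \<not> l dvd p")
    case True
    then have "column (p, c) = block ` {..p}" using column_white_eq[of p c] by (auto simp: column_white)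
    then show ?thesis by (simp add: card_image inj)
  next
    case False
    then have "c = Gray" "l dvd p" "p \<noteq> 0" using assms by (cases c; simp)+
    then show ?thesis using column_gray[of p] by (simp add: card_image inj)
  qed
  then show "finite (column (p, c))" "card (column (p, c)) = Suc p" by auto
qed

lemma ground_in_column: "p = 0 \<longrightarrow> c = White \<Longrightarrow> (0, PosA) \<in> column (p, c)"
  using slots_dvd[of 0] top_eq_0[of p] by (auto simp: column_def top_0)

text \<open>The column with more blocks also fills the position that the other one leaves free.\<close>

lemma column_mono:
  assumes "q < p"
  shows "column (q, d) \<subseteq> column (p, c)"
proof (cases "top q = top p")
  case True
  then have "l dvd q" "p = Suc q" using top_eq_dvd[OF assms] by auto
  then show ?thesis using not_dvd_Suc[of q] True by (auto simp: column_def)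
next
  case False
  then have "top q < top p" using top_mono[of q p] assms by simp
  then show ?thesis by (auto simp: column_def)
qed

lemma column_colour: "l dvd p \<Longrightarrow> column (p, c) \<subseteq> column (p, d) \<Longrightarrow> c = d"
proof -
  assume p: "l dvd p" and sub: "column (p, c) \<subseteq> column (p, d)"
  have "(top p, if c = White then PosA else PosB) \<in> column (p, c)"
    using slots_dvd[OF p] by (simp add: column_def)
  then have "(top p, if c = White then PosA else PosB) \<in> column (p, d)" using sub by blast
  then show ?thesis using p by (cases c; cases d) (simp_all add: column_def)
qed

lemma column_floors: "{h. \<exists>s. (h, s) \<in> column (p, c)} = {..top p}"
proof (intro equalityI subsetI)
  fix h assume "h \<in> {..top p}"
  then consider "h < top p" | "h = top p" "\<not> l dvd p" | "h = top p" "l dvd p" by fastforce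
  then show "h \<in> {h. \<exists>s. (h, s) \<in> column (p, c)}"
  proof cases
    case 3
    then have "(h, if c = White then PosA else PosB) \<in> column (p, c)"
      using slots_dvd[of p] by (simp add: column_def)
    then show ?thesis by blast
  next
  qed (use slots_nonempty in \<open>auto simp: column_def\<close>)
qed (auto simp: column_def)


section \<open>Walls as sequences of columns\<close>

text \<open>A sequence lists the columns from right to left, starting with index 0, as pairs of a number of added blocks
  and the colour of the bead.\<close>

definition columns :: "(nat \<Rightarrow> nat \<times> colour) set" where
  "columns = {x \<in> Pprime. (\<forall>i. \<not> l dvd fst (x i) \<longrightarrow> snd (x i) = White) \<and>
     (\<forall>i j. \<not> l dvd fst (x i) \<longrightarrow> fst (x i) = fst (x j) \<longrightarrow> i = j)}"

definition wall_of :: "(nat \<Rightarrow> nat \<times> colour) \<Rightarrow> wall" where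
  "wall_of x = {(k, h, s). k \<ge> 1 \<and> (h, s) \<in> column (x (k - 1))}"

lemma columns_Pprime: "x \<in> columns \<Longrightarrow> x \<in> Pprime"
  and columns_white: "x \<in> columns \<Longrightarrow> \<not> l dvd fst (x i) \<Longrightarrow> snd (x i) = White"
  and columns_distinct: "x \<in> columns \<Longrightarrow> \<not> l dvd fst (x i) \<Longrightarrow> fst (x i) = fst (x j) \<Longrightarrow> i = j"
  unfolding columns_def by blast+

lemma wall_of_Suc [simp]: "(Suc i, h, s) \<in> wall_of x \<longleftrightarrow> (h, s) \<in> column (x i)"
  by (simp add: wall_of_def)

lemma columns_zero: "x \<in> columns \<Longrightarrow> fst (x i) = 0 \<longrightarrow> snd (x i) = White"
  using Pprime_zero columns_Pprime by blast

lemma top_floor_wall_of: "top_floor (wall_of x) (Suc i) = top (fst (x i))"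
  using column_floors[of "fst (x i)" "snd (x i)"]
  by (simp add: top_floor_def) (intro Max_eqI; simp)

lemma full_column_wall_of: "full_column X \<Lambda> (wall_of x) (Suc i) \<longleftrightarrow> \<not> l dvd fst (x i)"
proof -
  obtain p c where x: "x i = (p, c)" by (cases "x i")
  show ?thesis
    using slots_dvd[of p] unfolding full_column_def top_floor_wall_of x fst_conv
    by (auto simp: column_def x)
qed

lemma added_count_wall_of:
  assumes "fst (x i) = 0 \<longrightarrow> snd (x i) = White"
  shows "added_count (wall_of x) (Suc i) = fst (x i)"
proof -
  obtain p c where x: "x i = (p, c)" by (cases "x i")
  have pc: "p = 0 \<longrightarrow> c = White" using assms x by simp
  have "{(h, s). (Suc i, h, s) \<in> wall_of x - ground_wall} = column (p, c) - {(0, PosA)}"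
    using x by (auto simp: ground_wall_def)
  then show ?thesis
    using card_column[OF pc] ground_in_column[OF pc] by (simp add: added_count_def x)
qed

lemma bead_colour_wall_of:
  assumes "x \<in> columns"
  shows "bead_colour (wall_of x) (Suc i) = snd (x i)"
proof -
  obtain p c where x: "x i = (p, c)" by (cases "x i")
  show ?thesis
  proof (cases "l dvd p")
    case True
    then show ?thesis using slots_dvd[of p] unfolding bead_colour_def top_floor_wall_of x
      by (cases c) (auto simp: column_def x)
  next
    case False
    then have "c = White" using columns_white[OF assms, of i] x by simp
    then show ?thesis using False unfolding bead_colour_def top_floor_wall_of x
      by (auto simp: column_def x slots_top)
  qed
qed

lemma beads_wall_of:
  assumes x: "x \<in> columns"
  shows "beads (wall_of x) = parts_mset x"
proof -
  have count: "added_count (wall_of x) (Suc i) = fst (x i)" for i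
    using added_count_wall_of columns_zero[OF x] by blast
  have "{k. k \<ge> 1 \<and> added_count (wall_of x) k \<noteq> 0} = Suc ` {i. fst (x i) \<noteq> 0}"
  proof (intro equalityI subsetI)
    fix k assume k: "k \<in> {k. k \<ge> 1 \<and> added_count (wall_of x) k \<noteq> 0}"
    then obtain i where "k = Suc i" by (cases k) auto
    then show "k \<in> Suc ` {i. fst (x i) \<noteq> 0}" using k count by simp
  qed (use count in auto)
  then have "mset_set {k. k \<ge> 1 \<and> added_count (wall_of x) k \<noteq> 0} =
      image_mset Suc (mset_set {i. fst (x i) \<noteq> 0})"
    by (simp only: image_mset_mset_set inj_Suc)
  then have "beads (wall_of x) =
      image_mset (\<lambda>i. (added_count (wall_of x) (Suc i), bead_colour (wall_of x) (Suc i)))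
        (mset_set {i. fst (x i) \<noteq> 0})"
    unfolding beads_def by (simp only: multiset.map_comp comp_def)
  then show ?thesis
    by (simp add: parts_mset_def count bead_colour_wall_of[OF x])
qed

lemma wall_of_proper:
  assumes x: "x \<in> columns"
  shows "wall_of x \<in> proper_walls X \<Lambda>"
proof -
  note zero = columns_zero[OF x]
  have part: "is_partition (fst \<circ> x)" using Pprime_partition columns_Pprime[OF x] by blast
  define N where "N = conj_part (fst \<circ> x) 0"
  have tail: "x i = (0, White)" if "i \<ge> N" for i
    using partition_zero_iff[OF part, of i] that zero[of i] by (simp add: N_def prod_eq_iff)
  have "ground_wall \<subseteq> wall_of x"
  proof
    fix b assume "b \<in> ground_wall"
    then obtain i where "b = (Suc i, 0, PosA)" by (auto simp: ground_wall_def dest!: Suc_le_D)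
    then show "b \<in> wall_of x"
      using ground_in_column[of "fst (x i)" "snd (x i)"] zero[of i] by simp
  qed
  moreover have "finite (wall_of x - ground_wall)"
  proof (rule finite_subset)
    show "finite (\<Union>i<N. (\<lambda>(h, s). (Suc i, h, s)) ` column (x i))"
    proof (intro finite_UN_I finite_imageI)
      show "finite (column (x i))" for i
        using card_column(1)[of "fst (x i)" "snd (x i)"] zero[of i] by simp
    qed simp
    show "wall_of x - ground_wall \<subseteq> (\<Union>i<N. (\<lambda>(h, s). (Suc i, h, s)) ` column (x i))"
    proof
      fix b assume b: "b \<in> wall_of x - ground_wall"
      obtain k h s where bk: "b = (k, h, s)" by (cases b)
      then obtain i where i: "k = Suc i" using b by (cases k) (auto simp: wall_of_def)
      have mem: "(h, s) \<in> column (x i)" using b bk i by simp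
      have "i < N"
      proof (rule ccontr)
        assume "\<not> i < N"
        then have "(h, s) = (0, PosA)" using mem tail[of i] column_0 by simp
        then show False using b bk i by (simp add: ground_wall_def)
      qed
      then show "b \<in> (\<Union>i<N. (\<lambda>(h, s). (Suc i, h, s)) ` column (x i))"
        using mem bk i by force
    qed
  qed
  moreover have "k \<ge> 1 \<and> s \<in> floor_slots (floor_at X \<Lambda> h)" if "(k, h, s) \<in> wall_of x" for k h s
    using that by (auto simp: wall_of_def column_def split: prod.splits)
  moreover have "(k, h, t) \<in> wall_of x"
    if "(k, Suc h, s) \<in> wall_of x" "t \<in> floor_slots (floor_at X \<Lambda> h)" for k h s t
    using that by (auto simp: wall_of_def column_def split: prod.splits)
  moreover have "(k, h, s) \<in> wall_of x" if "k \<ge> 1" "(Suc k, h, s) \<in> wall_of x" for k h s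
  proof -
    obtain i where i: "k = Suc i" using \<open>k \<ge> 1\<close> by (cases k) auto
    have "column (x (Suc i)) \<subseteq> column (x i)"
    proof (cases "fst (x (Suc i)) = fst (x i)")
      case True
      then have "x (Suc i) = x i"
        using Pprime_same[OF columns_Pprime[OF x] True] by (simp add: prod_eq_iff)
      then show ?thesis by simp
    next
      case False
      then have "fst (x (Suc i)) < fst (x i)" using partition_le[OF part, of i "Suc i"] by simp
      then show ?thesis
        using column_mono[of "fst (x (Suc i))" "fst (x i)" "snd (x (Suc i))" "snd (x i)"] by simp
    qed
    then show ?thesis using that i by auto
  qed
  ultimately have "young_wall X \<Lambda> (wall_of x)" unfolding young_wall_def by blast
  moreover have "top_floor (wall_of x) j \<noteq> top_floor (wall_of x) k"
    if "j \<ge> 1" "k \<ge> 1" "j \<noteq> k" "full_column X \<Lambda> (wall_of x) j" "full_column X \<Lambda> (wall_of x) k"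
    for j k
  proof -
    obtain i i' where ii: "j = Suc i" "k = Suc i'" using \<open>j \<ge> 1\<close> \<open>k \<ge> 1\<close> Suc_le_D by (metis One_nat_def)
    have full: "\<not> l dvd fst (x i)" "\<not> l dvd fst (x i')"
      using that ii by (simp_all add: full_column_wall_of)
    then have "fst (x i) \<noteq> fst (x i')" using columns_distinct[OF x] ii that(3) by blast
    then consider "fst (x i) < fst (x i')" | "fst (x i') < fst (x i)" by linarith
    then have "top (fst (x i)) \<noteq> top (fst (x i'))"
      by cases (use top_strict full in fastforce)+
    then show ?thesis by (simp add: ii top_floor_wall_of)
  qed
  ultimately show ?thesis unfolding proper_walls_def by blast
qed

text \<open>All floors below the highest one are completely filled. The highest floor is filled as well, or it is split
  and just one of its positions is occupied.\<close>

lemma column_exists: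
  assumes fin: "finite C" and ground: "(0, PosA) \<in> C"
    and slots: "\<And>h s. (h, s) \<in> C \<Longrightarrow> s \<in> floor_slots (floor_at X \<Lambda> h)"
    and below: "\<And>h s t. (Suc h, s) \<in> C \<Longrightarrow> t \<in> floor_slots (floor_at X \<Lambda> h) \<Longrightarrow> (h, t) \<in> C"
  shows "\<exists>p c. C = column (p, c) \<and> (\<not> l dvd p \<or> p = 0 \<longrightarrow> c = White)"
proof -
  define t where "t = Max (fst ` C)"
  have "fst ` C \<noteq> {}" using ground by blast
  then have "t \<in> fst ` C" unfolding t_def using fin by (intro Max_in) auto
  then obtain s0 where s0: "(t, s0) \<in> C" by auto
  have le: "h \<le> t" if "(h, s) \<in> C" for h s
    unfolding t_def using fin that by (intro Max_ge) force+
  have ex: "\<exists>s. (h, s) \<in> C" if "h \<le> t" for h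
    using that
  proof (induction h rule: inc_induct)
    case (step h)
    then obtain s where "(Suc h, s) \<in> C" by blast
    then show ?case using below slots_nonempty by blast
  qed (use s0 in blast)
  have low: "(h, s) \<in> C" if "h < t" "s \<in> floor_slots (floor_at X \<Lambda> h)" for h s
    using ex[of "Suc h"] below that by (metis Suc_leI)
  \<comment> \<open>The number of added blocks if the top floor is full; otherwise it is one less.\<close>
  obtain q where q: "top q = t" "\<not> l dvd q" using top_surj by blast
  show ?thesis
  proof (cases "\<forall>s \<in> floor_slots (floor_at X \<Lambda> t). (t, s) \<in> C")
    case True
    have "C = column (q, White)"
    proof (intro equalityI subrelI)
      fix h s assume hs: "(h, s) \<in> C"
      then have "h < t \<or> h = t" "s \<in> floor_slots (floor_at X \<Lambda> h)"
        using le[OF hs] slots[OF hs] by auto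
      then show "(h, s) \<in> column (q, White)" using q by (simp add: column_def)
    next
      fix h s assume "(h, s) \<in> column (q, White)"
      then have "h < t \<or> h = t" "s \<in> floor_slots (floor_at X \<Lambda> h)"
        using q by (auto simp: column_def)
      then show "(h, s) \<in> C" using low[of h s] True by blast
    qed
    then show ?thesis by (intro exI[of _ q] exI[of _ White]) simp
  next
    case False
    have "floor_slots (floor_at X \<Lambda> t) \<noteq> {Whole}"
    proof
      assume "floor_slots (floor_at X \<Lambda> t) = {Whole}"
      then show False using slots[OF s0] s0 False by (metis singletonD)
    qed
    then have "q mod l \<le> 1" using slots_top[of q] unfolding q(1) by argo
    then have q1: "q mod l = 1" using q(2) by (simp add: dvd_eq_mod_eq_0)
    define p where "p = q - 1"
    have pq: "q = Suc p" using q1 by (cases q) (auto simp: p_def)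
    have p: "l dvd p" using dvd_minus_mod[of l q] by (simp add: p_def q1)
    have tp: "top p = t" using q(1) p by (simp add: pq top_Suc)
    have sl: "floor_slots (floor_at X \<Lambda> t) = {PosA, PosB}" using slots_dvd[OF p] tp by simp
    define c where "c = (if (t, PosA) \<in> C then White else Gray)"
    have at: "(t, s) \<in> C \<longleftrightarrow> s = (if c = White then PosA else PosB)" for s
      using False slots[of t s] s0 slots[OF s0] by (auto simp: sl c_def)
    have "C = column (p, c)"
    proof (intro equalityI subrelI)
      fix h s assume hs: "(h, s) \<in> C"
      then have "h < t \<or> h = t \<and> s = (if c = White then PosA else PosB)"
        using le[OF hs] at[of s] by (cases "h = t") auto
      then show "(h, s) \<in> column (p, c)" using slots[OF hs] tp by (auto simp: column_def)
    next
      fix h s assume "(h, s) \<in> column (p, c)"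
      then have "s \<in> floor_slots (floor_at X \<Lambda> h)"
        "h < t \<or> h = t \<and> s = (if c = White then PosA else PosB)"
        using tp p by (auto simp: column_def)
      then show "(h, s) \<in> C" using low[of h s] at[of s] by blast
    qed
    moreover have "c = White" if "p = 0" using that tp ground by (simp add: c_def top_0)
    ultimately show ?thesis using p by (intro exI[of _ p] exI[of _ c]) simp
  qed
qed

text \<open>Containment of neighbouring columns gives the order of the block numbers and the equality of colours for
  half-filled columns of the same height; properness separates the full ones.\<close>

lemma proper_wall_of:
  assumes Y: "Y \<in> proper_walls X \<Lambda>"
  shows "\<exists>x \<in> columns. Y = wall_of x"
proof -
  have ground: "ground_wall \<subseteq> Y" and fin: "finite (Y - ground_wall)"
    and pos: "\<And>k h s. (k, h, s) \<in> Y \<Longrightarrow> k \<ge> 1"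
    and slots: "\<And>k h s. (k, h, s) \<in> Y \<Longrightarrow> s \<in> floor_slots (floor_at X \<Lambda> h)"
    and below: "\<And>k h s t. (k, Suc h, s) \<in> Y \<Longrightarrow> t \<in> floor_slots (floor_at X \<Lambda> h) \<Longrightarrow> (k, h, t) \<in> Y"
    and right: "\<And>k h s. k \<ge> 1 \<Longrightarrow> (Suc k, h, s) \<in> Y \<Longrightarrow> (k, h, s) \<in> Y"
    using Y unfolding proper_walls_def young_wall_def by blast+
  have "\<exists>a. {(h, s). (Suc i, h, s) \<in> Y} = column a \<and>
      (\<not> l dvd fst a \<or> fst a = 0 \<longrightarrow> snd a = White)" for i
  proof -
    have "{(h, s). (Suc i, h, s) \<in> Y} \<subseteq> insert (0, PosA) (snd ` (Y - ground_wall))"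
      by (force simp: ground_wall_def)
    then have "finite {(h, s). (Suc i, h, s) \<in> Y}" using fin finite_subset by blast
    then have "\<exists>p c. {(h, s). (Suc i, h, s) \<in> Y} = column (p, c) \<and>
        (\<not> l dvd p \<or> p = 0 \<longrightarrow> c = White)"
    proof (rule column_exists)
      show "(0, PosA) \<in> {(h, s). (Suc i, h, s) \<in> Y}" using ground by (auto simp: ground_wall_def)
    qed (use slots below in blast)+
    then show ?thesis by force
  qed
  then obtain x where C: "\<And>i. {(h, s). (Suc i, h, s) \<in> Y} = column (x i)"
    and white: "\<And>i. \<not> l dvd fst (x i) \<or> fst (x i) = 0 \<Longrightarrow> snd (x i) = White"
    by metis
  have mem: "(Suc i, h, s) \<in> Y \<longleftrightarrow> (h, s) \<in> column (x i)" for i h s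
    unfolding C[symmetric] by simp
  have Yx: "Y = wall_of x"
  proof (rule set_eqI)
    fix b :: "nat \<times> nat \<times> slot"
    obtain k h s where b: "b = (k, h, s)" by (cases b)
    show "b \<in> Y \<longleftrightarrow> b \<in> wall_of x"
      using pos[of k h s] by (cases k) (auto simp: b mem, simp add: wall_of_def)
  qed
  have card: "finite (column (x i))" "card (column (x i)) = Suc (fst (x i))" for i
    using card_column[of "fst (x i)" "snd (x i)"] white[of i] by auto
  have sub1: "column (x (Suc i)) \<subseteq> column (x i)" for i
    using right[of "Suc i"] mem[of i] mem[of "Suc i"] by auto
  have sub: "column (x j) \<subseteq> column (x i)" if "i \<le> j" for i j
    using that by (induction j rule: dec_induct) (use sub1 in blast)+
  obtain M where M: "fst ` (Y - ground_wall) \<subseteq> {..M}"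
    using finite_nat_set_iff_bounded_le[of "fst ` (Y - ground_wall)"] fin by auto
  have "is_partition (fst \<circ> x)"
  proof (rule is_partitionI)
    show "(fst \<circ> x) (Suc i) \<le> (fst \<circ> x) i" for i
      using card_mono[OF card(1) sub1, of i] card(2) by simp
    show "(fst \<circ> x) i = 0" if "i \<ge> M" for i
    proof -
      have "column (x i) \<subseteq> {(0, PosA)}"
      proof (rule subrelI)
        fix h s assume hs: "(h, s) \<in> column (x i)"
        have "Suc i \<notin> fst ` (Y - ground_wall)" using M that by (meson Suc_n_not_le_n atMost_iff le_trans subsetD)
        then have "(Suc i, h, s) \<in> ground_wall" using hs mem by force
        then show "(h, s) \<in> {(0, PosA)}" by (simp add: ground_wall_def)
      qed
      then have "card (column (x i)) \<le> 1" using card_mono[of "{(0::nat, PosA)}"] by simp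
      then show ?thesis using card(2)[of i] by simp
    qed
  qed
  moreover have "snd (x i) = snd (x j)" if eq: "fst (x i) = fst (x j)" for i j
  proof (cases "l dvd fst (x i)")
    case True
    have "column (x i) \<subseteq> column (x j) \<or> column (x j) \<subseteq> column (x i)"
      using sub[of i j] sub[of j i] by linarith
    then show ?thesis
      using column_colour[OF True, of "snd (x i)" "snd (x j)"]
        column_colour[OF True, of "snd (x j)" "snd (x i)"] eq by (metis prod.collapse)
  next
    case False
    then show ?thesis using white[of i] white[of j] eq by simp
  qed
  ultimately have "x \<in> Pprime" using white unfolding Pprime_def by blast
  moreover have "i = j" if "\<not> l dvd fst (x i)" "fst (x i) = fst (x j)" for i j
  proof (rule ccontr)
    assume "i \<noteq> j"
    moreover have "full_column X \<Lambda> Y (Suc i)" "full_column X \<Lambda> Y (Suc j)"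
      "top_floor Y (Suc i) = top_floor Y (Suc j)"
      using that unfolding Yx full_column_wall_of top_floor_wall_of by simp_all
    moreover have "\<forall>j\<ge>1. \<forall>k\<ge>1. j \<noteq> k \<and> full_column X \<Lambda> Y j \<and> full_column X \<Lambda> Y k \<longrightarrow>
        top_floor Y j \<noteq> top_floor Y k"
      using Y unfolding proper_walls_def by blast
    ultimately show False by simp
  qed
  ultimately have "x \<in> columns" using white unfolding columns_def by blast
  then show ?thesis using Yx by blast
qed


section \<open>Weights\<close>

text \<open>The index ranges over \<open>1..L\<close>, and residue 0 is represented by \<open>L\<close>: in this form the residues of the cubes of
  one colour add up to \<open>L + 1\<close>.\<close>

definition cnt :: "nat \<Rightarrow> nat \<Rightarrow> int" where
  "cnt p c = (\<Sum>t\<in>{1..p}. of_bool (t mod L = c mod L))"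

lemma cnt_0: "cnt 0 c = 0"
  and cnt_Suc: "cnt (Suc p) c = cnt p c + of_bool (Suc p mod L = c mod L)"
  by (simp_all add: cnt_def)

lemma Suc_mod_L: "Suc p mod L = (if Suc (p mod L) = L then 0 else Suc (p mod L))"
  by (rule mod_Suc)

text \<open>Consecutive residue classes are hit alternately.\<close>

lemma cnt_step:
  assumes "1 \<le> c" "c < L"
  shows "cnt p c - cnt p (Suc c) = of_bool (p mod L = c)"
proof (induction p)
  case 0
  then show ?case using assms by (simp add: cnt_0)
next
  case (Suc p)
  have "p mod L < L" using L_pos by simp
  then have "Suc p mod L = Suc c mod L \<longleftrightarrow> p mod L = c"
    using assms by (auto simp: Suc_mod_L mod_Suc)
  then show ?case using Suc assms by (simp add: cnt_Suc)
qed

lemma cnt_ends: "cnt p 1 - cnt p L = of_bool (\<not> L dvd p)"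
proof (induction p)
  case (Suc p)
  have "1 mod L = 1" using L_ge l_ge by simp
  moreover have "Suc p mod L = 1 \<longleftrightarrow> L dvd p"
    using L_ge l_ge by (auto simp: Suc_mod_L dvd_eq_mod_eq_0)
  ultimately show ?case using Suc by (auto simp: cnt_Suc dvd_eq_mod_eq_0)
qed (simp add: cnt_0)

lemma cnt_total: "(\<Sum>c\<in>{1..L}. cnt p c) = int p"
proof (induction p)
  case (Suc p)
  have "(\<Sum>c\<in>{1..L}. of_bool (Suc p mod L = c mod L)) = (1 :: int)"
  proof -
    define c0 where "c0 = (if Suc p mod L = 0 then L else Suc p mod L)"
    have lt: "Suc p mod L < L" using L_pos by simp
    have "Suc p mod L = c mod L \<longleftrightarrow> c = c0" if "c \<in> {1..L}" for c
      using that lt by (cases "c = L") (auto simp: c0_def)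
    then have "(\<Sum>c\<in>{1..L}. of_bool (Suc p mod L = c mod L)) = (\<Sum>c\<in>{1..L}. of_bool (c = c0) :: int)"
      by (intro sum.cong) auto
    also have "\<dots> = 1" using lt L_pos by (simp add: c0_def of_bool_def)
    finally show ?thesis .
  qed
  then show ?case using Suc by (simp add: cnt_Suc sum.distrib)
qed (simp add: cnt_0)

text \<open>The colour of the \<open>t\<close>-th block in column \<open>k\<close>, and the colour of the alternative choice, position B, at a half-filled
  top floor.\<close>

definition bcol :: "nat \<Rightarrow> nat \<Rightarrow> nat" where
  "bcol k t = slot_colour \<Lambda> k (floor_at X \<Lambda> (fst (block t))) (snd (block t))"

definition gcol :: "nat \<Rightarrow> nat \<Rightarrow> nat" where
  "gcol k t = slot_colour \<Lambda> k (floor_at X \<Lambda> (top t)) PosB"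

definition col_weight :: "nat \<Rightarrow> nat \<times> colour \<Rightarrow> (nat \<Rightarrow> int) \<Rightarrow> int" where
  "col_weight k a w = (\<Sum>(h, s)\<in>column a - {(0, PosA)}. w (slot_colour \<Lambda> k (floor_at X \<Lambda> h) s))"

text \<open>A column with a gray bead differs from the one with a white bead in its last block only.\<close>

lemma col_weight_eq:
  assumes "\<not> l dvd p \<or> p = 0 \<longrightarrow> c = White"
  shows "col_weight k (p, c) w = (\<Sum>t\<in>{1..p}. w (bcol k t)) +
    (if c = Gray then w (gcol k p) - w (bcol k p) else 0)"
proof -
  have inj: "inj_on block A" for A using inj_block by (rule inj_on_subset) simp
  have b0: "block 0 = (0, PosA)" by (simp add: block_def top_0)
  have img: "block ` {..q} - {(0, PosA)} = block ` {1..q}" for q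
  proof -
    have "block ` {..q} - block ` {0} = block ` ({..q} - {0})"
      using inj_block by (simp add: image_set_diff)
    also have "{..q} - {0} = {1..q}" by auto
    finally show ?thesis by (simp add: b0)
  qed
  have white: "(\<Sum>(h, s)\<in>block ` {1..q}. w (slot_colour \<Lambda> k (floor_at X \<Lambda> h) s)) =
      (\<Sum>t\<in>{1..q}. w (bcol k t))" for q
    by (simp add: sum.reindex[OF inj] bcol_def case_prod_unfold)
  show ?thesis
  proof (cases c)
    case White
    then show ?thesis by (simp add: col_weight_def column_white img white del: One_nat_def)
  next
    case Gray
    then have p: "l dvd p" "p \<noteq> 0" using assms by auto
    have "column (p, Gray) - {(0, PosA)} = insert (top p, PosB) (block ` {1..p - 1})"
      using column_gray(1)[OF p] img[of "p - 1"] by auto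
    moreover have "(top p, PosB) \<notin> block ` {1..p - 1}" using column_gray(2)[OF p] by auto
    ultimately have "col_weight k (p, c) w = w (gcol k p) + (\<Sum>t\<in>{1..p - 1}. w (bcol k t))"
      using Gray by (simp add: col_weight_def white gcol_def del: One_nat_def)
    moreover have "(\<Sum>t\<in>{1..p}. w (bcol k t)) = (\<Sum>t\<in>{1..p - 1}. w (bcol k t)) + w (bcol k p)"
      using p(2) by (cases p) auto
    ultimately show ?thesis using Gray by simp
  qed
qed

lemma colour_count_wall_of:
  assumes x: "x \<in> columns" and N: "\<And>i. i \<ge> N \<Longrightarrow> fst (x i) = 0"
  shows "int (colour_count X \<Lambda> (wall_of x) i) =
    (\<Sum>k<N. col_weight (Suc k) (x k) (\<lambda>j. of_bool (j = i)))"
proof -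
  define A where "A k = {(h, s) \<in> column (x k) - {(0, PosA)}.
    slot_colour \<Lambda> (Suc k) (floor_at X \<Lambda> h) s = i}" for k
  have fin: "finite (column (x k))" for k
    using card_column(1)[of "fst (x k)" "snd (x k)"] columns_zero[OF x, of k] by simp
  then have finA: "finite (A k)" for k unfolding A_def by (rule rev_finite_subset) auto
  have empty: "A k = {}" if "k \<ge> N" for k
  proof -
    have "x k = (0, White)" using N[OF that] columns_zero[OF x, of k] by (simp add: prod_eq_iff)
    then show ?thesis by (simp add: A_def column_0)
  qed
  have "{(k, h, s). (k, h, s) \<in> wall_of x - ground_wall \<and> slot_colour \<Lambda> k (floor_at X \<Lambda> h) s = i} =
      (\<lambda>(k, b). (Suc k, b)) ` (SIGMA k:{..<N}. A k)" (is "?S = ?T")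
  proof (intro equalityI subsetI)
    fix b assume b: "b \<in> ?S"
    obtain k h s where bk: "b = (k, h, s)" by (cases b)
    then obtain j where j: "k = Suc j" using b by (cases k) (auto simp: wall_of_def)
    have "(h, s) \<in> A j" using b bk j by (auto simp: A_def ground_wall_def)
    moreover from this have "j < N" using empty by (cases "j < N") auto
    ultimately show "b \<in> ?T" using bk j by force
  qed (auto simp: A_def ground_wall_def)
  then have "colour_count X \<Lambda> (wall_of x) i = card ?T" by (simp only: colour_count_def)
  also have "\<dots> = card (SIGMA k:{..<N}. A k)" by (rule card_image) (auto simp: inj_on_def)
  also have "\<dots> = (\<Sum>k<N. card (A k))" using finA by (simp add: card_SigmaI)
  also have "int \<dots> = (\<Sum>k<N. col_weight (Suc k) (x k) (\<lambda>j. of_bool (j = i)))"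
    unfolding of_nat_sum
  proof (rule sum.cong[OF refl])
    fix k
    have Aeq: "A k = {b \<in> column (x k) - {(0, PosA)}.
        case b of (h, s) \<Rightarrow> slot_colour \<Lambda> (Suc k) (floor_at X \<Lambda> h) s = i}"
      by (auto simp: A_def)
    have "int (card (A k)) = (\<Sum>b\<in>A k. 1)" by simp
    also have "\<dots> = (\<Sum>b\<in>column (x k) - {(0, PosA)}.
        if (case b of (h, s) \<Rightarrow> slot_colour \<Lambda> (Suc k) (floor_at X \<Lambda> h) s = i) then 1 else 0)"
      unfolding Aeq using fin[of k] by (intro sum.inter_filter) simp
    also have "\<dots> = col_weight (Suc k) (x k) (\<lambda>j. of_bool (j = i))"
      unfolding col_weight_def by (intro sum.cong) (auto simp: of_bool_def)
    finally show "int (card (A k)) = col_weight (Suc k) (x k) (\<lambda>j. of_bool (j = i))" .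
  qed
  finally show ?thesis .
qed

subsection \<open>Colours of blocks\<close>

text \<open>The sign is 1 if position A of the split floor in column \<open>k\<close> has the larger of the two colours; \<open>sgn0\<close>
  concerns the floors with colours \<open>bot\<close>, \<open>bot + 1\<close> and \<open>sgn1\<close> those with colours \<open>n - bot\<close>, \<open>n - bot + 1\<close>.\<close>

definition sgn0 :: "nat \<Rightarrow> int" where "sgn0 k = (if odd k \<longleftrightarrow> \<Lambda> \<noteq> bot + 1 then 1 else - 1)"
definition sgn1 :: "nat \<Rightarrow> int" where "sgn1 k = (if odd k \<longleftrightarrow> \<Lambda> \<noteq> n - bot + 1 then 1 else - 1)"

lemma block_slot:
  "snd (block t) = (if t mod L = 0 \<or> \<not> twisted \<and> t mod L = n then PosA
     else if t mod L = 1 \<or> \<not> twisted \<and> t mod L = n + 1 then PosB else Whole)"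
proof (cases rule: type_cases)
  case A
  then show ?thesis by (simp add: block_def dvd_eq_mod_eq_0)
next
  case D
  define r where "r = t mod L"
  have lt: "r < 2 * n" using D rank by (simp add: r_def)
  have tl: "t mod l = r mod n" using mod_L_mod_l[of t] D(3) by (simp add: r_def)
  have "n mod n = 0" "Suc n mod n = 1" using rank by (simp_all add: mod_Suc)
  moreover have "r mod n = (if r < n then r else r - n)" using lt by (simp add: le_mod_geq)
  ultimately show ?thesis
    using lt D(1) rank unfolding block_def dvd_eq_mod_eq_0 tl r_def[symmetric]
    by (cases "r < n") auto
qed

lemma bcol_eq:
  "bcol k t = (if t mod L = 0 then (if sgn0 k = 1 then bot + 1 else bot)
     else if t mod L = 1 then (if sgn0 k = 1 then bot else bot + 1)
     else if \<not> twisted \<and> t mod L = n then (if sgn1 k = 1 then n - bot + 1 else n - bot)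
     else if \<not> twisted \<and> t mod L = n + 1 then (if sgn1 k = 1 then n - bot else n - bot + 1)
     else mid (if t mod L \<le> n then t mod L else L + 1 - t mod L))"
  unfolding bcol_def block_slot using rank
  by (simp add: floor_at_top block_def sgn0_def sgn1_def Let_def)

lemma gcol_eq:
  assumes "l dvd t"
  shows "gcol k t = (if L dvd t then (if sgn0 k = 1 then bot else bot + 1)
     else (if sgn1 k = 1 then n - bot else n - bot + 1))"
proof (cases rule: type_cases)
  case A
  then show ?thesis using assms
    by (simp add: gcol_def floor_at_top sgn0_def sgn1_def dvd_eq_mod_eq_0 Let_def)
next
  case D
  have alt: "t mod L = 0 \<or> t mod L = n"
  proof -
    have "t mod L < 2 * n" "n dvd t mod L"
      using D rank assms by (simp_all add: dvd_mod)
    then obtain a where a: "t mod L = n * a" "n * a < n * 2" by (metis dvd_def mult.commute)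
    then have "a < 2" by simp
    then show ?thesis using a by (cases a) auto
  qed
  show ?thesis
  proof (cases "L dvd t")
    case True
    then show ?thesis by (simp add: gcol_def floor_at_top sgn0_def)
  next
    case False
    then have "t mod L = n" using alt by (simp add: dvd_eq_mod_eq_0)
    then show ?thesis using False D(1) rank by (simp add: gcol_def floor_at_top sgn1_def)
  qed
qed


lemma delta_eq: "delta X i = (if i = 0 \<or> i = 1 \<or> i = n \<or> \<not> twisted \<and> i = n + 1 then 1
    else if 2 \<le> i \<and> i < n then 2 else 0)"
  unfolding twisted_def by (cases X) auto

text \<open>The levels \<open>c\<close> up to \<open>n\<close> for which the blocks with residue \<open>c\<close> are unit cubes.\<close>

definition cube_level :: "nat \<Rightarrow> bool" where
  "cube_level c \<longleftrightarrow> 2 \<le> c \<and> c \<le> n \<and> (c < n \<or> twisted)"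

lemma residue_cases:
  obtains (bottomA) "t mod L = 0" | (bottomB) "t mod L = 1"
  | (topA) "\<not> twisted" "t mod L = n" | (topB) "\<not> twisted" "t mod L = n + 1"
  | (cube) c where "cube_level c" "t mod L = c \<or> t mod L = L + 1 - c" "\<And>k. bcol k t = mid c"
proof -
  define r where "r = t mod L"
  define c where "c = (if r \<le> n then r else L + 1 - r)"
  have r: "r < L" using L_pos by (simp add: r_def)
  show ?thesis
  proof (cases "r = 0 \<or> r = 1 \<or> \<not> twisted \<and> (r = n \<or> r = n + 1)")
    case True
    then show ?thesis using bottomA bottomB topA topB by (auto simp: r_def)
  next
    case False
    have "cube_level c"
      by (cases rule: type_cases) (use False r rank in \<open>auto simp: c_def cube_level_def\<close>)
    moreover have "bcol k t = mid c" for k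
      using False unfolding bcol_eq r_def[symmetric] c_def by (simp only: if_False simp_thms de_Morgan_disj de_Morgan_conj) auto
    moreover have "r = c \<or> r = L + 1 - c" using r by (auto simp: c_def)
    ultimately show ?thesis using cube by (simp add: r_def)
  qed
qed

lemma mid_inject: "cube_level c \<Longrightarrow> cube_level c' \<Longrightarrow> mid c = mid c' \<longleftrightarrow> c = c'"
  by (auto simp: mid_def cube_level_def)

lemma bot_cases: "bot = 0 \<or> \<not> twisted \<and> bot = n"
  by (auto simp: bot_def)

lemma mid_range:
  assumes "cube_level c"
  shows "2 \<le> mid c" "mid c \<le> n" "mid c < n \<or> twisted \<and> bot = 0"
  using assms bot_cases by (auto simp: mid_def cube_level_def)

lemma mid_neq:
  assumes "cube_level c"
  shows "mid c \<noteq> bot" "mid c \<noteq> bot + 1" "\<not> twisted \<Longrightarrow> mid c \<noteq> n - bot" "\<not> twisted \<Longrightarrow> mid c \<noteq> n - bot + 1"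
  using mid_range[OF assms] bot_cases rank by auto

lemma split_neq:
  assumes "\<not> twisted"
  shows "n - bot \<noteq> bot" "n - bot \<noteq> bot + 1" "n - bot + 1 \<noteq> bot" "n - bot + 1 \<noteq> bot + 1"
  using bot_cases rank by auto

text \<open>The cubes of one colour lie on the rising and on the falling part of a period, at the residues \<open>c\<close> and
  \<open>L + 1 - c\<close>. In the twisted type and for \<open>c = n\<close> these coincide and the coefficient in the null root is 1
  instead of 2; doubling the count treats both cases alike.\<close>

lemma bcol_mid:
  assumes c: "cube_level c"
  shows "2 * of_bool (bcol k t = mid c) =
    delta X (mid c) * (of_bool (t mod L = c) + of_bool (t mod L = L + 1 - c))"
proof -
  have Lc: "n < L + 1 - c" "L + 1 - c < L" if "\<not> twisted \<or> c < n"
    by (cases rule: type_cases; use that c rank in \<open>auto simp: cube_level_def\<close>)+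
  have cn: "L + 1 - c = c" if "twisted" "c = n"
    using that rank by (cases rule: type_cases) auto
  have range: "2 \<le> c" "c \<le> n" "\<not> twisted \<Longrightarrow> c < n" using c by (auto simp: cube_level_def)
  have d: "delta X (mid c) = (if c = n then 1 else 2)"
    using mid_range[OF c] c rank bot_cases by (auto simp: delta_eq mid_def cube_level_def)
  show ?thesis
  proof (cases t rule: residue_cases)
    case bottomA
    then show ?thesis using mid_neq[OF c] range L_n by (auto simp: bcol_eq)
  next
    case bottomB
    then show ?thesis using mid_neq[OF c] range L_n by (auto simp: bcol_eq)
  next
    case topA
    then show ?thesis using mid_neq[OF c] range Lc rank by (auto simp: bcol_eq)
  next
    case topB
    have "L + 1 - c \<noteq> n + 1"
      using topB(1) range(3) by (cases rule: type_cases) auto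
    then show ?thesis using topB mid_neq[OF c] range Lc rank by (auto simp: bcol_eq)
  next
    case (cube c')
    have c': "2 \<le> c'" "c' \<le> n" "\<not> twisted \<Longrightarrow> c' < n" using cube(1) by (auto simp: cube_level_def)
    have either: "t mod L = c \<or> t mod L = L + 1 - c \<longleftrightarrow> c = c'"
      using cube(2) range c' by (cases rule: type_cases) auto
    have hit: "bcol k t = mid c \<longleftrightarrow> c = c'"
      using mid_inject[OF c cube(1)] cube(3)[of k] by auto
    show ?thesis
    proof (cases "c = n")
      case True
      then have "L + 1 - c = c" using cn range(3) by blast
      then show ?thesis unfolding hit d using either True by simp
    next
      case False
      then have "\<not> (t mod L = c \<and> t mod L = L + 1 - c)" using Lc range by linarith
      then have "of_bool (t mod L = c) + of_bool (t mod L = L + 1 - c) = (of_bool (c = c') :: int)"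
        using either by (cases "t mod L = c"; cases "t mod L = L + 1 - c") auto
      then show ?thesis unfolding hit d using False by simp
    qed
  qed
qed

lemma bcol_bottom:
  shows "(of_bool (bcol k t = bot) + of_bool (bcol k t = bot + 1) =
      (of_bool (t mod L = 1) + of_bool (t mod L = 0) :: int)) \<and>
    of_bool (bcol k t = bot) - of_bool (bcol k t = bot + 1) =
      sgn0 k * (of_bool (t mod L = 1) - of_bool (t mod L = 0) :: int)"
proof (cases t rule: residue_cases)
  case (cube c)
  have "t mod L \<noteq> 0" "t mod L \<noteq> 1"
    using cube(1,2) rank by (cases rule: type_cases; auto simp: cube_level_def)+
  then show ?thesis using cube(3)[of k] mid_neq[OF cube(1)] by simp
next
  case topA
  then show ?thesis using split_neq[OF topA(1)] rank by (simp add: bcol_eq)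
next
  case topB
  then show ?thesis using split_neq[OF topB(1)] rank by (simp add: bcol_eq)
qed (auto simp: bcol_eq sgn0_def)

lemma bcol_top:
  assumes "\<not> twisted"
  shows "(of_bool (bcol k t = n - bot) + of_bool (bcol k t = n - bot + 1) =
      (of_bool (t mod L = n) + of_bool (t mod L = n + 1) :: int)) \<and>
    of_bool (bcol k t = n - bot + 1) - of_bool (bcol k t = n - bot) =
      sgn1 k * (of_bool (t mod L = n) - of_bool (t mod L = n + 1) :: int)"
proof (cases t rule: residue_cases)
  case (cube c)
  have "t mod L \<noteq> n" "t mod L \<noteq> n + 1"
    using cube(1,2) rank assms by (cases rule: type_cases; auto simp: cube_level_def)+
  then show ?thesis using cube(3)[of k] mid_neq[OF cube(1)] assms by simp
next
  case bottomA
  then show ?thesis using split_neq[OF assms] rank by (simp add: bcol_eq)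
next
  case bottomB
  then show ?thesis using split_neq[OF assms] rank by (simp add: bcol_eq)
next
  case topA
  then show ?thesis using rank by (simp add: bcol_eq sgn1_def)
next
  case topB
  then show ?thesis using rank by (simp add: bcol_eq sgn1_def)
qed

lemma colour_cases:
  obtains (bottom) "i = bot \<or> i = bot + 1" | (top) "\<not> twisted" "i = n - bot \<or> i = n - bot + 1"
  | (mid) c where "cube_level c" "i = mid c"
  | (other) "delta X i = 0" "\<And>k t. bcol k t \<noteq> i" "\<And>k t. l dvd t \<Longrightarrow> gcol k t \<noteq> i"
proof -
  define K where "K = (if twisted then n else n + 1)"
  show ?thesis
  proof (cases "i \<le> K")
    case True
    show ?thesis
    proof (cases "i = bot \<or> i = bot + 1 \<or> \<not> twisted \<and> (i = n - bot \<or> i = n - bot + 1)")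
      case False
      define c where "c = (if bot = 0 then i else n + 1 - i)"
      have "cube_level c \<and> i = mid c"
        using False True bot_cases unfolding cube_level_def c_def mid_def K_def
        by (cases twisted) auto
      then show ?thesis using mid by blast
    qed (use bottom top in blast)
  next
    case False
    have "delta X i = 0"
      using False rank by (auto simp: K_def delta_eq split: if_splits)
    moreover have "bcol k t \<le> K" for k t
    proof (cases t rule: residue_cases)
      case (cube c)
      then show ?thesis using mid_range(2)[OF cube(1)] by (simp add: K_def)
    qed (use bot_cases rank in \<open>auto simp: bcol_eq K_def\<close>)
    then have "bcol k t \<noteq> i" for k t using False by blast
    moreover have "gcol k t \<noteq> i" if "l dvd t" for k t
    proof -
      have "twisted \<Longrightarrow> L dvd t" using that by (cases rule: type_cases) auto
      then have "gcol k t \<le> K" using gcol_eq[OF that, of k] bot_cases rank by (auto simp: K_def)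
      then show ?thesis using False by blast
    qed
    ultimately show ?thesis by (rule other)
  qed
qed

lemma delta_split: "delta X bot = 1" "delta X (bot + 1) = 1"
  "\<not> twisted \<Longrightarrow> delta X (n - bot) = 1" "\<not> twisted \<Longrightarrow> delta X (n - bot + 1) = 1"
proof -
  have "delta X bot = 1 \<and> delta X (bot + 1) = 1 \<and>
    (\<not> twisted \<longrightarrow> delta X (n - bot) = 1 \<and> delta X (n - bot + 1) = 1)"
    using bot_cases rank by (auto simp: delta_eq)
  then show "delta X bot = 1" "delta X (bot + 1) = 1"
    "\<not> twisted \<Longrightarrow> delta X (n - bot) = 1" "\<not> twisted \<Longrightarrow> delta X (n - bot + 1) = 1" by auto
qed

lemma dvd_residue: "l dvd p \<Longrightarrow> p mod L = 0 \<or> \<not> twisted \<and> p mod L = n"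
  using block_slot[of p] by (auto simp: block_def split: if_splits)


subsection \<open>Weights of columns\<close>

abbreviation ind :: "nat \<Rightarrow> nat \<Rightarrow> int" where "ind i \<equiv> (\<lambda>j. of_bool (j = i))"

definition full :: "nat \<Rightarrow> bool" where "full p \<longleftrightarrow> \<not> l dvd p"

abbreviation opposite :: "nat \<Rightarrow> bool" where "opposite \<equiv> (\<lambda>p. odd (p div l))"

abbreviation alternating :: "nat \<Rightarrow> (nat \<Rightarrow> bool) \<Rightarrow> (nat \<Rightarrow> nat \<times> colour) \<Rightarrow> int" where
  "alternating N h x \<equiv> (\<Sum>k<N. (- 1) ^ k * excess full h (x k))"

context
  fixes p :: nat and g :: colour
  assumes white: "\<not> l dvd p \<or> p = 0 \<longrightarrow> g = White"
begin

lemma cw_lin: "col_weight k (p, g) w = (\<Sum>t\<in>{1..p}. w (bcol k t)) +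
    (if g = Gray then w (gcol k p) - w (bcol k p) else 0)"
  by (rule col_weight_eq[OF white])

lemma gray_dvd: "g = Gray \<Longrightarrow> l dvd p"
  using white by auto

text \<open>The block that distinguishes a gray bead from a white one never is a unit cube.\<close>

lemma cw_mid:
  assumes c: "cube_level c"
  shows "2 * col_weight k (p, g) (ind (mid c)) = delta X (mid c) * (cnt p c + cnt p (L + 1 - c))"
proof -
  have "bcol k p \<noteq> mid c" "gcol k p \<noteq> mid c" if "g = Gray"
  proof -
    note p = gray_dvd[OF that]
    show "gcol k p \<noteq> mid c"
      using gcol_eq[OF p, of k] mid_neq[OF c] dvd_residue[OF p] by (auto simp: dvd_eq_mod_eq_0)
    show "bcol k p \<noteq> mid c"
      using dvd_residue[OF p] mid_neq[OF c] L_n rank by (auto simp: bcol_eq)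
  qed
  then have "2 * col_weight k (p, g) (ind (mid c)) = (\<Sum>t\<in>{1..p}. 2 * of_bool (bcol k t = mid c))"
    by (simp add: cw_lin sum_distrib_left)
  also have "\<dots> = (\<Sum>t\<in>{1..p}. delta X (mid c) * (of_bool (t mod L = c) + of_bool (t mod L = L + 1 - c)))"
    by (intro sum.cong refl bcol_mid c)
  also have "\<dots> = delta X (mid c) * (cnt p c + cnt p (L + 1 - c))"
  proof -
    have "c < L" "L + 1 - c < L" using c L_n rank by (auto simp: cube_level_def)
    then show ?thesis by (simp add: cnt_def sum.distrib flip: sum_distrib_left)
  qed
  finally show ?thesis .
qed

lemma cw_bottom_sum: "col_weight k (p, g) (ind bot) + col_weight k (p, g) (ind (bot + 1)) = cnt p 1 + cnt p L"
proof -
  have "ind bot (gcol k p) + ind (bot + 1) (gcol k p) = ind bot (bcol k p) + ind (bot + 1) (bcol k p)"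
    if "g = Gray"
    using dvd_residue[OF gray_dvd[OF that]]
  proof
    assume "p mod L = 0"
    then show ?thesis using gcol_eq[OF gray_dvd[OF that], of k] by (auto simp: bcol_eq)
  next
    assume r: "\<not> twisted \<and> p mod L = n"
    then have "\<not> L dvd p" using rank by (auto simp: dvd_eq_mod_eq_0)
    then show ?thesis using gcol_eq[OF gray_dvd[OF that], of k] r rank split_neq by (auto simp: bcol_eq)
  qed
  then have "col_weight k (p, g) (ind bot) + col_weight k (p, g) (ind (bot + 1)) =
      (\<Sum>t\<in>{1..p}. of_bool (bcol k t = bot) + of_bool (bcol k t = bot + 1))"
    unfolding cw_lin sum.distrib by (cases g) simp_all
  also have "\<dots> = (\<Sum>t\<in>{1..p}. of_bool (t mod L = 1) + of_bool (t mod L = 0))"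
    by (intro sum.cong refl bcol_bottom[THEN conjunct1])
  also have "\<dots> = cnt p 1 + cnt p L"
    using L_n rank by (simp add: cnt_def sum.distrib)
  finally show ?thesis .
qed

text \<open>Blocks of residue 1 and 0 have opposite colours and follow each other in turn, so a white column has
  an excess iff it stops between them. For a gray bead on such a floor the last block has the other colour, which
  changes the difference by 2.\<close>

lemma cw_bottom_diff: "col_weight k (p, g) (ind bot) - col_weight k (p, g) (ind (bot + 1)) =
    sgn0 k * (if \<not> L dvd p then 1 else if g = Gray then 2 else 0)"
proof -
  have gray: "ind bot (gcol k p) - ind (bot + 1) (gcol k p) - (ind bot (bcol k p) - ind (bot + 1) (bcol k p)) =
      (if L dvd p then 2 * sgn0 k else 0)"
    if "g = Gray"
    using dvd_residue[OF gray_dvd[OF that]]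
  proof
    assume "p mod L = 0"
    then show ?thesis using gcol_eq[OF gray_dvd[OF that], of k] by (auto simp: bcol_eq sgn0_def)
  next
    assume r: "\<not> twisted \<and> p mod L = n"
    then have "\<not> L dvd p" using rank by (auto simp: dvd_eq_mod_eq_0)
    then show ?thesis using gcol_eq[OF gray_dvd[OF that], of k] r rank split_neq by (auto simp: bcol_eq)
  qed
  have "(\<Sum>t\<in>{1..p}. of_bool (bcol k t = bot) - of_bool (bcol k t = bot + 1)) =
      (\<Sum>t\<in>{1..p}. sgn0 k * (of_bool (t mod L = 1) - of_bool (t mod L = 0)) :: int)"
    by (intro sum.cong refl bcol_bottom[THEN conjunct2])
  also have "\<dots> = sgn0 k * (cnt p 1 - cnt p L)"
    using L_n rank by (simp add: cnt_def sum_subtractf flip: sum_distrib_left)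
  also have "\<dots> = sgn0 k * of_bool (\<not> L dvd p)" by (simp only: cnt_ends)
  finally have sum: "(\<Sum>t\<in>{1..p}. ind bot (bcol k t)) - (\<Sum>t\<in>{1..p}. ind (bot + 1) (bcol k t)) =
      sgn0 k * of_bool (\<not> L dvd p)" by (simp only: sum_subtractf)
  show ?thesis
  proof (cases "g = Gray")
    case True
    then have "col_weight k (p, g) (ind bot) - col_weight k (p, g) (ind (bot + 1)) =
        sgn0 k * of_bool (\<not> L dvd p) + (if L dvd p then 2 * sgn0 k else 0)"
      unfolding cw_lin using sum gray[OF True] by (simp only: True if_True)
    then show ?thesis using True by simp
  next
    case False
    then show ?thesis unfolding cw_lin using sum by simp
  qed
qed

lemma cw_top_sum:
  assumes D: "\<not> twisted"
  shows "col_weight k (p, g) (ind (n - bot)) + col_weight k (p, g) (ind (n - bot + 1)) = cnt p n + cnt p (n + 1)"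
proof -
  have "ind (n - bot) (gcol k p) + ind (n - bot + 1) (gcol k p) =
      ind (n - bot) (bcol k p) + ind (n - bot + 1) (bcol k p)"
    if "g = Gray"
    using dvd_residue[OF gray_dvd[OF that]]
  proof
    assume "p mod L = 0"
    then show ?thesis using gcol_eq[OF gray_dvd[OF that], of k] split_neq[OF D] by (auto simp: bcol_eq)
  next
    assume r: "\<not> twisted \<and> p mod L = n"
    then have "\<not> L dvd p" using rank by (auto simp: dvd_eq_mod_eq_0)
    then show ?thesis using gcol_eq[OF gray_dvd[OF that], of k] r rank by (auto simp: bcol_eq)
  qed
  then have "col_weight k (p, g) (ind (n - bot)) + col_weight k (p, g) (ind (n - bot + 1)) =
      (\<Sum>t\<in>{1..p}. of_bool (bcol k t = n - bot) + of_bool (bcol k t = n - bot + 1))"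
    unfolding cw_lin sum.distrib by (cases g) simp_all
  also have "\<dots> = (\<Sum>t\<in>{1..p}. of_bool (t mod L = n) + of_bool (t mod L = n + 1))"
    by (intro sum.cong refl bcol_top[THEN conjunct1] D)
  also have "\<dots> = cnt p n + cnt p (n + 1)"
  proof -
    have "n + 1 < L" using rank D by (cases rule: type_cases) auto
    then show ?thesis by (simp add: cnt_def sum.distrib)
  qed
  finally show ?thesis .
qed

lemma cw_top_diff:
  assumes D: "\<not> twisted"
  shows "col_weight k (p, g) (ind (n - bot + 1)) - col_weight k (p, g) (ind (n - bot)) =
    sgn1 k * (if p mod L = n then if g = Gray then - 1 else 1 else 0)"
proof -
  have gray: "ind (n - bot + 1) (gcol k p) - ind (n - bot) (gcol k p) -
      (ind (n - bot + 1) (bcol k p) - ind (n - bot) (bcol k p)) = (if p mod L = n then - 2 * sgn1 k else 0)"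
    if "g = Gray"
    using dvd_residue[OF gray_dvd[OF that]]
  proof
    assume "p mod L = 0"
    then show ?thesis using gcol_eq[OF gray_dvd[OF that], of k] split_neq[OF D] rank by (auto simp: bcol_eq)
  next
    assume r: "\<not> twisted \<and> p mod L = n"
    then have "\<not> L dvd p" using rank by (auto simp: dvd_eq_mod_eq_0)
    then show ?thesis using gcol_eq[OF gray_dvd[OF that], of k] r rank by (auto simp: bcol_eq sgn1_def)
  qed
  have nL: "n + 1 < L" using rank D by (cases rule: type_cases) auto
  have "(\<Sum>t\<in>{1..p}. of_bool (bcol k t = n - bot + 1) - of_bool (bcol k t = n - bot)) =
      (\<Sum>t\<in>{1..p}. sgn1 k * (of_bool (t mod L = n) - of_bool (t mod L = n + 1)) :: int)"
    by (intro sum.cong refl bcol_top[THEN conjunct2] D)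
  also have "\<dots> = sgn1 k * (cnt p n - cnt p (Suc n))"
    using nL by (simp add: cnt_def sum_subtractf flip: sum_distrib_left)
  also have "\<dots> = sgn1 k * of_bool (p mod L = n)" using nL rank by (subst cnt_step) auto
  finally have sum: "(\<Sum>t\<in>{1..p}. ind (n - bot + 1) (bcol k t)) - (\<Sum>t\<in>{1..p}. ind (n - bot) (bcol k t)) =
      sgn1 k * of_bool (p mod L = n)" by (simp only: sum_subtractf)
  show ?thesis
  proof (cases "g = Gray")
    case True
    then have "col_weight k (p, g) (ind (n - bot + 1)) - col_weight k (p, g) (ind (n - bot)) =
        sgn1 k * of_bool (p mod L = n) + (if p mod L = n then - 2 * sgn1 k else 0)"
      unfolding cw_lin using sum gray[OF True] by (simp only: True if_True)
    then show ?thesis using True by simp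
  next
    case False
    then show ?thesis unfolding cw_lin using sum by simp
  qed
qed

lemma cw_other:
  assumes "\<And>k t. bcol k t \<noteq> i" "\<And>k t. l dvd t \<Longrightarrow> gcol k t \<noteq> i"
  shows "col_weight k (p, g) (ind i) = 0"
  using assms gray_dvd unfolding cw_lin by auto

end

text \<open>The two discrepancies combine to the two alternating sums of excesses.\<close>

lemma excess_untwisted:
  assumes D: "\<not> twisted"
  defines "v1 \<equiv> (\<lambda>(p, g). if \<not> L dvd p then 1 else if g = Gray then 2 else 0 :: int)"
    and "v2 \<equiv> (\<lambda>(p, g). if p mod L = n then if g = Gray then - 1 else 1 else 0 :: int)"
  shows "excess full (\<lambda>_. False) a = v1 a - v2 a" "excess full opposite a = v1 a + v2 a"
proof -
  obtain p g where a: "a = (p, g)" by (cases a)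
  have L: "L = 2 * l" "l = n" using D by (cases rule: type_cases; simp)+
  have "excess full (\<lambda>_. False) a = v1 a - v2 a \<and> excess full opposite a = v1 a + v2 a"
  proof (cases "l dvd p")
    case True
    then obtain b where b: "p = l * b" by (rule dvdE)
    have "L dvd p \<longleftrightarrow> even b" using rank by (simp add: b L)
    moreover have "p mod L = n * (b mod 2)" by (simp add: b L mult.commute[of 2] mod_mult_mult1)
    then have "p mod L = n \<longleftrightarrow> odd b"
      using rank by (cases "even b") (simp_all add: odd_iff_mod_2_eq_one)
    moreover have "p div l = b" using l_pos by (simp add: b)
    ultimately show ?thesis using True by (cases g) (simp_all add: a excess_def full_def v1_def v2_def)
  next
    case False
    have "\<not> L dvd p" using dvd_trans[OF l_dvd_L, of p] False by blast
    moreover have "p mod L \<noteq> n"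
    proof
      assume "p mod L = n"
      then have "p mod l = 0" using mod_L_mod_l[of p] L(2) by simp
      then show False using False by (simp add: dvd_eq_mod_eq_0)
    qed
    ultimately show ?thesis using False by (simp add: a excess_def full_def v1_def v2_def)
  qed
  then show "excess full (\<lambda>_. False) a = v1 a - v2 a" "excess full opposite a = v1 a + v2 a"
    by auto
qed

lemma excess_twisted:
  assumes A: "twisted"
  shows "excess full (\<lambda>_. False) a = (case a of (p, g) \<Rightarrow> if \<not> L dvd p then 1 else if g = Gray then 2 else 0)"
  using A by (cases rule: type_cases; cases a) (auto simp: excess_def full_def)


subsection \<open>Weights of walls\<close>

text \<open>In the application, \<open>f c\<close> counts the blocks of residue \<open>c\<close> in all columns. All values \<open>f c + f (L + 1 - c)\<close> are equal iff consecutive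
  ones are, and \<open>f c - f (c + 1)\<close> counts the columns that end with residue \<open>c\<close>. The common value is found by summing
  over all \<open>c\<close>.\<close>

lemma symmetric_levels_iff:
  fixes f :: "nat \<Rightarrow> int"
  shows "(\<forall>c\<in>{1..n}. f c + f (L + 1 - c) = 2 * m) \<longleftrightarrow>
    (\<forall>c\<in>{1..<n}. f c - f (Suc c) = f (L - c) - f (Suc (L - c))) \<and> (\<Sum>c\<in>{1..L}. f c) = int L * m"
proof -
  define K where "K c = f c + f (L + 1 - c)" for c
  have mirror: "L + 1 - c \<in> {1..n}" if "c \<in> {1..L}" "c \<notin> {1..n}" for c
    using that rank by (cases rule: type_cases) auto
  have K_sym: "K (L + 1 - c) = K c" if "c \<in> {1..L}" for c using that by (simp add: K_def)
  have K_all: "K c = a" if "c \<in> {1..L}" "\<And>c. c \<in> {1..n} \<Longrightarrow> K c = a" for c a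
    using that mirror[of c] K_sym[of c] by metis
  have K_sum: "(\<Sum>c\<in>{1..L}. K c) = 2 * (\<Sum>c\<in>{1..L}. f c)"
    using sum.atLeastAtMost_rev[of f 1 L] by (simp add: K_def sum.distrib)
  have step: "K c = K (Suc c) \<longleftrightarrow> f c - f (Suc c) = f (L - c) - f (Suc (L - c))" if "c \<in> {1..<n}" for c
  proof -
    have "L + 1 - c = Suc (L - c)" "L + 1 - Suc c = L - c" using that L_n by auto
    then show ?thesis by (auto simp: K_def)
  qed
  have "(\<forall>c\<in>{1..n}. K c = 2 * m) \<longleftrightarrow> (\<forall>c\<in>{1..<n}. K c = K (Suc c)) \<and> (\<Sum>c\<in>{1..L}. K c) = 2 * (int L * m)"
  proof (intro iffI conjI ballI)
    assume K: "\<forall>c\<in>{1..n}. K c = 2 * m"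
    then have "K c = 2 * m" if "c \<in> {1..L}" for c using K_all that by blast
    then have "(\<Sum>c\<in>{1..L}. K c) = (\<Sum>c\<in>{1..L}. 2 * m)" by (intro sum.cong) auto
    then show "(\<Sum>c\<in>{1..L}. K c) = 2 * (int L * m)" by simp
    fix c assume "c \<in> {1..<n}"
    then show "K c = K (Suc c)" using K by simp
  next
    fix c assume *: "(\<forall>c\<in>{1..<n}. K c = K (Suc c)) \<and> (\<Sum>c\<in>{1..L}. K c) = 2 * (int L * m)"
    have K1: "K c = K 1" if "c \<in> {1..n}" for c
    proof -
      have "1 \<le> c" "c \<le> n" using that by auto
      then show ?thesis by (induction c rule: dec_induct) (use * in auto)
    qed
    then have "K c = K 1" if "c \<in> {1..L}" for c using K_all that by blast
    then have "(\<Sum>c\<in>{1..L}. K c) = (\<Sum>c\<in>{1..L}. K 1)" by (rule sum.cong[OF refl])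
    then have "int L * K 1 = int L * (2 * m)" using * by simp
    then have "K 1 = 2 * m" using L_pos by simp
    moreover assume "c \<in> {1..n}"
    ultimately show "K c = 2 * m" using K1 by simp
  qed
  then show ?thesis unfolding K_sum using step by (simp add: K_def)
qed

text \<open>The multiplicities of the cubes and the sums over the two colours of a split floor give the first two
  conditions, the differences of these two colours give the vanishing alternating sums. In type \<open>D\<close>, the sum and
  the difference of the two discrepancies are taken instead of the discrepancies themselves, since both
  have the form treated by \<open>alt_sum_strip\<close>.\<close>

lemma weight_iff:
  assumes x: "x \<in> columns" and N: "\<And>i. i \<ge> N \<Longrightarrow> fst (x i) = 0"
  shows "wt X \<Lambda> (wall_of x) = (\<lambda>i. - int m * delta X i) \<longleftrightarrow>
    (\<forall>c\<in>{1..<n}. card {k. k < N \<and> fst (x k) mod L = c} = card {k. k < N \<and> fst (x k) mod L = L - c}) \<and>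
    (\<Sum>k<N. fst (x k)) = L * m \<and>
    alternating N (\<lambda>_. False) x = 0 \<and>
    (\<not> twisted \<longrightarrow> alternating N opposite x = 0)"
proof -
  define T where "T i = (\<Sum>k<N. col_weight (Suc k) (x k) (ind i))" for i
  define f where "f c = (\<Sum>k<N. cnt (fst (x k)) c)" for c
  define v1 where "v1 = (\<lambda>(p, g). if \<not> L dvd p then 1 else if g = Gray then 2 else 0 :: int)"
  define v2 where "v2 = (\<lambda>(p, g). if p mod L = n then if g = Gray then - 1 else 1 else 0 :: int)"
  define S1 where "S1 = (\<Sum>k<N. (- 1) ^ k * v1 (x k))"
  define S2 where "S2 = (\<Sum>k<N. (- 1) ^ k * v2 (x k))"
  have cond: "\<not> l dvd fst (x k) \<or> fst (x k) = 0 \<longrightarrow> snd (x k) = White" for k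
    using columns_white[OF x] columns_zero[OF x] by blast
  have E1: "2 * T (mid c) = delta X (mid c) * (f c + f (L + 1 - c))" if "cube_level c" for c
    using cw_mid[OF cond that] unfolding T_def f_def
    by (simp add: sum_distrib_left sum.distrib distrib_left)
  have E2: "T bot + T (bot + 1) = f 1 + f L"
    using cw_bottom_sum[OF cond] unfolding T_def f_def by (simp flip: sum.distrib)
  have E3: "T (n - bot) + T (n - bot + 1) = f n + f (n + 1)" if "\<not> twisted"
    using cw_top_sum[OF cond that] unfolding T_def f_def by (simp flip: sum.distrib)
  have E4: "T bot - T (bot + 1) = sgn0 1 * S1"
  proof -
    define e where "e = sgn0 1"
    have "sgn0 (Suc k) = e * (- 1) ^ k" for k by (simp add: sgn0_def e_def)
    then show ?thesis
      using cw_bottom_diff[OF cond] unfolding T_def S1_def v1_def e_def[symmetric]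
      by (simp add: sum_distrib_left case_prod_unfold mult.assoc flip: sum_subtractf)
  qed
  have E5: "T (n - bot + 1) - T (n - bot) = sgn1 1 * S2" if "\<not> twisted"
  proof -
    define e where "e = sgn1 1"
    have "sgn1 (Suc k) = e * (- 1) ^ k" for k by (simp add: sgn1_def e_def)
    then show ?thesis
      using cw_top_diff[OF cond that] unfolding T_def S2_def v2_def e_def[symmetric]
      by (simp add: sum_distrib_left case_prod_unfold mult.assoc flip: sum_subtractf)
  qed
  have sgn: "sgn0 1 \<noteq> 0" "sgn1 1 \<noteq> 0" by (simp_all add: sgn0_def sgn1_def)
  have delta_mid: "delta X (mid c) \<noteq> 0" if "cube_level c" for c
    using mid_range[OF that] rank by (auto simp: delta_eq)
  have top_sym: "L + 1 - n = n + 1" if "\<not> twisted" using that rank by (cases rule: type_cases) auto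
  have "wt X \<Lambda> (wall_of x) = (\<lambda>i. - int m * delta X i) \<longleftrightarrow> (\<forall>i. T i = int m * delta X i)"
    using colour_count_wall_of[OF x N] by (simp add: fun_eq_iff wt_def T_def)
  also have "\<dots> \<longleftrightarrow> (\<forall>c\<in>{1..n}. f c + f (L + 1 - c) = 2 * int m) \<and> S1 = 0 \<and> (\<not> twisted \<longrightarrow> S2 = 0)"
  proof (intro iffI conjI ballI impI allI)
    assume T: "\<forall>i. T i = int m * delta X i"
    show "S1 = 0" using E4 sgn T delta_split by simp
    show "S2 = 0" if "\<not> twisted" using E5[OF that] sgn T delta_split(3,4)[OF that] by simp
    fix c assume c: "c \<in> {1..n}"
    consider "c = 1" | "cube_level c" | "c = n" "\<not> twisted"
      using c by (fastforce simp: cube_level_def)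
    then show "f c + f (L + 1 - c) = 2 * int m"
    proof cases
      case 1
      then show ?thesis using E2 T delta_split by simp
    next
      case 2
      have "T (mid c) = int m * delta X (mid c)" using T by blast
      then have "delta X (mid c) * (f c + f (L + 1 - c)) = delta X (mid c) * (2 * int m)"
        using E1[OF 2] by (metis mult.commute mult.left_commute)
      then show ?thesis using delta_mid[OF 2] by (simp only: mult_cancel_left simp_thms)
    next
      case 3
      then show ?thesis using E3[OF 3(2)] T delta_split(3,4)[OF 3(2)] top_sym[OF 3(2)] by simp
    qed
  next
    fix i
    assume *: "(\<forall>c\<in>{1..n}. f c + f (L + 1 - c) = 2 * int m) \<and> S1 = 0 \<and> (\<not> twisted \<longrightarrow> S2 = 0)"
    show "T i = int m * delta X i"
    proof (cases i rule: colour_cases)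
      case bottom
      have "f 1 + f L = 2 * int m" using bspec[OF conjunct1[OF *], of 1] rank by simp
      then have "T bot = int m" "T (bot + 1) = int m" using E2 E4 * by auto
      then show ?thesis using bottom delta_split(1,2) by auto
    next
      case top
      have "f n + f (n + 1) = 2 * int m"
        using bspec[OF conjunct1[OF *], of n] rank top_sym[OF top(1)] by simp
      then have "T (n - bot) = int m" "T (n - bot + 1) = int m" using E3 E5 * top(1) by auto
      then show ?thesis using top delta_split(3,4) by auto
    next
      case (mid c)
      have "f c + f (L + 1 - c) = 2 * int m" using * mid(1) by (simp add: cube_level_def)
      then have "2 * T i = 2 * (int m * delta X i)"
        using E1[OF mid(1)] mid(2) by (simp only: ac_simps)
      then show ?thesis by (simp only: mult_cancel_left) simp
    next
      case other
      have "col_weight (Suc k) (x k) (ind i) = 0" for k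
        using cw_other[OF cond other(2,3), of "Suc k" k] by simp
      then show ?thesis using other(1) by (simp add: T_def)
    qed
  qed
  also have "(\<forall>c\<in>{1..n}. f c + f (L + 1 - c) = 2 * int m) \<longleftrightarrow>
      (\<forall>c\<in>{1..<n}. f c - f (Suc c) = f (L - c) - f (Suc (L - c))) \<and> (\<Sum>c\<in>{1..L}. f c) = int L * int m"
    by (rule symmetric_levels_iff)
  also have "(\<Sum>c\<in>{1..L}. f c) = int (\<Sum>k<N. fst (x k))"
    unfolding f_def by (subst sum.swap) (simp only: cnt_total of_nat_sum)
  also have "(\<forall>c\<in>{1..<n}. f c - f (Suc c) = f (L - c) - f (Suc (L - c))) \<longleftrightarrow>
      (\<forall>c\<in>{1..<n}. card {k. k < N \<and> fst (x k) mod L = c} = card {k. k < N \<and> fst (x k) mod L = L - c})"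
  proof -
    have diff: "f c - f (Suc c) = int (card {k. k < N \<and> fst (x k) mod L = c})" if "1 \<le> c" "c < L" for c
    proof -
      have "f c - f (Suc c) = (\<Sum>k<N. of_bool (fst (x k) mod L = c))"
        using cnt_step[OF that] by (simp add: f_def flip: sum_subtractf)
      also have "\<dots> = int (card ({..<N} \<inter> {k. fst (x k) mod L = c}))"
        by (simp add: sum_of_bool_eq)
      also have "{..<N} \<inter> {k. fst (x k) mod L = c} = {k. k < N \<and> fst (x k) mod L = c}" by auto
      finally show ?thesis .
    qed
    show ?thesis
    proof (rule ball_cong[OF refl])
      fix c assume "c \<in> {1..<n}"
      then have "1 \<le> c" "c < L" "1 \<le> L - c" "L - c < L" using L_n by auto
      then show "(f c - f (Suc c) = f (L - c) - f (Suc (L - c))) =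
          (card {k. k < N \<and> fst (x k) mod L = c} = card {k. k < N \<and> fst (x k) mod L = L - c})"
        using diff by simp
    qed
  qed
  also have "int (\<Sum>k<N. fst (x k)) = int L * int m \<longleftrightarrow> (\<Sum>k<N. fst (x k)) = L * m"
    by (simp only: of_nat_eq_iff flip: of_nat_mult)
  also have "S1 = 0 \<and> (\<not> twisted \<longrightarrow> S2 = 0) \<longleftrightarrow>
      alternating N (\<lambda>_. False) x = 0 \<and>
      (\<not> twisted \<longrightarrow> alternating N opposite x = 0)"
  proof (cases twisted)
    case True
    then show ?thesis by (simp add: S1_def v1_def excess_twisted)
  next
    case False
    have "alternating N (\<lambda>_. False) x = S1 - S2"
      "alternating N opposite x = S1 + S2"
      unfolding S1_def S2_def excess_untwisted[OF False] v1_def v2_def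
      by (simp_all only: right_diff_distrib distrib_left sum_subtractf sum.distrib)
    then show ?thesis using False by auto
  qed
  finally show ?thesis by blast
qed


section \<open>The bead moves\<close>

definition positions :: "(nat \<times> colour) multiset \<Rightarrow> nat multiset" where
  "positions B = image_mset fst B"

text \<open>The bead configurations of proper walls.\<close>

definition valid :: "(nat \<times> colour) multiset \<Rightarrow> bool" where
  "valid B \<longleftrightarrow> consistent B \<and>
     (\<forall>p c. (p, c) \<in># B \<longrightarrow> full p \<longrightarrow> c = White \<and> count (positions B) p \<le> 1)"

definition residue_count :: "(nat \<times> colour) multiset \<Rightarrow> nat \<Rightarrow> nat" where
  "residue_count B k = size (filter_mset (\<lambda>s. s mod L = k) (positions B))"

definition balanced :: "(nat \<times> colour) multiset \<Rightarrow> bool" where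
  "balanced B \<longleftrightarrow> (\<forall>c\<in>{1..<n}. residue_count B c = residue_count B (L - c))"

lemma positions_switch: "positions (switch_at P M) = positions M"
  unfolding positions_def switch_at_def multiset.map_comp
  by (rule image_mset_cong) (auto split: prod.splits)

lemma overtaken_positions: "overtaken F B p = size (filter_mset (\<lambda>s. F s \<and> p < s) (positions B))"
  by (simp add: overtaken_def positions_def filter_mset_image_mset case_prod_unfold)

lemma in_switch_at: "(p, c) \<in># switch_at P M \<longleftrightarrow> (p, if p \<in> P then switch c else c) \<in># M"
proof -
  have sw: "switch (switch d) = d" for d by (cases d) auto
  have "(p, c) \<in># switch_at P M \<longleftrightarrow> (\<exists>d. (p, d) \<in># M \<and> c = (if p \<in> P then switch d else d))"
  proof
    assume "(p, c) \<in># switch_at P M"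
    then show "\<exists>d. (p, d) \<in># M \<and> c = (if p \<in> P then switch d else d)"
      by (auto simp: switch_at_def split: if_splits)
  next
    assume "\<exists>d. (p, d) \<in># M \<and> c = (if p \<in> P then switch d else d)"
    then obtain d where d: "(p, d) \<in># M" "c = (if p \<in> P then switch d else d)" by blast
    have "(p, c) = (\<lambda>(p, c). if p \<in> P then (p, switch c) else (p, c)) (p, d)" by (simp add: d(2))
    then show "(p, c) \<in># switch_at P M"
      unfolding switch_at_def set_image_mset using d(1) by (rule image_eqI)
  qed
  also have "\<dots> \<longleftrightarrow> (p, if p \<in> P then switch c else c) \<in># M" 
    by (cases "p \<in> P") (auto simp: sw intro: exI[of _ "switch c"])
  finally show ?thesis .
qed

lemma full_mod:
  assumes "full p"
  shows "1 \<le> p mod L" "p mod L < L" "p mod L \<noteq> l" "full (p mod L)"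
proof -
  show "full (p mod L)" using assms l_dvd_L by (simp add: full_def dvd_mod_iff)
  then show "1 \<le> p mod L" "p mod L \<noteq> l" by (auto simp: full_def Suc_le_eq intro: gr0I)
  show "p mod L < L" using L_pos by simp
qed

lemma runner_type_I: "type_I X k \<Longrightarrow> runner X k = {s. s > 0 \<and> s mod L = k}"
  by (simp add: type_I_def runner_def)

lemma type_I_full: "type_I X k \<longleftrightarrow> k < L \<and> full k"
proof -
  have "k = 0 \<or> k = l" if "l dvd k" "k < L"
  proof -
    from that(1) obtain a where a: "k = l * a" by (rule dvdE)
    have "l * a < l * 2" using that(2) a by (cases rule: type_cases) auto
    then have "a < 2" by simp
    then show ?thesis using a by (cases a) auto
  qed
  then show ?thesis by (auto simp: type_I_def full_def Suc_le_eq intro: gr0I)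
qed

lemma full_runner: "type_I X k \<Longrightarrow> s \<in> runner X k \<Longrightarrow> full s"
  using l_dvd_L by (auto simp: runner_type_I type_I_full full_def dvd_mod_iff)

lemma full_iff_runner: "0 < p \<Longrightarrow> p \<in> runner X l \<longleftrightarrow> \<not> full p"
  by (simp add: runner_def full_def)

lemma small_full:
  assumes "1 \<le> s" "s < n"
  shows "full s" "full (L - s)" "n \<le> L - s" "s < l"
proof -
  show sl: "s < l" using assms rank by (cases rule: type_cases) auto
  then show s: "full s" using assms by (auto simp: full_def dest: dvd_imp_le)
  have "s \<le> L" using assms L_n by simp
  then show "full (L - s)" using s l_dvd_L by (simp add: full_def dvd_diff_nat dvd_minus_self) (metis dvd_diffD1)
  show "n \<le> L - s" using assms L_n by linarith
qed

text \<open>A move replaces the full beads \<open>R\<close> by \<open>R'\<close> and switches colours at \<open>P\<close>. The corrected colours are invariant if a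
  colour is switched exactly where the parity of the overtaking beads changes.\<close>

lemma reduce_switch:
  assumes BM: "B = M + R" "\<And>p c. (p, c) \<in># R \<Longrightarrow> full p"
    and C: "C = switch_at P M + R'" "\<And>p c. (p, c) \<in># R' \<Longrightarrow> full p"
    and parity: "\<And>p c. (p, c) \<in># M \<Longrightarrow> \<not> full p \<Longrightarrow>
      odd (overtaken full C p) \<longleftrightarrow> odd (overtaken full B p) \<noteq> (p \<in> P)"
  shows "reduce full C = reduce full B"
proof -
  have sw: "switch (switch d) = d" for d by (cases d) auto
  have R: "filter_mset (\<lambda>(p, _). \<not> full p) R = {#}" "filter_mset (\<lambda>(p, _). \<not> full p) R' = {#}"
    using BM(2) C(2) by auto
  have "filter_mset (\<lambda>(p, _). \<not> full p) C = switch_at P (filter_mset (\<lambda>(p, _). \<not> full p) M)"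
    unfolding C(1) switch_at_def filter_union_mset R filter_mset_image_mset
    by (simp add: case_prod_unfold if_distrib cong: if_cong)
  then have "reduce full C = image_mset (\<lambda>(p, c). (p, if odd (overtaken full C p) then switch c else c))
      (switch_at P (filter_mset (\<lambda>(p, _). \<not> full p) M))" by (simp only: reduce_def)
  also have "\<dots> = image_mset (\<lambda>(p, c). (p, if odd (overtaken full B p) then switch c else c))
      (filter_mset (\<lambda>(p, _). \<not> full p) M)"
    unfolding switch_at_def multiset.map_comp
  proof (rule image_mset_cong)
    fix a assume "a \<in># filter_mset (\<lambda>(p, _). \<not> full p) M"
    then obtain p c where a: "a = (p, c)" "(p, c) \<in># M" "\<not> full p" by (cases a) auto
    then show "((\<lambda>(p, c). (p, if odd (overtaken full C p) then switch c else c)) \<circ>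
        (\<lambda>(p, c). if p \<in> P then (p, switch c) else (p, c))) a =
        (case a of (p, c) \<Rightarrow> (p, if odd (overtaken full B p) then switch c else c))"
      using parity[OF a(2,3)] by (simp add: sw)
  qed
  also have "filter_mset (\<lambda>(p, _). \<not> full p) M = filter_mset (\<lambda>(p, _). \<not> full p) B"
    unfolding BM(1) filter_union_mset R by simp
  finally show ?thesis by (simp only: reduce_def)
qed

lemma valid_switch:
  assumes B: "valid (M + R)" and P: "\<And>p. p \<in> P \<Longrightarrow> \<not> full p"
  shows "valid (switch_at P M)"
proof -
  have con: "consistent (M + R)" and fullB: "\<And>p c. (p, c) \<in># M + R \<Longrightarrow> full p \<Longrightarrow>
      c = White \<and> count (positions (M + R)) p \<le> 1"
    using B by (auto simp: valid_def)
  have "consistent (switch_at P M)"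
    unfolding consistent_def in_switch_at
  proof (intro conjI allI impI)
    fix p c assume "(p, if p \<in> P then switch c else c) \<in># M"
    then show "p \<noteq> 0" using con by (auto simp: consistent_def)
  next
    fix p c d assume "(p, if p \<in> P then switch c else c) \<in># M" "(p, if p \<in> P then switch d else d) \<in># M"
    then have "(if p \<in> P then switch c else c) = (if p \<in> P then switch d else d)"
      using con by (auto simp: consistent_def)
    then show "c = d" by (cases c; cases d) (auto split: if_splits)
  qed
  moreover have "c = White \<and> count (positions (switch_at P M)) p \<le> 1"
    if "(p, c) \<in># switch_at P M" "full p" for p c
  proof -
    have "p \<notin> P" using P that(2) by blast
    then have "(p, c) \<in># M + R" using that unfolding in_switch_at by simp
    then have "c = White" "count (positions (M + R)) p \<le> 1" using fullB that(2) by auto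
    then show ?thesis by (simp add: positions_switch) (simp add: positions_def)
  qed
  ultimately show ?thesis by (simp add: valid_def)
qed

text \<open>A move of the first kind changes the number of full beads beyond \<open>p\<close> exactly for \<open>p\<close> strictly between the old and
  the new position. A move of the second kind removes one full bead beyond \<open>\<ell>\<close> and none beyond larger positions of
  \<open>R\<^sub>\<ell>\<close> in type \<open>D\<close>, and no bead beyond a position of \<open>R\<^sub>\<ell>\<close> in the twisted type. The sum of the
  positions decreases, so the moves end.\<close>

lemma bead_step_invariants:
  assumes step: "bead_step X B C" and B: "valid B"
  shows "valid C" "balanced B \<Longrightarrow> balanced C" "reduce full C = reduce full B"
    "\<Sum>\<^sub># (positions C) < \<Sum>\<^sub># (positions B)"
proof -
  have pos: "p > 0" if "(p, c) \<in># B" for p c using B that by (auto simp: valid_def consistent_def)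
  have "valid C \<and> (balanced B \<longrightarrow> balanced C) \<and> reduce full C = reduce full B \<and>
    \<Sum>\<^sub># (positions C) < \<Sum>\<^sub># (positions B)"
    using step
  proof cases
    case (B1 s c k)
    define M where "M = B - {#(s, c)#}"
    define P where "P = {p \<in> runner X l. s - L < p \<and> p < s}"
    have BM: "B = M + {#(s, c)#}" using B1(2) by (simp add: M_def)
    have C: "C = switch_at P M + {#(s - L, c)#}" by (simp add: B1(1) M_def P_def)
    have fs: "full s" using full_runner B1(4,5) by blast
    then have fsL: "full (s - L)" using l_dvd_L B1(3)
      by (simp add: full_def) (metis dvd_diffD less_imp_le)
    have P: "\<not> full p" if "p \<in> P" for p using that by (auto simp: P_def runner_def full_def)
    have posB: "positions B = add_mset s (positions M)" by (simp add: BM positions_def)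
    have posC: "positions C = add_mset (s - L) (positions M)"
      by (simp add: C positions_switch[unfolded positions_def] positions_def)
    have fresh: "s - L \<notin># positions M"
      using B1(6) by (auto simp: BM positions_def)
    have cW: "c = White" using B fs B1(2) by (auto simp: valid_def)
    have vM: "valid (switch_at P M)" using valid_switch[of M "{#(s, c)#}" P] B P by (simp add: BM)
    have "valid C"
      unfolding valid_def
    proof (intro conjI allI impI)
      have "(s - L, d) \<notin># switch_at P M" for d
        using fresh unfolding in_switch_at positions_def by force
      then show "consistent C"
        using vM B1(3) unfolding C by (auto simp: valid_def consistent_def)
    next
      fix p d assume pd: "(p, d) \<in># C" "full p"
      show "d = White" using pd vM cW unfolding C by (auto simp: valid_def)
      show "count (positions C) p \<le> 1"
      proof (cases "p = s - L")
        case True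
        then show ?thesis using fresh by (simp add: posC not_in_iff)
      next
        case False
        then have "(p, d) \<in># switch_at P M" using pd(1) unfolding C by auto
        then have "count (positions (switch_at P M)) p \<le> 1" using vM pd(2) unfolding valid_def by blast
        then show ?thesis using False by (simp add: posC positions_switch)
      qed
    qed
    moreover have "(s - L) mod L = s mod L" using B1(3) by (simp add: le_mod_geq)
    then have "residue_count C j = residue_count B j" for j
      by (simp add: residue_count_def posB posC)
    then have "balanced B \<longrightarrow> balanced C" by (simp add: balanced_def)
    moreover have "reduce full C = reduce full B"
    proof (rule reduce_switch[OF BM _ C])
      fix p d assume p: "(p, d) \<in># M" "\<not> full p"
      have "p \<noteq> s" "p \<noteq> s - L" using fs fsL p(2) by auto
      moreover have "p \<in> runner X l" using full_iff_runner[OF pos, of p d] p by (simp add: BM)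
      ultimately show "odd (overtaken full C p) \<longleftrightarrow> odd (overtaken full B p) \<noteq> (p \<in> P)"
        using fs fsL by (auto simp: overtaken_positions posB posC P_def)
    qed (use fs fsL in auto)
    moreover have "\<Sum>\<^sub># (positions C) < \<Sum>\<^sub># (positions B)"
      using B1(3) L_pos by (simp add: posB posC)
    ultimately show ?thesis by blast
  next
    case (B2 s c d)
    define M where "M = B - {#(s, c), (L - s, d)#}"
    define P where "P = (if s < l \<and> l < L - s then {l} else {})"
    have s: "1 \<le> s" "s < n" using B2(4,5) rank by auto
    note small = small_full[OF s]
    have "{#(s, c), (L - s, d)#} \<subseteq># B"
      using B2(2,3) small(3) s(2) by (auto simp: insert_subset_eq_iff in_diff_count)
    then have BM: "B = M + {#(s, c), (L - s, d)#}"
      unfolding M_def by (rule subset_mset.diff_add[symmetric])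
    have C: "C = switch_at P M + {#}" by (simp add: B2(1) M_def P_def)
    have posB: "positions B = add_mset s (add_mset (L - s) (positions M))"
      by (simp add: BM positions_def)
    have posC: "positions C = positions M" by (simp add: C positions_switch)
    have P: "\<not> full p" if "p \<in> P" for p using that by (auto simp: P_def full_def split: if_splits)
    have "valid C" using valid_switch[of M "{#(s, c), (L - s, d)#}" P] B P by (simp add: BM C)
    moreover have "balanced B \<longrightarrow> balanced C"
      unfolding balanced_def
    proof (intro impI ballI)
      fix j assume bal: "\<forall>c\<in>{1..<n}. residue_count B c = residue_count B (L - c)" and j: "j \<in> {1..<n}"
      have sL: "s < L" "L - s < L" "j < L" "L - j < L" using s j L_n by auto
      have "n \<le> L - j" using small_full(3)[of j] j by simp
      then have "s \<noteq> L - j" "L - s \<noteq> j" "L - s = L - j \<longleftrightarrow> s = j" using s j small(3) sL by auto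
      then show "residue_count C j = residue_count C (L - j)"
        using bspec[OF bal j] sL by (auto simp: residue_count_def posB posC split: if_splits)
    qed
    moreover have "reduce full C = reduce full B"
    proof (rule reduce_switch[OF BM _ C])
      fix p e assume p: "(p, e) \<in># M" "\<not> full p"
      have "l \<le> p" using pos[of p e] p by (auto simp: BM full_def intro: dvd_imp_le)
      moreover have "p < L - s \<longleftrightarrow> p = l \<and> l < L - s"
      proof
        assume lt: "p < L - s"
        obtain a where a: "p = l * a" using p(2) by (auto simp: full_def)
        have "L \<le> l * 2" by (cases rule: type_cases) auto
        then have "l * a < l * 2" using lt a by linarith
        then have "a < 2" by simp
        then show "p = l \<and> l < L - s" using lt a \<open>l \<le> p\<close> l_pos by (cases a) auto
      qed auto
      ultimately show "odd (overtaken full C p) \<longleftrightarrow> odd (overtaken full B p) \<noteq> (p \<in> P)"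
        using small by (auto simp: overtaken_positions posB posC P_def)
    qed (use small in auto)
    moreover have "\<Sum>\<^sub># (positions C) < \<Sum>\<^sub># (positions B)"
      using s(1) by (simp add: posB posC)
    ultimately show ?thesis by blast
  qed
  then show "valid C" "balanced B \<Longrightarrow> balanced C" "reduce full C = reduce full B"
    "\<Sum>\<^sub># (positions C) < \<Sum>\<^sub># (positions B)" by auto
qed

text \<open>The lowest bead on a runner of type I can be moved unless it is at the bottom of the runner.\<close>

lemma runner_bottom:
  assumes B: "valid B" and stuck: "\<nexists>C. bead_step X B C" and r: "r < L" "full r"
    and p: "p \<in># positions B" "p mod L = r"
  shows "r \<in># positions B"
proof -
  \<comment> \<open>No bead of the same residue lies below \<open>q\<close>, so a move down from \<open>q\<close> would not be blocked.\<close>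
  define q where "q = (LEAST q. q \<in># positions B \<and> q mod L = r)"
  have q: "q \<in># positions B" "q mod L = r"
    using LeastI[of "\<lambda>q. q \<in># positions B \<and> q mod L = r" p] p by (auto simp: q_def)
  have least: "q \<le> q'" if "q' \<in># positions B" "q' mod L = r" for q'
    unfolding q_def using that by (intro Least_le) auto
  obtain c where c: "(q, c) \<in># B" using q(1) by (auto simp: positions_def)
  have "q \<le> L"
  proof (rule ccontr)
    assume "\<not> q \<le> L"
    then have gt: "q > L" by simp
    have "(q - L) mod L = r" using gt q(2) by (simp add: le_mod_geq)
    then have "q - L \<notin># positions B" using least[of "q - L"] gt L_pos by fastforce
    moreover have "q \<in> runner X r" "type_I X r"
      using runner_type_I[of r] type_I_full[of r] r gt q(2) by auto
    ultimately have "\<exists>C. bead_step X B C"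
      using B1[OF c gt] unfolding positions_def by blast
    then show False using stuck by blast
  qed
  moreover have "q \<noteq> L" using q(2) r(2) by (auto simp: full_def)
  ultimately show ?thesis using q by simp
qed

text \<open>A remaining full bead would give beads at the bottom of two opposite runners, by balance, and these could be
  removed.\<close>

lemma stuck_no_full:
  assumes B: "valid B" "balanced B" and stuck: "\<nexists>C. bead_step X B C"
  shows "\<not> (\<exists>p \<in># positions B. full p)"
proof
  assume "\<exists>p \<in># positions B. full p"
  then obtain p where p: "p \<in># positions B" "full p" by blast
  define r where "r = p mod L"
  have r: "1 \<le> r" "r < L" "r \<noteq> l" "full r" using full_mod[OF p(2)] by (simp_all add: r_def)
  define c where "c = (if r < n then r else L - r)"
  have c: "c \<in> {1..<n}" "r = c \<or> r = L - c"
    using r by (cases rule: type_cases; auto simp: c_def)+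
  have "residue_count B r \<noteq> 0"
    using p(1) by (auto simp: residue_count_def r_def)
  then have "residue_count B c \<noteq> 0" "residue_count B (L - c) \<noteq> 0"
    using B(2) c unfolding balanced_def by auto
  then obtain p1 p2 where "p1 \<in># positions B" "p1 mod L = c" "p2 \<in># positions B" "p2 mod L = L - c"
    unfolding residue_count_def by (auto simp: filter_mset_eq_mempty_iff)
  moreover have "full c" "full (L - c)" "c < L" "L - c < L"
    using small_full[of c] c(1) L_n by auto
  ultimately have "c \<in># positions B" "L - c \<in># positions B"
    using runner_bottom[OF B(1) stuck] by blast+
  then obtain d e where "(c, d) \<in># B" "(L - c, e) \<in># B" by (auto simp: positions_def)
  moreover have "1 \<le> c" "c \<le> n - 1" using c(1) by auto
  ultimately have "\<exists>C. bead_step X B C" using B2[of c d B X e] by blast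
  then show False using stuck by blast
qed

lemma reduce_no_full:
  assumes "\<not> (\<exists>p \<in># positions B. full p)"
  shows "reduce full B = B"
proof -
  have nf: "\<not> full p" if "(p, c) \<in># B" for p c using assms that by (force simp: positions_def)
  have "filter_mset (\<lambda>(p, _). \<not> full p) B = B" using nf by (auto simp: filter_mset_eq_conv)
  moreover have "overtaken full B p = 0" for p
    using assms by (auto simp: overtaken_positions)
  ultimately show ?thesis by (simp add: reduce_def)
qed

lemma reduce_positions_not_full: "\<not> (\<exists>p \<in># positions (reduce full B). full p)"
  by (auto simp: reduce_def positions_def)

lemma no_full_stuck:
  assumes "\<not> (\<exists>p \<in># positions B. full p)"
  shows "\<nexists>C. bead_step X B C"
proof
  assume "\<exists>C. bead_step X B C"
  then obtain C where "bead_step X B C" ..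
  then show False
  proof cases
    case (B1 s c k)
    then show False using full_runner[of k s] assms by (force simp: positions_def)
  next
    case (B2 s c d)
    then show False using small_full(1)[of s] rank assms by (force simp: positions_def)
  qed
qed

lemma bead_steps_to_reduce:
  assumes "valid B" "balanced B"
  shows "(bead_step X)\<^sup>*\<^sup>* B (reduce full B)"
  using assms
proof (induction "\<Sum>\<^sub># (positions B)" arbitrary: B rule: less_induct)
  case less
  show ?case
  proof (cases "\<exists>C. bead_step X B C")
    case True
    then obtain C where C: "bead_step X B C" ..
    note inv = bead_step_invariants[OF C less.prems(1)]
    have "(bead_step X)\<^sup>*\<^sup>* C (reduce full C)"
      using less.hyps inv less.prems by blast
    then show ?thesis using C inv(3) by (simp add: converse_rtranclp_into_rtranclp)
  next
    case False
    then show ?thesis using reduce_no_full stuck_no_full less.prems by simp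
  qed
qed

lemma bead_steps_stuck:
  assumes steps: "(bead_step X)\<^sup>*\<^sup>* B C" and B: "valid B" "balanced B" and stuck: "\<nexists>D. bead_step X C D"
  shows "C = reduce full B"
proof -
  have "valid C \<and> balanced C \<and> reduce full C = reduce full B"
    using steps B by (induction rule: rtranclp_induct) (auto simp: bead_step_invariants)
  then show ?thesis using reduce_no_full stuck_no_full stuck by metis
qed


section \<open>Bead positions on the runners of type I\<close>

definition on_runner :: "nat set \<Rightarrow> nat \<Rightarrow> nat set" where
  "on_runner S j = {s \<in> S. s mod L = j}"

definition balanced_set :: "nat set \<Rightarrow> bool" where
  "balanced_set S \<longleftrightarrow> finite S \<and> (\<forall>s\<in>S. full s) \<and>
     (\<forall>c\<in>{1..<n}. card (on_runner S c) = card (on_runner S (L - c)))"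

definition coords :: "nat set \<Rightarrow> nat \<Rightarrow> nat list" where
  "coords S j = map (\<lambda>N. (N - j) div L) (rev (sorted_list_of_set (on_runner S j)))"

definition frobenius_tuple :: "nat set \<Rightarrow> (nat \<Rightarrow> nat) list" where
  "frobenius_tuple S = map (\<lambda>k. frobenius (coords S k) (coords S (L - k))) [1..<n]"

text \<open>On a runner the offset \<open>j\<close> is the residue, so it disappears in the division.\<close>

lemma coords_eq: "coords S j = map (\<lambda>s. s div L) (rev (sorted_list_of_set (on_runner S j)))"
proof (cases "finite (on_runner S j)")
  case True
  have "(s - j) div L = s div L" if "s \<in> on_runner S j" for s
  proof -
    have "s - j = L * (s div L)"
      using that minus_mod_eq_mult_div[of s L] by (auto simp: on_runner_def)
    then show ?thesis using L_pos by simp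
  qed
  then show ?thesis unfolding coords_def using True by (intro map_cong) auto
qed (simp add: coords_def)

lemma inj_on_div: "inj_on (\<lambda>s. s div L) (on_runner S j)"
  by (rule inj_onI) (metis (mono_tags, lifting) div_mult_mod_eq mem_Collect_eq on_runner_def)

lemma set_coords: "finite S \<Longrightarrow> set (coords S j) = (\<lambda>s. s div L) ` on_runner S j"
  by (simp add: coords_eq on_runner_def)

lemma length_coords: "finite S \<Longrightarrow> length (coords S j) = card (on_runner S j)"
  by (simp add: coords_eq on_runner_def)

lemma sorted_coords:
  assumes "finite S"
  shows "sorted_wrt (>) (coords S j)"
proof -
  have fin: "finite (on_runner S j)" using assms by (simp add: on_runner_def)
  have "s div L < t div L" if "s \<in> on_runner S j" "t \<in> on_runner S j" "s < t" for s t
  proof -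
    have "s div L \<noteq> t div L" using inj_onD[OF inj_on_div _ that(1,2)] that(3) by blast
    then show ?thesis using div_le_mono[of s t L] that(3) by simp
  qed
  then have "sorted_wrt (\<lambda>s t. s div L < t div L) (sorted_list_of_set (on_runner S j))"
    using fin by (intro sorted_wrt_mono_rel[OF _ strict_sorted_list_of_set]) auto
  then show ?thesis by (simp add: coords_eq sorted_wrt_map sorted_wrt_rev)
qed

lemma sum_on_runner:
  assumes "finite S"
  shows "\<Sum>(on_runner S j) = L * sum_list (coords S j) + j * card (on_runner S j)"
proof -
  have fin: "finite (on_runner S j)" using assms by (simp add: on_runner_def)
  have "sum_list (coords S j) = (\<Sum>s\<in>on_runner S j. s div L)"
    using fin by (simp add: coords_eq sum_list_distinct_conv_sum_set flip: rev_map)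
  moreover have "\<Sum>(on_runner S j) = (\<Sum>s\<in>on_runner S j. L * (s div L) + j)"
    by (intro sum.cong) (auto simp: on_runner_def)
  ultimately show ?thesis by (simp add: sum.distrib sum_distrib_left mult.commute)
qed

lemma type_I_cases:
  assumes "full s"
  shows "\<exists>!c. c \<in> {1..<n} \<and> (s mod L = c \<or> s mod L = L - c)"
proof -
  define r where "r = s mod L"
  have fr: "full r" using assms l_dvd_L by (simp add: full_def r_def dvd_mod_iff)
  have r: "r < L" using L_pos by (simp add: r_def)
  have "r \<noteq> 0" "r \<noteq> l" using fr by (auto simp: full_def intro!: gr0I)
  define c0 where "c0 = (if r < n then r else L - r)"
  show ?thesis
    unfolding r_def[symmetric]
  proof (rule ex1I[of _ c0], intro conjI)
    show "c0 \<in> {1..<n}"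
      using r \<open>r \<noteq> 0\<close> \<open>r \<noteq> l\<close> by (cases rule: type_cases) (auto simp: c0_def)
    show "r = c0 \<or> r = L - c0" using r by (simp add: c0_def)
    fix c assume "c \<in> {1..<n} \<and> (r = c \<or> r = L - c)"
    then have "1 \<le> c" "c < n" "r = c \<or> r = L - c" by auto
    then show "c = c0" using L_n by (auto simp: c0_def)
  qed
qed

lemma runners_disjoint:
  assumes "c \<in> {1..<n}"
  shows "c < L" "L - c < L" "c \<noteq> L - c" "full c" "full (L - c)"
  using assms small_full[of c] L_n by auto

lemma sum_runners:
  fixes g :: "nat \<Rightarrow> nat"
  assumes "finite S" "\<forall>s\<in>S. full s"
  shows "sum g S = (\<Sum>c\<in>{1..<n}. sum g (on_runner S c) + sum g (on_runner S (L - c)))"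
proof -
  have "S = (\<Union>c\<in>{1..<n}. on_runner S c \<union> on_runner S (L - c))"
  proof (intro equalityI subsetI)
    fix s assume s: "s \<in> S"
    then obtain c where "c \<in> {1..<n}" "s mod L = c \<or> s mod L = L - c"
      using type_I_cases assms(2) by meson
    then show "s \<in> (\<Union>c\<in>{1..<n}. on_runner S c \<union> on_runner S (L - c))"
      using s by (auto simp: on_runner_def)
  qed (auto simp: on_runner_def)
  then have "sum g S = sum g (\<Union>c\<in>{1..<n}. on_runner S c \<union> on_runner S (L - c))" by simp
  also have "\<dots> = (\<Sum>c\<in>{1..<n}. sum g (on_runner S c \<union> on_runner S (L - c)))"
  proof (rule sum.UNION_disjoint)
    show "\<forall>i\<in>{1..<n}. \<forall>j\<in>{1..<n}. i \<noteq> j \<longrightarrow>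
        (on_runner S i \<union> on_runner S (L - i)) \<inter> (on_runner S j \<union> on_runner S (L - j)) = {}"
    proof (intro ballI impI)
      fix i j assume ij: "i \<in> {1..<n}" "j \<in> {1..<n}" "i \<noteq> j"
      show "(on_runner S i \<union> on_runner S (L - i)) \<inter> (on_runner S j \<union> on_runner S (L - j)) = {}"
      proof -
        have "i < n" "j < n" "n \<le> L - i" "n \<le> L - j" "L - i \<noteq> L - j" using ij L_n by auto
        then have "i \<noteq> L - j" "L - i \<noteq> j" by linarith+
        then show ?thesis using ij(3) \<open>L - i \<noteq> L - j\<close> by (auto simp: on_runner_def)
      qed
    qed
  qed (use assms(1) in \<open>auto simp: on_runner_def\<close>)
  also have "\<dots> = (\<Sum>c\<in>{1..<n}. sum g (on_runner S c) + sum g (on_runner S (L - c)))"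
  proof (rule sum.cong[OF refl])
    fix c assume "c \<in> {1..<n}"
    then show "sum g (on_runner S c \<union> on_runner S (L - c)) = sum g (on_runner S c) + sum g (on_runner S (L - c))"
      using assms(1) runners_disjoint(3)[of c] by (intro sum.union_disjoint) (auto simp: on_runner_def)
  qed
  finally show ?thesis .
qed

lemma even_card_balanced:
  assumes "balanced_set S"
  shows "even (card S)"
proof -
  have "card S = (\<Sum>c\<in>{1..<n}. card (on_runner S c) + card (on_runner S (L - c)))"
    using sum_runners[of S "\<lambda>_. 1"] assms by (simp add: balanced_set_def)
  also have "\<dots> = (\<Sum>c\<in>{1..<n}. 2 * card (on_runner S c))"
    using assms by (intro sum.cong) (auto simp: balanced_set_def)
  also have "even \<dots>" by (intro dvd_sum) simp
  finally show ?thesis .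
qed

lemma is_frobenius_coords:
  assumes "balanced_set S" "c \<in> {1..<n}"
  shows "is_frobenius (coords S c) (coords S (L - c)) (frobenius (coords S c) (coords S (L - c)))"
  using assms by (intro is_frobenius_frobenius sorted_coords)
    (auto simp: balanced_set_def length_coords)

text \<open>The beads of two opposite runners pair up, and the offsets \<open>c\<close> and \<open>L - c\<close> of a pair make up one more period;
  this is the summand for the diagonal boxes.\<close>

lemma frobenius_tuple_partitions:
  assumes S: "balanced_set S"
  shows "length (frobenius_tuple S) = n - 1" "\<forall>p\<in>set (frobenius_tuple S). is_partition p"
    "\<Sum>S = L * sum_list (map psize (frobenius_tuple S))"
proof -
  show "length (frobenius_tuple S) = n - 1" by (simp add: frobenius_tuple_def)
  show "\<forall>p\<in>set (frobenius_tuple S). is_partition p"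
    using is_frobenius_coords[OF S] by (auto simp: frobenius_tuple_def is_frobenius_def)
  have fin: "finite S" using S by (simp add: balanced_set_def)
  have "\<Sum>S = (\<Sum>c\<in>{1..<n}. \<Sum>(on_runner S c) + \<Sum>(on_runner S (L - c)))"
    using sum_runners[of S "\<lambda>s. s"] S by (simp add: balanced_set_def)
  also have "\<dots> = (\<Sum>c\<in>{1..<n}. L * psize (frobenius (coords S c) (coords S (L - c))))"
  proof (rule sum.cong[OF refl])
    fix c assume c: "c \<in> {1..<n}"
    define r where "r = card (on_runner S c)"
    have r: "card (on_runner S (L - c)) = r" using S c by (simp add: balanced_set_def r_def)
    have "c * r + (L - c) * r = L * r"
      using runners_disjoint(1)[OF c] by (simp flip: add_mult_distrib)
    then show "\<Sum>(on_runner S c) + \<Sum>(on_runner S (L - c)) = L * psize (frobenius (coords S c) (coords S (L - c)))"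
      using psize_frobenius[OF is_frobenius_coords[OF S c]]
      unfolding sum_on_runner[OF fin] length_coords[OF fin] r r_def[symmetric]
      by (simp add: distrib_left)
  qed
  also have "\<dots> = L * sum_list (map psize (frobenius_tuple S))"
    by (simp add: frobenius_tuple_def comp_def sum_distrib_left interv_sum_list_conv_sum_set_nat
        sum_list_const_mult flip: sum_set_upt_conv_sum_list_nat)
  finally show "\<Sum>S = L * sum_list (map psize (frobenius_tuple S))" .
qed

lemma frobenius_tuple_inject:
  assumes S: "balanced_set S" and S': "balanced_set S'" and eq: "frobenius_tuple S = frobenius_tuple S'"
  shows "S = S'"
proof -
  have fin: "finite S" "finite S'" using S S' by (simp_all add: balanced_set_def)
  have coords: "coords S c = coords S' c" "coords S (L - c) = coords S' (L - c)" if "c \<in> {1..<n}" for c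
  proof -
    have "frobenius (coords S c) (coords S (L - c)) = frobenius (coords S' c) (coords S' (L - c))"
      using eq that by (simp add: frobenius_tuple_def)
    then show "coords S c = coords S' c" "coords S (L - c) = coords S' (L - c)"
      using is_frobenius_coords[OF S that] is_frobenius_coords[OF S' that]
        is_frobenius_coords_unique by metis+
  qed
  have sub: "A \<subseteq> B" if AB: "finite A" "finite B" "\<And>s. s \<in> A \<Longrightarrow> full s"
    "\<And>c. c \<in> {1..<n} \<Longrightarrow> coords A c = coords B c \<and> coords A (L - c) = coords B (L - c)" for A B
  proof
    fix s assume s: "s \<in> A"
    obtain c where "c \<in> {1..<n}" "s mod L = c \<or> s mod L = L - c" using type_I_cases AB(3)[OF s] by meson
    then have "coords A (s mod L) = coords B (s mod L)" using AB(4)[of c] by auto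
    moreover have "s div L \<in> set (coords A (s mod L))"
      using s by (auto simp: set_coords AB(1) on_runner_def)
    ultimately obtain t where "t \<in> on_runner B (s mod L)" "s div L = t div L"
      by (auto simp: set_coords AB(2))
    then show "s \<in> B" unfolding on_runner_def by (metis (mono_tags, lifting) div_mult_mod_eq mem_Collect_eq)
  qed
  show ?thesis
    using sub[OF fin] sub[OF fin(2,1)] coords S S' unfolding balanced_set_def by (intro equalityI) auto
qed

lemma strict_desc_equal:
  fixes xs ys :: "nat list"
  assumes "sorted_wrt (>) xs" "sorted_wrt (>) ys" "set xs = set ys"
  shows "xs = ys"
proof -
  have "sorted_wrt (<) (rev xs)" "sorted_wrt (<) (rev ys)"
    using assms by (simp_all add: sorted_wrt_rev)
  then have "rev xs = rev ys" using assms(3) by (intro strict_sorted_equal) auto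
  then show ?thesis by simp
qed

lemma frobenius_tuple_surj:
  assumes len: "length ps = n - 1" and parts: "\<forall>p\<in>set ps. is_partition p"
  shows "\<exists>S. balanced_set S \<and> frobenius_tuple S = ps"
proof -
  have "\<exists>xs ys. sorted_wrt (>) xs \<and> sorted_wrt (>) ys \<and> is_frobenius xs ys (ps ! (c - 1))"
    if "c \<in> {1..<n}" for c
  proof -
    have "ps ! (c - 1) \<in> set ps" using that len by (intro nth_mem) auto
    then show ?thesis using frobenius_coords_exist parts by blast
  qed
  then obtain xs ys where xy: "\<And>c. c \<in> {1..<n} \<Longrightarrow> sorted_wrt (>) (xs c) \<and> sorted_wrt (>) (ys c) \<and>
      is_frobenius (xs c) (ys c) (ps ! (c - 1))"
    by metis
  \<comment> \<open>The bead positions, divided by \<open>L\<close>, prescribed for the runner of residue \<open>j\<close>.\<close>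
  define zs where "zs j = (if j < n then xs j else ys (L - j))" for j
  define S where "S = {s. full s \<and> s div L \<in> set (zs (s mod L))}"
  have "S \<subseteq> (\<Union>j<L. (\<lambda>a. a * L + j) ` set (zs j))"
  proof
    fix s assume "s \<in> S"
    moreover have "s = s div L * L + s mod L" "s mod L < L" using L_pos by simp_all
    ultimately show "s \<in> (\<Union>j<L. (\<lambda>a. a * L + j) ` set (zs j))" unfolding S_def by blast
  qed
  then have fin: "finite S" by (rule finite_subset) auto
  have img: "(\<lambda>s. s div L) ` on_runner S j = set (zs j)" if "full j" "j < L" for j
  proof (intro equalityI subsetI)
    fix a assume a: "a \<in> set (zs j)"
    have "(a * L + j) mod L = j" "(a * L + j) div L = a" using that(2) by simp_all
    moreover have "full (a * L + j)"
      using that(1) l_dvd_L by (simp add: full_def dvd_add_right_iff)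
    ultimately have "a * L + j \<in> on_runner S j" using a by (simp add: on_runner_def S_def)
    then show "a \<in> (\<lambda>s. s div L) ` on_runner S j"
      using \<open>(a * L + j) div L = a\<close> by (metis imageI)
  qed (auto simp: on_runner_def S_def)
  have z: "zs c = xs c" "zs (L - c) = ys c" if "c \<in> {1..<n}" for c
    using that L_n by (auto simp: zs_def)
  have co: "coords S c = xs c" "coords S (L - c) = ys c" if c: "c \<in> {1..<n}" for c
    using xy[OF c] img[of c] img[of "L - c"] runners_disjoint[OF c] z[OF c]
    by (auto intro!: strict_desc_equal sorted_coords fin simp: set_coords[OF fin])
  have "balanced_set S"
    unfolding balanced_set_def
  proof (intro conjI ballI)
    fix c assume c: "c \<in> {1..<n}"
    then show "card (on_runner S c) = card (on_runner S (L - c))"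
      using xy[OF c] co[OF c] length_coords[OF fin] by (metis is_frobenius_def)
  qed (use fin in \<open>auto simp: S_def\<close>)
  moreover have "frobenius_tuple S = ps"
  proof (rule nth_equalityI)
    show "length (frobenius_tuple S) = length ps" by (simp add: frobenius_tuple_def len)
    fix i assume "i < length (frobenius_tuple S)"
    then have i: "i < n - 1" "Suc i \<in> {1..<n}" by (auto simp: frobenius_tuple_def)
    then show "frobenius_tuple S ! i = ps ! i"
      using co[OF i(2)] frobenius_eqI xy[OF i(2)] by (simp add: frobenius_tuple_def)
  qed
  ultimately show ?thesis by blast
qed


section \<open>Splitting a wall into its full columns and its reduced wall\<close>

definition full_set :: "(nat \<times> colour) multiset \<Rightarrow> nat set" where
  "full_set B = {p. p \<in># positions B \<and> full p}"

text \<open>The columns of a wall all of whose beads lie in \<open>R\<^sub>\<ell>\<close>, from its two-coloured partition.\<close>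

definition scale :: "(nat \<Rightarrow> nat \<times> colour) \<Rightarrow> nat \<Rightarrow> nat \<times> colour" where
  "scale w i = (l * fst (w i), snd (w i))"

definition toggle :: "nat set \<Rightarrow> nat \<times> colour \<Rightarrow> nat \<times> colour" where
  "toggle S = (\<lambda>(p, c). (p, if odd (card {s \<in> S. p < s}) then switch c else c))"

lemma switch_switch [simp]: "switch (switch c) = c"
  by (cases c) auto

lemma toggle_toggle: "toggle S (toggle S a) = a"
  by (cases a) (simp add: toggle_def)

lemma fst_toggle [simp]: "fst (toggle S a) = fst a"
  by (cases a) (simp add: toggle_def)

lemma not_full_0: "\<not> full 0"
  by (simp add: full_def)

lemma size_filter_positions:
  assumes "x \<in> Pprime"
  shows "size (filter_mset P (positions (parts_mset x))) = card {k. fst (x k) \<noteq> 0 \<and> P (fst (x k))}"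
  using Pprime_finite[OF assms]
  by (simp add: positions_def parts_mset_def filter_mset_image_mset multiset.map_comp comp_def)

lemma count_positions: "count M p = size (filter_mset (\<lambda>s. s = p) M)"
  by (simp add: filter_eq_replicate_mset)

lemma columns_iff_valid:
  assumes x: "x \<in> Pprime"
  shows "x \<in> columns \<longleftrightarrow> valid (parts_mset x)"
proof -
  have count: "count (positions (parts_mset x)) p = card {k. fst (x k) \<noteq> 0 \<and> fst (x k) = p}" for p
    unfolding count_positions by (rule size_filter_positions[OF x])
  have fin: "finite {k. fst (x k) \<noteq> 0 \<and> fst (x k) = p}" for p
    using Pprime_finite[OF x] by (rule rev_finite_subset) auto
  have one: "count (positions (parts_mset x)) p \<le> 1 \<longleftrightarrow> (\<forall>i j. fst (x i) = p \<longrightarrow> fst (x j) = p \<longrightarrow> i = j)"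
    if "full p" for p
  proof -
    have "p \<noteq> 0" using that not_full_0 by (auto intro!: gr0I)
    then show ?thesis unfolding count One_nat_def card_le_Suc0_iff_eq[OF fin] by auto
  qed
  have mem: "(p, c) \<in># parts_mset x \<longleftrightarrow> (\<exists>i. x i = (p, c))" if "full p" for p c
  proof -
    have "p \<noteq> 0" using that not_full_0 by (auto intro!: gr0I)
    then show ?thesis unfolding set_parts_mset[OF x] mem_Collect_eq by (metis fst_conv)
  qed
  show ?thesis
  proof
    assume col: "x \<in> columns"
    have "c = White \<and> count (positions (parts_mset x)) p \<le> 1"
      if pc: "(p, c) \<in># parts_mset x" and p: "full p" for p c
    proof
      obtain i where i: "x i = (p, c)" using mem[OF p] pc by blast
      then show "c = White" using columns_white[OF col, of i] p by (simp add: full_def)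
      show "count (positions (parts_mset x)) p \<le> 1"
        unfolding one[OF p]
      proof (intro allI impI)
        fix i j assume "fst (x i) = p" "fst (x j) = p"
        then show "i = j" using columns_distinct[OF col, of i j] p by (simp add: full_def)
      qed
    qed
    then show "valid (parts_mset x)" using consistent_parts_mset[OF x] by (simp add: valid_def)
  next
    assume v: "valid (parts_mset x)"
    have "snd (x i) = White \<and> (\<forall>j. fst (x i) = fst (x j) \<longrightarrow> i = j)" if "\<not> l dvd fst (x i)" for i
    proof -
      have p: "full (fst (x i))" using that by (simp add: full_def)
      have "(fst (x i), snd (x i)) \<in># parts_mset x" using mem[OF p] by (metis prod.collapse)
      then have "snd (x i) = White" "count (positions (parts_mset x)) (fst (x i)) \<le> 1"
        using v p unfolding valid_def by blast+
      then show ?thesis unfolding one[OF p] by metis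
    qed
    then show "x \<in> columns" using x unfolding columns_def by blast
  qed
qed

lemma finite_full_set: "finite (full_set B)"
  unfolding full_set_def by (rule finite_subset[of _ "set_mset (positions B)"]) auto

lemma full_positions:
  assumes "valid B"
  shows "filter_mset full (positions B) = mset_set (full_set B)"
proof (rule multiset_eqI)
  fix p
  have "count (positions B) p = 1" if "p \<in># positions B" "full p"
  proof -
    obtain c where "(p, c) \<in># B" using \<open>p \<in># positions B\<close> by (auto simp: positions_def)
    then have "count (positions B) p \<le> 1" using assms that(2) unfolding valid_def by blast
    moreover have "count (positions B) p > 0" using that(1) by simp
    ultimately show ?thesis by linarith
  qed
  moreover have "count (positions B) p = 0" if "p \<notin># positions B" using that by (simp add: not_in_iff)
  ultimately show "count (filter_mset full (positions B)) p = count (mset_set (full_set B)) p"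
    using finite_full_set[of B] by (auto simp: count_mset_set' full_set_def)
qed

lemma size_filter_full:
  assumes "valid B"
  shows "size (filter_mset (\<lambda>s. full s \<and> P s) (positions B)) = card {s \<in> full_set B. P s}"
proof -
  have "filter_mset (\<lambda>s. full s \<and> P s) (positions B) = filter_mset P (filter_mset full (positions B))"
    by (simp add: filter_filter_mset conj_commute)
  then show ?thesis using finite_full_set[of B] by (simp add: full_positions[OF assms])
qed

lemma reduce_toggle:
  assumes "valid B"
  shows "reduce full B = image_mset (toggle (full_set B)) (filter_mset (\<lambda>(p, _). \<not> full p) B)"
  unfolding reduce_def toggle_def overtaken_positions size_filter_full[OF assms] ..

text \<open>The correction of colours depends on the full positions only and is an involution, so it can be undone.\<close>

lemma valid_split:
  assumes "valid B"
  shows "B = image_mset (\<lambda>p. (p, White)) (mset_set (full_set B)) +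
    image_mset (toggle (full_set B)) (reduce full B)"
proof -
  have "image_mset (toggle (full_set B)) (reduce full B) = filter_mset (\<lambda>(p, _). \<not> full p) B"
    by (simp add: reduce_toggle[OF assms] multiset.map_comp comp_def toggle_toggle)
  moreover have "image_mset (\<lambda>p. (p, White)) (mset_set (full_set B)) = filter_mset (\<lambda>(p, _). full p) B"
  proof -
    have "image_mset (\<lambda>p. (p, White)) (mset_set (full_set B)) =
        image_mset (\<lambda>a. (fst a, White)) (filter_mset (\<lambda>(p, _). full p) B)"
      unfolding full_positions[OF assms, symmetric] positions_def filter_mset_image_mset multiset.map_comp
      by (simp add: comp_def case_prod_unfold)
    also have "\<dots> = image_mset (\<lambda>a. a) (filter_mset (\<lambda>(p, _). full p) B)"
    proof (rule image_mset_cong)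
      fix a assume "a \<in># filter_mset (\<lambda>(p, _). full p) B"
      then show "(fst a, White) = a" using assms by (cases a) (auto simp: valid_def)
    qed
    finally show ?thesis by simp
  qed
  moreover have "filter_mset (\<lambda>(p, _). full p) B + filter_mset (\<lambda>(p, _). \<not> full p) B = B"
    using multiset_partition[of B "\<lambda>(p, _). full p"] by (simp add: case_prod_unfold)
  ultimately show ?thesis by simp
qed

text \<open>The corrected colours of the beads in \<open>R\<close> are turned into the original ones by correcting them again.\<close>

lemma valid_join:
  assumes fin: "finite S" and full: "\<forall>s\<in>S. full s"
    and con: "consistent R" and nf: "\<And>p c. (p, c) \<in># R \<Longrightarrow> \<not> full p"
  shows "\<exists>B. valid B \<and> full_set B = S \<and> reduce full B = R"
proof -
  define B where "B = image_mset (\<lambda>p. (p, White)) (mset_set S) + image_mset (toggle S) R"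
  have mem: "(p, c) \<in># B \<longleftrightarrow> p \<in> S \<and> c = White \<or> toggle S (p, c) \<in># R" for p c
  proof -
    have "(p, c) \<in># image_mset (toggle S) R \<longleftrightarrow> toggle S (p, c) \<in># R"
      using toggle_toggle[of S] by (metis image_iff set_image_mset)
    then show ?thesis using fin by (auto simp: B_def)
  qed
  have tog: "\<exists>d. toggle S (p, c) = (p, d)" for p c by (simp add: toggle_def)
  have fullB: "p \<in> S \<and> c = White" if "(p, c) \<in># B" "full p" for p c
    using that mem tog[of p c] nf by fastforce
  have nfB: "toggle S (p, c) \<in># R" if "(p, c) \<in># B" "\<not> full p" for p c
    using that mem full by blast
  have posB: "positions B = mset_set S + positions R"
    by (simp add: B_def positions_def multiset.map_comp comp_def)
  have nR: "p \<notin># positions R" if "full p" for p using nf that by (auto simp: positions_def)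
  have "consistent B"
    unfolding consistent_def
  proof (intro conjI allI impI)
    fix p c assume pc: "(p, c) \<in># B"
    show "p \<noteq> 0"
    proof (cases "full p")
      case True
      then show ?thesis using not_full_0 by (auto intro!: gr0I)
    next
      case False
      then show ?thesis using nfB[OF pc] tog[of p c] con unfolding consistent_def by metis
    qed
    fix d assume pd: "(p, d) \<in># B"
    show "c = d"
    proof (cases "full p")
      case True
      then show ?thesis using fullB[OF pc] fullB[OF pd] by simp
    next
      case False
      then have "toggle S (p, c) = toggle S (p, d)"
        using nfB[OF pc] nfB[OF pd] tog[of p c] tog[of p d] con unfolding consistent_def by metis
      then show ?thesis by (metis prod.inject toggle_toggle)
    qed
  qed
  moreover have "c = White \<and> count (positions B) p \<le> 1" if "(p, c) \<in># B" "full p" for p c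
    using fullB[OF that] nR[OF that(2)] fin by (simp add: posB not_in_iff)
  ultimately have valid: "valid B" by (simp add: valid_def)
  moreover have fs: "full_set B = S"
    using nR full fin by (auto simp: full_set_def posB)
  moreover have "reduce full B = R"
  proof -
    have "filter_mset (\<lambda>(p, _). \<not> full p) B = image_mset (toggle S) R"
    proof -
      have "filter_mset (\<lambda>(p, _). \<not> full p) (image_mset (\<lambda>p. (p, White)) (mset_set S)) = {#}"
        using full fin by auto
      moreover have "filter_mset (\<lambda>(p, _). \<not> full p) (image_mset (toggle S) R) = image_mset (toggle S) R"
        using nf by (auto simp: filter_mset_eq_conv case_prod_unfold)
      ultimately show ?thesis by (simp add: B_def)
    qed
    then show ?thesis
      by (simp add: reduce_toggle[OF valid] fs multiset.map_comp comp_def toggle_toggle)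
  qed
  ultimately show ?thesis by blast
qed

lemma consistent_reduce: "consistent B \<Longrightarrow> consistent (reduce F B)"
  unfolding consistent_def reduce_def by (auto split: if_splits)

lemma scale_Pprime:
  assumes w: "w \<in> Pprime"
  shows "scale w \<in> Pprime"
proof -
  have part: "is_partition (fst \<circ> scale w)"
  proof (rule is_partitionI)
    show "(fst \<circ> scale w) (Suc i) \<le> (fst \<circ> scale w) i" for i
      using partition_le[OF Pprime_partition[OF w], of i "Suc i"] by (simp add: scale_def)
    show "(fst \<circ> scale w) i = 0" if "i \<ge> conj_part (fst \<circ> w) 0" for i
      using partition_zero_iff[OF Pprime_partition[OF w], of i] that by (simp add: scale_def)
  qed
  have "snd (scale w i) = White" if "fst (scale w i) = 0" for i
    using that Pprime_zero[OF w, of i] l_pos by (simp add: scale_def)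
  moreover have "snd (scale w i) = snd (scale w j)" if "fst (scale w i) = fst (scale w j)" for i j
    using that Pprime_same[OF w, of i j] l_pos by (simp add: scale_def)
  ultimately show ?thesis using part unfolding Pprime_def by blast
qed

lemma scale_columns: "w \<in> Pprime \<Longrightarrow> scale w \<in> columns"
  using scale_Pprime unfolding columns_def by (simp add: scale_def)

lemma scale_surj:
  assumes con: "consistent R" and nf: "\<And>p c. (p, c) \<in># R \<Longrightarrow> \<not> full p"
  shows "\<exists>w \<in> Pprime. parts_mset (scale w) = R"
proof -
  obtain z where z: "z \<in> Pprime" "parts_mset z = R" using parts_mset_surj[OF con] by blast
  have dvd: "l dvd fst (z i)" for i
  proof (cases "fst (z i) = 0")
    case False
    then have "(fst (z i), snd (z i)) \<in># R" using set_parts_mset[OF z(1)] z(2) by auto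
    then show ?thesis using nf unfolding full_def by blast
  qed simp
  define w where "w i = (fst (z i) div l, snd (z i))" for i
  have zw: "scale w = z" using dvd by (simp add: scale_def w_def fun_eq_iff prod_eq_iff)
  have fw: "fst (z i) = l * fst (w i)" "snd (z i) = snd (w i)" for i using dvd by (simp_all add: w_def)
  have "is_partition (fst \<circ> w)"
  proof (rule is_partitionI)
    show "(fst \<circ> w) (Suc i) \<le> (fst \<circ> w) i" for i
      using partition_le[OF Pprime_partition[OF z(1)], of i "Suc i"] by (simp add: w_def div_le_mono)
    show "(fst \<circ> w) i = 0" if "i \<ge> conj_part (fst \<circ> z) 0" for i
      using partition_zero_iff[OF Pprime_partition[OF z(1)], of i] that by (simp add: w_def)
  qed
  moreover have "snd (w i) = White" if "fst (w i) = 0" for i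
    using Pprime_zero[OF z(1), of i] fw[of i] that by simp
  moreover have "snd (w i) = snd (w j)" if "fst (w i) = fst (w j)" for i j
    using Pprime_same[OF z(1), of i j] fw[of i] fw[of j] that by simp
  ultimately have "w \<in> Pprime" unfolding Pprime_def by blast
  then show ?thesis using z(2) zw by blast
qed

text \<open>\<open>splits x S w\<close>: the wall with columns \<open>x\<close> has its beads of type I at \<open>S\<close>, and \<open>w\<close> is the
  two-coloured partition of its other beads, with corrected colours.\<close>

definition splits :: "(nat \<Rightarrow> nat \<times> colour) \<Rightarrow> nat set \<Rightarrow> (nat \<Rightarrow> nat \<times> colour) \<Rightarrow> bool" where
  "splits x S w \<longleftrightarrow> x \<in> columns \<and> w \<in> Pprime \<and> full_set (parts_mset x) = S \<and>
     parts_mset (scale w) = reduce full (parts_mset x)"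

lemma splits_exist:
  assumes x: "x \<in> columns"
  shows "\<exists>S w. splits x S w"
proof -
  have "consistent (reduce full (parts_mset x))"
    using consistent_reduce consistent_parts_mset columns_Pprime[OF x] by blast
  moreover have "\<not> full p" if "(p, c) \<in># reduce full (parts_mset x)" for p c
    using that by (auto simp: reduce_def)
  ultimately show ?thesis using scale_surj x unfolding splits_def by blast
qed

lemma splits_surj:
  assumes S: "finite S" "\<forall>s\<in>S. full s" and w: "w \<in> Pprime"
  shows "\<exists>x. splits x S w"
proof -
  have "\<not> full p" if "(p, c) \<in># parts_mset (scale w)" for p c
    using that unfolding set_parts_mset[OF scale_Pprime[OF w]] by (auto simp: scale_def full_def)
  then obtain B where B: "valid B" "full_set B = S" "reduce full B = parts_mset (scale w)"
    using valid_join[OF S consistent_parts_mset[OF scale_Pprime[OF w]]] by metis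
  then obtain x where x: "x \<in> Pprime" "parts_mset x = B"
    using parts_mset_surj unfolding valid_def by blast
  then have "x \<in> columns" using columns_iff_valid B(1) by blast
  then show ?thesis using x B w unfolding splits_def by auto
qed

lemma splits_inject:
  assumes "splits x S w" "splits x' S w"
  shows "x = x'"
proof -
  have x: "x \<in> Pprime" "x' \<in> Pprime" "valid (parts_mset x)" "valid (parts_mset x')"
    using assms columns_Pprime columns_iff_valid unfolding splits_def by blast+
  have "parts_mset x = parts_mset x'"
    using valid_split[OF x(3)] valid_split[OF x(4)] assms unfolding splits_def by metis
  then show ?thesis using parts_mset_inject x by blast
qed


section \<open>The bijection\<close>

lemma residue_count_full_set:
  assumes B: "valid B" and j: "full j"
  shows "residue_count B j = card (on_runner (full_set B) j)"
proof -
  have "full s" if "s mod L = j" for s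
    using j that l_dvd_L by (auto simp: full_def dvd_mod_iff)
  then have "filter_mset (\<lambda>s. s mod L = j) (positions B) = filter_mset (\<lambda>s. full s \<and> s mod L = j) (positions B)"
    by (intro filter_mset_cong refl) auto
  then show ?thesis using size_filter_full[OF B, of "\<lambda>s. s mod L = j"]
    by (simp add: residue_count_def on_runner_def)
qed

lemma balanced_iff:
  assumes "valid B"
  shows "balanced B \<longleftrightarrow> balanced_set (full_set B)"
proof -
  have "finite (full_set B)" "\<forall>s\<in>full_set B. full s"
    using finite_full_set by (auto simp: full_set_def)
  moreover have "residue_count B c = card (on_runner (full_set B) c)"
    "residue_count B (L - c) = card (on_runner (full_set B) (L - c))" if "c \<in> {1..<n}" for c
    using residue_count_full_set[OF assms] runners_disjoint[OF that] by auto
  ultimately show ?thesis by (simp add: balanced_def balanced_set_def)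
qed

text \<open>The corrected colours are invariant under the moves, so every sequence of moves that cannot be continued ends in
  the same configuration, and a wall is determined by its beads.\<close>

lemma reduced_wall_eq:
  assumes sp: "splits x S w" and bal: "balanced_set S"
  shows "reduced_wall X \<Lambda> (wall_of x) = wall_of (scale w)"
proof -
  define B where "B = parts_mset x"
  have x: "x \<in> columns" and w: "w \<in> Pprime" and S: "full_set B = S"
    and red: "parts_mset (scale w) = reduce full B"
    using sp unfolding splits_def B_def by auto
  have B: "valid B" using columns_iff_valid columns_Pprime x unfolding B_def by blast
  have balB: "balanced B" using balanced_iff[OF B] bal S by simp
  have beads: "beads (wall_of x) = B" "beads (wall_of (scale w)) = reduce full B"
    using beads_wall_of x scale_columns[OF w] red unfolding B_def by simp_all
  show ?thesis
    unfolding reduced_wall_def beads(1)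
  proof (rule the_equality)
    show "wall_of (scale w) \<in> proper_walls X \<Lambda> \<and>
        (bead_step X)\<^sup>*\<^sup>* B (beads (wall_of (scale w))) \<and>
        (\<nexists>C. bead_step X (beads (wall_of (scale w))) C)"
      using wall_of_proper[OF scale_columns[OF w]] bead_steps_to_reduce[OF B balB]
        no_full_stuck[OF reduce_positions_not_full] by (simp add: beads)
  next
    fix Z
    assume Z: "Z \<in> proper_walls X \<Lambda> \<and> (bead_step X)\<^sup>*\<^sup>* B (beads Z) \<and> (\<nexists>C. bead_step X (beads Z) C)"
    then obtain z where z: "z \<in> columns" "Z = wall_of z" using proper_wall_of by blast
    have "beads Z = reduce full B" using bead_steps_stuck[OF _ B balB] Z by blast
    then have "parts_mset z = parts_mset (scale w)" using z beads_wall_of red by simp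
    then show "Z = wall_of (scale w)"
      using parts_mset_inject columns_Pprime z scale_Pprime[OF w] by blast
  qed
qed

text \<open>The multiplicities of the coloured parts determine the coloured partition.\<close>

lemma wall_part_scale:
  assumes w: "w \<in> Pprime"
  shows "wall_part X (wall_of (scale w)) = w"
proof -
  have beads: "beads (wall_of (scale w)) = parts_mset (scale w)"
    by (rule beads_wall_of[OF scale_columns[OF w]])
  have count: "count (parts_mset (scale w)) (k * l, c) = card {i. w i = (k, c)}" if "k \<ge> 1" for k c
  proof -
    have "{i. scale w i = (k * l, c)} = {i. w i = (k, c)}"
      using l_pos by (auto simp: scale_def prod_eq_iff)
    then show ?thesis
      using count_parts_mset[OF scale_Pprime[OF w], of "k * l" c] that l_pos by simp
  qed
  show ?thesis
    unfolding wall_part_def beads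
  proof (rule the_equality)
    show "w \<in> Pprime \<and> (\<forall>k\<ge>1. \<forall>c. card {i. w i = (k, c)} = count (parts_mset (scale w)) (k * l, c))"
      using w count by simp
  next
    fix v
    assume v: "v \<in> Pprime \<and> (\<forall>k\<ge>1. \<forall>c. card {i. v i = (k, c)} = count (parts_mset (scale w)) (k * l, c))"
    have "count (parts_mset v) a = count (parts_mset w) a" for a
    proof -
      obtain k c where a: "a = (k, c)" by (cases a)
      show ?thesis
      proof (cases "k = 0")
        case True
        then have "a \<notin># parts_mset v" "a \<notin># parts_mset w"
          using v w a consistent_parts_mset[of v] consistent_parts_mset[of w]
          unfolding consistent_def by blast+
        then show ?thesis by (simp add: not_in_iff)
      next
        case False
        then show ?thesis using v w count[of k c] by (simp add: a count_parts_mset)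
      qed
    qed
    then have "parts_mset v = parts_mset w" by (rule multiset_eqI)
    then show "v = w" using parts_mset_inject v w by blast
  qed
qed

lemma pi0_wall_of:
  assumes "splits x S w"
  shows "pi0 X (wall_of x) = frobenius_tuple S"
proof -
  have x: "x \<in> columns" and S: "full_set (parts_mset x) = S" using assms by (auto simp: splits_def)
  have "mu_seq X (wall_of x) j = coords S j" if j: "full j" "j < L" for j
  proof -
    have "type_I X j" using j by (simp add: type_I_full)
    have "s > 0 \<and> full s" if "s \<in># positions (parts_mset x)" "s mod L = j" for s
      using that j(1) l_dvd_L not_full_0 by (auto simp: full_def dvd_mod_iff intro!: gr0I)
    then have "{s \<in> runner X j. s \<in># image_mset fst (beads (wall_of x))} = on_runner S j"
      unfolding runner_type_I[OF \<open>type_I X j\<close>] beads_wall_of[OF x] positions_def[symmetric]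
        S[symmetric] on_runner_def full_set_def by blast
    then show ?thesis by (simp only: mu_seq_def coords_def)
  qed
  then show ?thesis
    unfolding pi0_def frobenius_tuple_def using runners_disjoint by (intro map_cong refl) auto
qed

lemma pi_map_wall_of:
  assumes sp: "splits x S (compose p q)" and bal: "balanced_set S"
    and pq: "is_partition p" "is_partition q" "two_reduced q"
  shows "pi_map X \<Lambda> (wall_of x) = (frobenius_tuple S, p, q)"
proof -
  have "compose p q \<in> Pprime" by (rule compose_in_Pprime[OF pq(1,2)])
  then have "pi1 X (reduced_wall X \<Lambda> (wall_of x)) = (p, q)"
    unfolding pi1_def reduced_wall_eq[OF sp bal]
    by (simp add: wall_part_scale decompose_compose[OF pq] fst_compose)
  then show ?thesis using pi0_wall_of[OF sp] by (simp add: pi_map_def)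
qed

text \<open>As lists, the columns of the reduced wall arise from those of the wall by \<open>strip\<close>; \<open>M\<close> is their number.\<close>

lemma alternating_sum_scale:
  assumes sp: "splits x S w" and ev: "even (card S)" and xs: "x = pad xs" "decreasing xs" "consistent (mset xs)"
  obtains M where "\<And>h. alternating (length xs) h x =
      alternating M h (scale w)" "\<And>k. k \<ge> M \<Longrightarrow> fst (w k) = 0"
proof
  define ys where "ys = strip full False xs"
  have x: "x \<in> columns" and w: "w \<in> Pprime" and S: "full_set (mset xs) = S"
    and red: "parts_mset (scale w) = reduce full (mset xs)"
    using sp unfolding splits_def xs(1) parts_mset_pad[OF xs(3)] by auto
  have ys: "mset ys = reduce full (mset xs)" "decreasing ys" "consistent (mset ys)"
    using mset_strip decreasing_strip xs consistent_reduce by (simp_all add: ys_def)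
  have pad: "scale w = pad ys"
    using parts_mset_inject[OF scale_Pprime[OF w] pad_in_Pprime[OF ys(2,3)]] parts_mset_pad[OF ys(3)] ys(1) red
    by simp
  have valid: "valid (mset xs)"
    using x columns_iff_valid[OF columns_Pprime[OF x]] parts_mset_pad[OF xs(3)] by (simp add: xs(1))
  have "length (filter (full \<circ> fst) xs) = size (filter_mset full (positions (mset xs)))"
    by (simp add: positions_def filter_mset_image_mset comp_def flip: mset_filter)
  also have "\<dots> = card S" using finite_full_set by (simp add: full_positions[OF valid] S)
  finally have "even (length (filter (full \<circ> fst) xs))" using ev by simp
  then have "alt_sum (excess full h) ys = alt_sum (excess full h) xs" for h
    unfolding ys_def using alt_sum_strip by blast
  then show "alternating (length xs) h x =
      alternating (length ys) h (scale w)" for h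
    by (simp add: alt_sum_eq_sum pad xs(1)) (simp add: pad_def)
  show "fst (w k) = 0" if "k \<ge> length ys" for k
  proof -
    have "fst (scale w k) = 0" using that by (simp add: pad pad_def)
    then show ?thesis using l_pos by (simp add: scale_def)
  qed
qed

text \<open>A part of \<open>p + q\<close> is gray iff the part of \<open>q\<close> is odd, and it is odd iff exactly one of the two parts is odd.\<close>

lemma excess_scale_compose:
  "excess full (\<lambda>_. False) (scale (compose p q) k) = 2 * of_bool (odd (q k))"
  "excess full opposite (scale (compose p q) k) = 2 * of_bool (odd (p k))"
  using l_pos by (simp_all add: excess_def scale_def compose_def full_def)

lemma sum_tilt:
  assumes "\<And>k. k \<ge> M \<Longrightarrow> p k = 0"
  shows "(\<Sum>k<M. (- 1) ^ k * (2 * of_bool (odd (p k)))) = 2 * tilt p"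
proof -
  have "k < M" if "odd (p k)" for k using assms[of k] that by (cases "k < M") auto
  then have "{k. odd (p k)} = {..<M} \<inter> {k. odd (p k)}" by auto
  then have "tilt p = (\<Sum>k\<in>{..<M} \<inter> {k. odd (p k)}. (- 1) ^ k)" by (simp add: tilt_def)
  also have "\<dots> = (\<Sum>k<M. if odd (p k) then (- 1) ^ k else 0)" by (simp add: sum.inter_restrict)
  also have "2 * \<dots> = (\<Sum>k<M. (- 1) ^ k * (2 * of_bool (odd (p k))))"
    unfolding sum_distrib_left by (intro sum.cong) auto
  finally show ?thesis by simp
qed

lemma sum_positions_parts:
  assumes "x \<in> Pprime"
  shows "\<Sum>\<^sub># (positions (parts_mset x)) = psize (fst \<circ> x)"
  by (simp add: positions_def parts_mset_def psize_def multiset.map_comp sum_unfold_sum_mset comp_def)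

lemma positions_reduce: "positions (reduce F B) = filter_mset (\<lambda>s. \<not> F s) (positions B)"
  unfolding positions_def reduce_def multiset.map_comp filter_mset_image_mset
  by (simp add: comp_def case_prod_unfold)

lemma psize_split:
  assumes sp: "splits x S (compose p q)" and pq: "is_partition p" "is_partition q"
  shows "psize (fst \<circ> x) = \<Sum>S + l * (psize p + psize q)"
proof -
  define B where "B = parts_mset x"
  have x: "x \<in> Pprime" and w: "compose p q \<in> Pprime" and S: "full_set B = S"
    and red: "parts_mset (scale (compose p q)) = reduce full B" and B: "valid B"
    using sp columns_Pprime columns_iff_valid unfolding splits_def B_def by blast+
  have "positions B = filter_mset full (positions B) + positions (reduce full B)"
    by (simp add: positions_reduce)
  then have "\<Sum>\<^sub># (positions B) = \<Sum>\<^sub># (mset_set S) + \<Sum>\<^sub># (positions (reduce full B))"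
    unfolding full_positions[OF B] S by (metis sum_mset.union)
  also have "\<Sum>\<^sub># (mset_set S) = \<Sum>S" by (simp add: sum_unfold_sum_mset)
  also have "\<Sum>\<^sub># (positions (reduce full B)) = psize (fst \<circ> scale (compose p q))"
    unfolding red[symmetric] by (rule sum_positions_parts[OF scale_Pprime[OF w]])
  also have "fst \<circ> scale (compose p q) = (\<lambda>i. l * (p i + q i))"
    by (simp add: fun_eq_iff scale_def compose_def)
  also have "psize \<dots> = l * (psize p + psize q)"
  proof -
    define N where "N = conj_part p 0 + conj_part q 0"
    have z: "p i = 0" "q i = 0" if "i \<ge> N" for i
      using partition_zero_iff[OF pq(1), of i] partition_zero_iff[OF pq(2), of i] that by (simp_all add: N_def)
    have "psize p = sum p {..<N}" "psize q = sum q {..<N}" "psize (\<lambda>i. l * (p i + q i)) = (\<Sum>i<N. l * (p i + q i))"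
      using z by (auto intro!: psize_eq_sum)
    then show ?thesis by (simp add: sum.distrib flip: sum_distrib_left)
  qed
  finally show ?thesis using sum_positions_parts[OF x] by (simp add: B_def)
qed

text \<open>Balance makes the number of full columns even, so the alternating sums can be taken over the columns of the
  reduced wall, where they are twice the tilts.\<close>

lemma weight_splits_iff:
  assumes sp: "splits x S (compose p q)" and pq: "is_partition p" "is_partition q"
  shows "wt X \<Lambda> (wall_of x) = (\<lambda>i. - int m * delta X i) \<longleftrightarrow>
    balanced_set S \<and> \<Sum>S + l * (psize p + psize q) = L * m \<and> tilt q = 0 \<and> (\<not> twisted \<longrightarrow> tilt p = 0)"
proof -
  have x: "x \<in> columns" and S: "full_set (parts_mset x) = S" using sp by (auto simp: splits_def)
  have xP: "x \<in> Pprime" and valid: "valid (parts_mset x)"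
    using x columns_Pprime columns_iff_valid by blast+
  obtain xs where xs: "x = pad xs" "decreasing xs" "consistent (mset xs)" using Pprime_pad[OF xP] .
  have tail: "fst (x i) = 0" if "i \<ge> length xs" for i using that by (simp add: xs(1) pad_def)
  have residue: "card {k. k < length xs \<and> fst (x k) mod L = c} = residue_count (parts_mset x) c" if "full c" for c
  proof -
    have "c \<noteq> 0" using that not_full_0 by (auto intro!: gr0I)
    then have "{k. k < length xs \<and> fst (x k) mod L = c} = {k. fst (x k) \<noteq> 0 \<and> fst (x k) mod L = c}"
    proof (intro Collect_cong iffI conjI; elim conjE)
      fix k assume "fst (x k) \<noteq> 0"
      then show "k < length xs" using tail[of k] by (cases "k < length xs") auto
    next
      fix k assume "fst (x k) mod L = c"
      then show "fst (x k) \<noteq> 0" using \<open>c \<noteq> 0\<close> mod_0[of L] by metis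
    qed
    then show ?thesis by (simp only: residue_count_def size_filter_positions[OF xP])
  qed
  have "(\<forall>c\<in>{1..<n}. card {k. k < length xs \<and> fst (x k) mod L = c} =
      card {k. k < length xs \<and> fst (x k) mod L = L - c}) \<longleftrightarrow> balanced (parts_mset x)"
    unfolding balanced_def using residue runners_disjoint(4,5) by (intro ball_cong refl) simp
  also have "\<dots> \<longleftrightarrow> balanced_set S" using balanced_iff[OF valid] S by simp
  finally have bal: "(\<forall>c\<in>{1..<n}. card {k. k < length xs \<and> fst (x k) mod L = c} =
      card {k. k < length xs \<and> fst (x k) mod L = L - c}) \<longleftrightarrow> balanced_set S" .
  have "(\<Sum>k<length xs. fst (x k)) = psize (fst \<circ> x)"
    using tail by (subst psize_eq_sum[of "length xs"]) auto
  then have size: "(\<Sum>k<length xs. fst (x k)) = \<Sum>S + l * (psize p + psize q)"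
    using psize_split[OF sp pq] by simp
  have alt: "alternating (length xs) (\<lambda>_. False) x = 2 * tilt q"
    "alternating (length xs) opposite x = 2 * tilt p"
    if bS: "balanced_set S"
  proof -
    obtain M where M: "\<And>h. alternating (length xs) h x =
        alternating M h (scale (compose p q))"
      "\<And>k. k \<ge> M \<Longrightarrow> fst (compose p q k) = 0"
      using alternating_sum_scale[OF sp even_card_balanced[OF bS] xs] by metis
    have z: "p k = 0" "q k = 0" if "k \<ge> M" for k using M(2)[OF that] by (simp_all add: compose_def)
    show "alternating (length xs) (\<lambda>_. False) x = 2 * tilt q"
      "alternating (length xs) opposite x = 2 * tilt p"
      unfolding M(1) excess_scale_compose by (intro sum_tilt z; assumption)+
  qed
  show ?thesis
    using weight_iff[where N = "length xs" and m = m, OF x tail] alt unfolding bal size by auto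
qed

text \<open>The image of \<open>\<pi>\<close> with the sizes expressed by one equation, which fits both types.\<close>

definition targets :: "nat \<Rightarrow> ((nat \<Rightarrow> nat) list \<times> (nat \<Rightarrow> nat) \<times> (nat \<Rightarrow> nat)) set" where
  "targets m = {(ps, p, q). length ps = n - 1 \<and> (\<forall>r\<in>set ps. is_partition r) \<and>
     is_partition p \<and> is_partition q \<and> two_reduced q \<and> tilt q = 0 \<and> (\<not> twisted \<longrightarrow> tilt p = 0) \<and>
     L * sum_list (map psize ps) + l * (psize p + psize q) = L * m}"

abbreviation walls :: "nat \<Rightarrow> wall set" where
  "walls m \<equiv> proper_walls_wt X \<Lambda> (\<lambda>i. - int m * delta X i)"

lemma walls_wt_cases:
  assumes "Y \<in> walls m"
  obtains x S p q where "Y = wall_of x" "splits x S (compose p q)" "balanced_set S"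
    "is_partition p" "is_partition q" "two_reduced q"
    "\<Sum>S + l * (psize p + psize q) = L * m" "tilt q = 0" "\<not> twisted \<longrightarrow> tilt p = 0"
proof -
  have Y: "Y \<in> proper_walls X \<Lambda>" "wt X \<Lambda> Y = (\<lambda>i. - int m * delta X i)"
    using assms by (auto simp: proper_walls_wt_def)
  obtain x where x: "x \<in> columns" "Y = wall_of x" using proper_wall_of[OF Y(1)] by blast
  obtain S w where sp: "splits x S w" using splits_exist[OF x(1)] by blast
  then obtain p q where pq: "is_partition p" "is_partition q" "two_reduced q" "w = compose p q"
    using compose_surj unfolding splits_def by blast
  show ?thesis
    using that[OF x(2) sp[unfolded pq(4)] _ pq(1-3)] Y(2) weight_splits_iff[OF sp[unfolded pq(4)] pq(1,2)]
    unfolding x(2) by blast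
qed

lemma bij_pi_map: "bij_betw (pi_map X \<Lambda>) (walls m) (targets m)"
  unfolding bij_betw_def
proof (intro conjI equalityI)
  show "inj_on (pi_map X \<Lambda>) (walls m)"
  proof (rule inj_onI)
    fix Y Y' assume Y: "Y \<in> walls m"
      and Y': "Y' \<in> walls m" and eq: "pi_map X \<Lambda> Y = pi_map X \<Lambda> Y'"
    from Y obtain x S p q where 1: "Y = wall_of x" "splits x S (compose p q)" "balanced_set S"
      "is_partition p" "is_partition q" "two_reduced q" by (rule walls_wt_cases)
    from Y' obtain x' S' p' q' where 2: "Y' = wall_of x'" "splits x' S' (compose p' q')" "balanced_set S'"
      "is_partition p'" "is_partition q'" "two_reduced q'" by (rule walls_wt_cases)
    have "(frobenius_tuple S, p, q) = (frobenius_tuple S', p', q')"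
      using eq pi_map_wall_of[OF 1(2-6)] pi_map_wall_of[OF 2(2-6)] 1(1) 2(1) by simp
    then have "p = p'" "q = q'" "S = S'" using frobenius_tuple_inject[OF 1(3) 2(3)] by auto
    then show "Y = Y'" using splits_inject 1(1,2) 2(1,2) by blast
  qed
  show "pi_map X \<Lambda> ` walls m \<subseteq> targets m"
  proof (rule image_subsetI)
    fix Y assume "Y \<in> walls m"
    then obtain x S p q where 1: "Y = wall_of x" "splits x S (compose p q)" "balanced_set S"
      "is_partition p" "is_partition q" "two_reduced q"
      "\<Sum>S + l * (psize p + psize q) = L * m" "tilt q = 0" "\<not> twisted \<longrightarrow> tilt p = 0"
      by (rule walls_wt_cases)
    then show "pi_map X \<Lambda> Y \<in> targets m"
      using pi_map_wall_of[OF 1(2-6)] frobenius_tuple_partitions[OF 1(3)] by (simp add: targets_def)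
  qed
  show "targets m \<subseteq> pi_map X \<Lambda> ` walls m"
  proof
    fix t assume t: "t \<in> targets m"
    obtain ps p q where t_eq: "t = (ps, p, q)" by (cases t)
    have ps: "length ps = n - 1" "\<forall>r\<in>set ps. is_partition r"
      and pq: "is_partition p" "is_partition q" "two_reduced q"
      and tilt: "tilt q = 0" "\<not> twisted \<longrightarrow> tilt p = 0"
      and size: "L * sum_list (map psize ps) + l * (psize p + psize q) = L * m"
      using t by (auto simp: targets_def t_eq)
    obtain S where S: "balanced_set S" "frobenius_tuple S = ps" using frobenius_tuple_surj[OF ps] by blast
    obtain x where x: "splits x S (compose p q)"
      using splits_surj compose_in_Pprime[OF pq(1,2)] S(1) unfolding balanced_set_def by blast
    have "wt X \<Lambda> (wall_of x) = (\<lambda>i. - int m * delta X i)"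
      unfolding weight_splits_iff[OF x pq(1,2)]
      using S tilt size frobenius_tuple_partitions(3)[OF S(1)] by simp
    then have "wall_of x \<in> walls m"
      using wall_of_proper x by (simp add: proper_walls_wt_def splits_def)
    moreover have "pi_map X \<Lambda> (wall_of x) = t" using pi_map_wall_of[OF x S(1) pq] S(2) t_eq by simp
    ultimately show "t \<in> pi_map X \<Lambda> ` walls m" by blast
  qed
qed

end

text \<open>The size and the tilt have the parity of the number of odd parts.\<close>

lemma psize_even:
  assumes p: "is_partition p" and t: "tilt p = 0"
  shows "\<exists>k. psize p = 2 * k"
proof -
  have fin: "finite {i. p i \<noteq> 0}" using p by (simp add: is_partition_def)
  have odd: "{i \<in> {i. p i \<noteq> 0}. odd (p i)} = {i. odd (p i)}" by (auto intro: odd_pos)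
  have "even (psize p) \<longleftrightarrow> even (card {i. odd (p i)})"
    unfolding psize_def even_sum_iff[OF fin] odd ..
  also have "\<dots> \<longleftrightarrow> even (tilt p)"
    unfolding tilt_def even_sum_iff[OF finite_odd_parts[OF p]] by simp
  finally show ?thesis using t by auto
qed

lemma targets_A2:
  assumes "3 \<le> n" "\<Lambda> \<in> level1 (A2 n)"
  shows "bij_betw regroup (level1_data.targets (A2 n) m)
    (\<Union>(m1, m2) \<in> {(m1, m2). m1 + 2 * m2 = m}. multipartitions n m1 \<times> DP0 m2)" (is "bij_betw _ _ ?T")
proof -
  interpret level1_data "A2 n" \<Lambda> using assms by unfold_locales simp_all
  have tw: "twisted" by (simp add: twisted_def)
  have l: "0 < 2 * n - 1" using assms by simp
  have mem: "(ps, p, q) \<in> targets m \<longleftrightarrow> length ps = n - 1 \<and> (\<forall>r\<in>set ps. is_partition r) \<and>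
     is_partition p \<and> is_partition q \<and> two_reduced q \<and> tilt q = 0 \<and>
     sum_list (map psize ps) + psize p + psize q = m" for ps p q
    using tw l by (simp add: targets_def add.assoc flip: distrib_left)
  have target: "(qs, q) \<in> ?T \<longleftrightarrow> length qs = n \<and> (\<forall>r\<in>set qs. is_partition r) \<and>
     is_partition q \<and> two_reduced q \<and> tilt q = 0 \<and> sum_list (map psize qs) + psize q = m" for qs q
    using psize_even[of q] by (auto simp: multipartitions_def DP0_def P0_iff)
  show ?thesis
  proof (rule bij_betw_imageI)
    show "inj_on regroup (targets m)" by (rule inj_onI) auto
    show "regroup ` targets m = ?T"
    proof (intro equalityI subsetI)
      fix t assume "t \<in> regroup ` targets m"
      then obtain ps p q where t: "t = (ps @ [p], q)" "(ps, p, q) \<in> targets m" by auto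
      then show "t \<in> ?T" using assms(1) unfolding t(1) target mem by auto
    next
      fix t assume t: "t \<in> ?T"
      obtain qs q where tq: "t = (qs, q)" by (cases t)
      then have qs: "length qs = n" "\<forall>r\<in>set qs. is_partition r" "is_partition q \<and> two_reduced q \<and> tilt q = 0"
        "sum_list (map psize qs) + psize q = m" using t target by auto
      then have "qs \<noteq> []" using assms(1) by auto
      then obtain ps p where split: "qs = ps @ [p]" by (cases qs rule: rev_cases) auto
      then have "(ps, p, q) \<in> targets m" unfolding mem using qs by auto
      then show "t \<in> regroup ` targets m" using tq split by force
    qed
  qed
qed

lemma targets_D1:
  assumes "3 \<le> n" "\<Lambda> \<in> level1 (D1 n)"
  shows "level1_data.targets (D1 n) m =
    (\<Union>(m1, m2, m3) \<in> {(m1, m2, m3). m1 + m2 + m3 = m}. multipartitions (n - 1) m1 \<times> P0 m2 \<times> DP0 m3)"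
    (is "_ = ?T")
proof -
  interpret level1_data "D1 n" \<Lambda> using assms by unfold_locales simp_all
  have tw: "\<not> twisted" by (simp add: twisted_def)
  have size: "2 * n * a + n * (2 * b + 2 * c) = 2 * n * m \<longleftrightarrow> a + b + c = m" for a b c :: nat
  proof -
    have "2 * n * a + n * (2 * b + 2 * c) = 2 * n * (a + b + c)" by (simp add: algebra_simps)
    then show ?thesis using assms(1) by simp
  qed
  have "(ps, p, q) \<in> targets m \<longleftrightarrow> (ps, p, q) \<in> ?T" for ps p q
  proof
    assume t: "(ps, p, q) \<in> targets m"
    then obtain b c where "psize p = 2 * b" "psize q = 2 * c"
      using psize_even[of p] psize_even[of q] tw by (auto simp: targets_def)
    then show "(ps, p, q) \<in> ?T"
      using t tw size[of "sum_list (map psize ps)" b c]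
      by (auto simp: targets_def multipartitions_def DP0_def P0_iff)
  next
    assume "(ps, p, q) \<in> ?T"
    then obtain a b c where "a + b + c = m" "ps \<in> multipartitions (n - 1) a" "p \<in> P0 b" "q \<in> DP0 c"
      by auto
    then show "(ps, p, q) \<in> targets m"
      using size[of a b c] by (auto simp: targets_def multipartitions_def DP0_def P0_iff)
  qed
  then have "t \<in> targets m \<longleftrightarrow> t \<in> ?T" for t
    by (cases t) (simp only:)
  then show ?thesis by (rule set_eqI)
qed

theorem theorem5p11:
  shows "(\<forall>n\<ge>3. \<forall>\<Lambda> \<in> level1 (A2 n). \<forall>m::nat.
            bij_betw (regroup \<circ> pi_map (A2 n) \<Lambda>)
              (proper_walls_wt (A2 n) \<Lambda> (\<lambda>i. - int m * delta (A2 n) i))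
              (\<Union>(m1, m2) \<in> {(m1, m2). m1 + 2 * m2 = m}. multipartitions n m1 \<times> DP0 m2)) \<and>
         (\<forall>n\<ge>3. \<forall>\<Lambda> \<in> level1 (D1 n). \<forall>m::nat.
            bij_betw (pi_map (D1 n) \<Lambda>)
              (proper_walls_wt (D1 n) \<Lambda> (\<lambda>i. - int m * delta (D1 n) i))
              (\<Union>(m1, m2, m3) \<in> {(m1, m2, m3). m1 + m2 + m3 = m}.
                 multipartitions (n - 1) m1 \<times> P0 m2 \<times> DP0 m3))"
proof (intro conjI allI impI ballI)
  fix n \<Lambda> m :: nat assume n: "3 \<le> n" and \<Lambda>: "\<Lambda> \<in> level1 (A2 n)"
  interpret level1_data "A2 n" \<Lambda> using n \<Lambda> by unfold_locales simp_all
  show "bij_betw (regroup \<circ> pi_map (A2 n) \<Lambda>)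
      (proper_walls_wt (A2 n) \<Lambda> (\<lambda>i. - int m * delta (A2 n) i))
      (\<Union>(m1, m2) \<in> {(m1, m2). m1 + 2 * m2 = m}. multipartitions n m1 \<times> DP0 m2)"
    by (rule bij_betw_trans[OF bij_pi_map targets_A2[OF n \<Lambda>]])
next
  fix n \<Lambda> m :: nat assume n: "3 \<le> n" and \<Lambda>: "\<Lambda> \<in> level1 (D1 n)"
  interpret level1_data "D1 n" \<Lambda> using n \<Lambda> by unfold_locales simp_all
  show "bij_betw (pi_map (D1 n) \<Lambda>)
      (proper_walls_wt (D1 n) \<Lambda> (\<lambda>i. - int m * delta (D1 n) i))
      (\<Union>(m1, m2, m3) \<in> {(m1, m2, m3). m1 + m2 + m3 = m}. multipartitions (n - 1) m1 \<times> P0 m2 \<times> DP0 m3)"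
    using bij_pi_map unfolding targets_D1[OF n \<Lambda>] .
qed

end
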